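(* Let $\Sigma\subset\mathbb{R}^3$ be an immersed rotationally symmetric self-shrinking torus. Let $F(\Sigma)$ denote the entropy of $\Sigma$, let $r_{\min}$ be the smallest distance between a point on $\Sigma$ and the axis of rotation, and let $R$ be the largest distance between a point on $\Sigma$ and the origin. Let $i(\Sigma)$ denote the index of $\Sigma$, with the convention that the translation and dilation variations are excluded from the count. Then $$\frac{3\sqrt{2e}}{\pi}F(\Sigma)-7<i(\Sigma)<\frac{2}{\pi}\,\frac{F(\Sigma)}{r_{\min}}\,e^{R^2/4}\left(3+\frac{1}{r_{\min}}+2R\right)+2R-1.$$
   Context: Let $x$ denote the position vector in $\mathbb{R}^3$, with cylindrical coordinates $(r,\theta,z)$; the axis of rotation is $\{r=0\}$ and $|x|^2=r^2+z^2$. For an immersed oriented surface $\Sigma\subset\mathbb{R}^3$ with unit normal $\mathbf{n}$, write $v^\perp=\langle v,\mathbf{n}\rangle$, let $A_\Sigma(v,w)=(\nabla_v w)^\perp$ be the second fundamental form and $H_\Sigma=-\operatorname{tr}A_\Sigma$ the mean curvature. Mean curvature flow is $\dot x=-H_\Sigma\mathbf{n}$. $\Sigma$ is a self-shrinker if $\Sigma_t=\sqrt{-t}\,\Sigma$, $t<0$, is a mean curvature flow; equivalently $H_\Sigma=\frac12x^\perp$. A rotationally symmetric torus is one invariant under rotations about $\{r=0\}$, generated by rotating its cross-section $\Gamma$, an immersed closed curve in the open half-plane $\{(r,z):r>0\}$ (so it stays away from the axis). The $F$-functional is $F(\Sigma)=\frac{1}{4\pi}\int_\Sigma e^{-|x|^2/4}$.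 The entropy of $\Sigma$ is $\sup_{x_0\in\mathbb{R}^3,\,t_0>0}F(x_0+\sqrt{t_0}\,\Sigma)$; for a self-shrinker the entropy equals $F(\Sigma)$. The stability operator acting on functions $f\colon\Sigma\to\mathbb{R}$ is $L_\Sigma f=\mathcal{L}_\Sigma f+|A_\Sigma|^2f+\frac12f$, where $\mathcal{L}_\Sigma f=e^{|x|^2/4}\operatorname{div}_\Sigma(e^{-|x|^2/4}\operatorname{grad}_\Sigma f)$. Sign convention: $f\neq0$ is an eigenfunction of $L$ with eigenvalue $\lambda$ if $-Lf=\lambda f$. The index $i(\Sigma)$ is the number of negative eigenvalues of $L_\Sigma$ (counted with multiplicity), excluding those corresponding to translations (eigenfunctions $v^\perp$ for $v\in\mathbb{R}^3$, eigenvalue $-\frac12$) and dilation (eigenfunction $H_\Sigma$, eigenvalue $-1$). For a compact self-shrinker in $\mathbb{R}^3$ this is the number of negative eigenvalues minus $4$. *)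

theory Defs
  imports "HOL-Analysis.Analysis"
begin

subsection \<open>Smooth maps\<close>

primrec C_k :: "nat \<Rightarrow> ('a::euclidean_space \<Rightarrow> 'b::real_normed_vector) \<Rightarrow> bool" where
  "C_k 0 f \<longleftrightarrow> continuous_on UNIV f"
| "C_k (Suc k) f \<longleftrightarrow>
     f differentiable_on UNIV \<and> (\<forall>b\<in>Basis. C_k k (\<lambda>p. frechet_derivative f (at p) b))"

definition smooth :: "('a::euclidean_space \<Rightarrow> 'b::real_normed_vector) \<Rightarrow> bool" where
  "smooth f \<longleftrightarrow> (\<forall>k. C_k k f)"

definition partial :: "'n::finite \<Rightarrow> (real^'n \<Rightarrow> 'b::real_normed_vector) \<Rightarrow> real^'n \<Rightarrow> 'b" where
  "partial i f p = frechet_derivative f (at p) (axis i 1)"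


subsection \<open>Local geometry of a parametrized surface\<close>

text \<open>
  A surface is given by a map \<open>X\<close> from the coordinate plane to space.  Functions on the surface
  are functions of the coordinates, so at a self-intersection the sheets are kept apart.
\<close>

definition metric :: "(real^2 \<Rightarrow> real^3) \<Rightarrow> real^2 \<Rightarrow> real^2^2" where
  "metric X p = (\<chi> i j. partial i X p \<bullet> partial j X p)"

definition area_density :: "(real^2 \<Rightarrow> real^3) \<Rightarrow> real^2 \<Rightarrow> real" where
  "area_density X p = sqrt (det (metric X p))"

definition unit_normal :: "(real^2 \<Rightarrow> real^3) \<Rightarrow> real^2 \<Rightarrow> real^3" where
  "unit_normal X p = sgn (cross3 (partial 1 X p) (partial 2 X p))"

definition second_ff :: "(real^2 \<Rightarrow> real^3) \<Rightarrow> real^2 \<Rightarrow> real^2^2" where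
  "second_ff X p = (\<chi> i j. partial i (partial j X) p \<bullet> unit_normal X p)"

text \<open>The trace is taken with respect to the metric: \<open>H = - g\<^sup>i\<^sup>j A\<^sub>i\<^sub>j\<close>.\<close>

definition mean_curvature :: "(real^2 \<Rightarrow> real^3) \<Rightarrow> real^2 \<Rightarrow> real" where
  "mean_curvature X p = - trace (matrix_inv (metric X p) ** second_ff X p)"

text \<open>\<open>|A|\<^sup>2 = g\<^sup>i\<^sup>j A\<^sub>j\<^sub>k g\<^sup>k\<^sup>l A\<^sub>i\<^sub>l\<close>.\<close>

definition norm_A_squared :: "(real^2 \<Rightarrow> real^3) \<Rightarrow> real^2 \<Rightarrow> real" where
  "norm_A_squared X p =
     (let G = matrix_inv (metric X p); A = second_ff X p
      in trace (G ** A ** G ** transpose A))"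

text \<open>
  Tangent vector fields are represented by their components in the frame
  \<open>partial 1 X\<close>, \<open>partial 2 X\<close>.
\<close>

definition surface_grad :: "(real^2 \<Rightarrow> real^3) \<Rightarrow> (real^2 \<Rightarrow> real) \<Rightarrow> real^2 \<Rightarrow> real^2" where
  "surface_grad X f p = matrix_inv (metric X p) *v (\<chi> j. partial j f p)"

definition surface_div :: "(real^2 \<Rightarrow> real^3) \<Rightarrow> (real^2 \<Rightarrow> real^2) \<Rightarrow> real^2 \<Rightarrow> real" where
  "surface_div X V p =
     (\<Sum>i\<in>UNIV. partial i (\<lambda>q. area_density X q * V q $ i) p) / area_density X p"


subsection \<open>Self-shrinkers and the stability operator\<close>

definition self_shrinker :: "(real^2 \<Rightarrow> real^3) \<Rightarrow> bool" where
  "self_shrinker X \<longleftrightarrow> (\<forall>p. mean_curvature X p = (X p \<bullet> unit_normal X p) / 2)"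

definition drift_laplacian :: "(real^2 \<Rightarrow> real^3) \<Rightarrow> (real^2 \<Rightarrow> real) \<Rightarrow> real^2 \<Rightarrow> real" where
  "drift_laplacian X f p =
     exp ((norm (X p))\<^sup>2 / 4) *
     surface_div X (\<lambda>q. exp (- (norm (X q))\<^sup>2 / 4) *\<^sub>R surface_grad X f q) p"

definition stability_operator :: "(real^2 \<Rightarrow> real^3) \<Rightarrow> (real^2 \<Rightarrow> real) \<Rightarrow> real^2 \<Rightarrow> real" where
  "stability_operator X f p = drift_laplacian X f p + norm_A_squared X p * f p + f p / 2"


subsection \<open>Parametrized tori\<close>

text \<open>The domain of a torus is the plane modulo the lattice with period \<open>2 * pi\<close> in each coordinate.\<close>

definition doubly_periodic :: "(real^2 \<Rightarrow> 'b) \<Rightarrow> bool" where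
  "doubly_periodic f \<longleftrightarrow> (\<forall>p i. f (p + axis i (2 * pi)) = f p)"

definition F_functional :: "(real^2 \<Rightarrow> real^3) \<Rightarrow> real" where
  "F_functional X =
     integral (cbox 0 (\<chi> i. 2 * pi)) (\<lambda>p. exp (- (norm (X p))\<^sup>2 / 4) * area_density X p) / (4 * pi)"

definition entropy :: "(real^2 \<Rightarrow> real^3) \<Rightarrow> real" where
  "entropy X = Sup {F_functional (\<lambda>p. x0 + sqrt t0 *\<^sub>R X p) | x0 t0. t0 > 0}"

definition eigenspace :: "(real^2 \<Rightarrow> real^3) \<Rightarrow> real \<Rightarrow> (real^2 \<Rightarrow> real) set" where
  "eigenspace X lam =
     {f. smooth f \<and> doubly_periodic f \<and> (\<forall>p. - stability_operator X f p = lam * f p)}"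

text \<open>The span of the translation variations and the dilation variation.\<close>

definition trivial_variations :: "(real^2 \<Rightarrow> real^3) \<Rightarrow> (real^2 \<Rightarrow> real) set" where
  "trivial_variations X =
     {\<lambda>p. v \<bullet> unit_normal X p + c * mean_curvature X p | v c. True}"

text \<open>
  For linear spaces of functions \<open>V\<close> and \<open>W\<close>, the dimension (possibly infinite) of
  \<open>V / (V \<inter> W)\<close>: the largest number of elements of \<open>V\<close> linearly independent modulo \<open>W\<close>.
\<close>

definition dim_mod :: "('a \<Rightarrow> real) set \<Rightarrow> ('a \<Rightarrow> real) set \<Rightarrow> enat" where
  "dim_mod V W = Sup {enat k | k. \<exists>f :: nat \<Rightarrow> 'a \<Rightarrow> real. (\<forall>i<k. f i \<in> V) \<and>
     (\<forall>c :: nat \<Rightarrow> real. (\<lambda>p. \<Sum>i<k. c i * f i p) \<in> W \<longrightarrow> (\<forall>i<k. c i = 0))}"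

text \<open>
  Each negative eigenvalue is counted with its multiplicity, not counting the part of its
  eigenspace that consists of translation and dilation variations.
\<close>

definition index :: "(real^2 \<Rightarrow> real^3) \<Rightarrow> enat" where
  "index X = (\<Sum>\<^sub>\<infinity>lam\<in>{..<0}. dim_mod (eigenspace X lam) (trivial_variations X))"


subsection \<open>Rotationally symmetric tori\<close>

text \<open>An immersed closed curve \<open>\<gamma> = (r, z)\<close> in the open half-plane \<open>r > 0\<close>.\<close>

definition closed_half_plane_curve :: "(real \<Rightarrow> real \<times> real) \<Rightarrow> bool" where
  "closed_half_plane_curve \<gamma> \<longleftrightarrow>
     smooth \<gamma> \<and> (\<forall>s. \<gamma> (s + 2 * pi) = \<gamma> s) \<and>
     (\<forall>s. vector_derivative \<gamma> (at s) \<noteq> 0) \<and> (\<forall>s. fst (\<gamma> s) > 0)"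

definition torus_of_revolution :: "(real \<Rightarrow> real \<times> real) \<Rightarrow> real^2 \<Rightarrow> real^3" where
  "torus_of_revolution \<gamma> p =
     (let (r, z) = \<gamma> (p $ 1); \<theta> = p $ 2 in vector [r * cos \<theta>, r * sin \<theta>, z])"

definition rotation_axis :: "(real^3) set" where
  "rotation_axis = {x. x $ 1 = 0 \<and> x $ 2 = 0}"

definition min_axis_distance :: "(real^2 \<Rightarrow> real^3) \<Rightarrow> real" where
  "min_axis_distance X = (INF x\<in>range X. infdist x rotation_axis)"

definition max_origin_distance :: "(real^2 \<Rightarrow> real^3) \<Rightarrow> real" where
  "max_origin_distance X = (SUP x\<in>range X. norm x)"

end

theory Submission
  imports Defs "HOL-Library.Function_Algebras"
begin

text \<open>
  Let the cross-section have coordinates \<open>r\<close>, \<open>z\<close> and speed \<open>v\<close>, and put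
  \<open>w = r * exp (- (r\<^sup>2 + z\<^sup>2) / 4)\<close>.  Integrating over the rotation angle gives
  \<open>F(\<Sigma>) = L / 2\<close>, where \<open>L\<close> is the length of the cross-section in the conformal metric with
  length element \<open>w v ds\<close>, and the self-shrinker equation says that the cross-section is a closed
  geodesic of that metric.  The stability operator commutes with rotations.  On functions
  \<open>u(s) cos k\<theta>\<close> and \<open>u(s) sin k\<theta>\<close> the equation with eigenvalue \<open>l\<close> becomes, for \<open>g = w u\<close> and with
  \<open>'\<close> the derivative by conformal arc length,
  \<open>g'' + (V\<^sub>k + l / w\<^sup>2) g = 0\<close> with \<open>V\<^sub>k = (1 + (1 - k\<^sup>2) / r\<^sup>2) / w\<^sup>2\<close>
  (\<open>mode_sols_iff\<close>); for \<open>k = 0\<close> this is the Jacobi equation of the geodesic, and \<open>V\<^sub>0\<close> is the Gauss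
  curvature.

  The number \<open>N\<^sub>k\<close> of negative eigenvalues of such a periodic equation is compared with the case of a
  constant potential \<open>K\<^sup>2\<close>: it is less than \<open>K L / \<pi> + 1\<close> if \<open>V\<^sub>k \<le> K\<^sup>2\<close> and at least
  \<open>K L / \<pi> - 1\<close> if \<open>V\<^sub>k \<ge> K\<^sup>2\<close> (\<open>sum_mult_upper\<close>, \<open>sum_mult_lower\<close>).  The proof follows the polar
  angle of \<open>(g', g)\<close>.  A periodic solution exists exactly if the total rotation over one period, as a
  function of the initial direction, has a multiple \<open>2 \<pi> j\<close> of the full turn as its minimum or as its
  maximum.  The rotation increases strictly with \<open>l\<close>, so each of the two happens for at most one \<open>l\<close>,
  and by the intermediate value theorem it happens for a negative \<open>l\<close> whenever the rotation at
  \<open>l = 0\<close> exceeds \<open>2 \<pi> j\<close>.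

  Since smooth functions on the torus are determined by their Fourier coefficients in \<open>\<theta>\<close>, and since
  the translations and the dilation contribute four eigenfunctions in the modes 0 and 1, the index is
  \<open>N\<^sub>0 + 2 (N\<^sub>1 + N\<^sub>2 + \<dots>) - 4\<close> (\<open>index_eq\<close>).  For the lower bound, \<open>w\<^sup>2 \<le> 2 / e\<close> gives
  \<open>V\<^sub>0, V\<^sub>1 \<ge> e / 2\<close>, and only these modes are counted.  For the upper bound,
  \<open>w\<^sup>2 \<ge> r\<^sub>m\<^sub>i\<^sub>n\<^sup>2 exp (- R\<^sup>2 / 2)\<close> bounds every \<open>V\<^sub>k\<close>, and \<open>V\<^sub>k \<le> 0\<close> leaves no negative eigenvalue
  once \<open>k\<^sup>2 \<ge> 1 + R\<^sup>2\<close>.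

  It remains to see that the entropy is attained at the unit scale centred at the origin.  Along the
  path with centre \<open>e y\<close> and scale \<open>1 + a e\<^sup>2\<close>, \<open>0 \<le> e \<le> 1\<close>, the Gaussian area does not
  increase, because by the divergence theorem its derivative is minus the integral of a square
  (\<open>gaussian_first_variation\<close>).
\<close>

section \<open>Scalar differential equations with Lipschitz right-hand side\<close>

text \<open>
  A lower Gronwall estimate.  Where \<open>d\<close> is negative the hypothesis reads \<open>d' \<ge> K d\<close>, so
  \<open>exp (- K s) * d\<close> increases there and \<open>d\<close> cannot leave zero downwards.  Once \<open>d \<ge> 0\<close> is known,
  the hypothesis reads \<open>d' \<ge> - K d\<close>, so \<open>exp (K s) * d\<close> increases.
\<close>

lemma lipschitz_growth_lower:
  fixes d d' :: "real \<Rightarrow> real"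
  assumes der: "\<And>s. 0 \<le> s \<Longrightarrow> (d has_real_derivative d' s) (at s)"
    and low: "\<And>s. 0 \<le> s \<Longrightarrow> d' s \<ge> - K * \<bar>d s\<bar>"
    and d0: "d 0 \<ge> 0" and s: "0 \<le> s"
  shows "d s \<ge> d 0 * exp (- K * s)"
proof -
  have cont: "continuous_on {0..b} d" for b
    by (intro continuous_at_imp_continuous_on ballI DERIV_isCont[OF der]) auto
  have nonneg: "d t \<ge> 0" if t: "t \<ge> 0" for t
  proof (rule ccontr)
    assume neg: "\<not> d t \<ge> 0"
    define Z where "Z = {x \<in> {0..t}. d x \<in> {0..}}"
    have "Z = {0..t} \<inter> d -` {0..}" by (auto simp: Z_def)
    then have "closed Z" by (auto intro!: continuous_closed_preimage cont)
    moreover have "bounded Z" by (rule bounded_subset[of "{0..t}"]) (auto simp: Z_def)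
    ultimately have "compact Z" using compact_eq_bounded_closed by blast
    moreover have "0 \<in> Z" using t d0 by (auto simp: Z_def)
    ultimately obtain s0 where s0: "s0 \<in> Z" "\<And>x. x \<in> Z \<Longrightarrow> x \<le> s0"
      using compact_attains_sup[of Z] by blast
    have lt: "0 \<le> s0" "s0 < t" using s0(1) neg by (auto simp: Z_def order.order_iff_strict)
    have neg': "d x < 0" if "s0 < x" "x \<le> t" for x
      using s0(2)[of x] that lt by (force simp: Z_def)
    have "exp (- K * s0) * d s0 \<le> exp (- K * t) * d t"
    proof (rule DERIV_nonneg_imp_increasing_open[of s0 t])
      show "s0 \<le> t" using lt by simp
      fix x assume x: "s0 < x" "x < t"
      have "((\<lambda>x. exp (- K * x) * d x) has_real_derivative exp (- K * x) * (d' x - K * d x)) (at x)"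
        using x lt by (auto intro!: derivative_eq_intros der simp: algebra_simps)
      moreover have "d' x - K * d x \<ge> 0" using low[of x] neg'[of x] x lt by auto
      ultimately show "\<exists>y. ((\<lambda>x. exp (- K * x) * d x) has_real_derivative y) (at x) \<and> 0 \<le> y"
        by (intro exI[of _ "exp (- K * x) * (d' x - K * d x)"]) auto
    next
      show "continuous_on {s0..t} (\<lambda>x. exp (- K * x) * d x)"
        by (intro continuous_intros continuous_on_subset[OF cont[of t]]) (use lt in auto)
    qed
    moreover have "exp (- K * s0) * d s0 \<ge> 0" using s0(1) by (auto simp: Z_def)
    moreover have "exp (- K * t) * d t < 0" using neg by (simp add: mult_pos_neg)
    ultimately show False by linarith
  qed
  have "exp (K * 0) * d 0 \<le> exp (K * s) * d s"
  proof (rule DERIV_nonneg_imp_nondecreasing[OF s])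
    fix x assume x: "0 \<le> x" "x \<le> s"
    have "((\<lambda>x. exp (K * x) * d x) has_real_derivative exp (K * x) * (d' x + K * d x)) (at x)"
      using x by (auto intro!: derivative_eq_intros der simp: algebra_simps)
    moreover have "d' x + K * d x \<ge> 0" using low[of x] nonneg[of x] x by auto
    ultimately show "\<exists>y. ((\<lambda>x. exp (K * x) * d x) has_real_derivative y) (at x) \<and> 0 \<le> y"
      by (intro exI[of _ "exp (K * x) * (d' x + K * d x)"]) auto
  qed
  then have "exp (- K * s) * d 0 \<le> exp (- K * s) * (exp (K * s) * d s)"
    by (intro mult_left_mono) auto
  also have "\<dots> = d s" by (simp add: mult.assoc[symmetric] exp_add[symmetric])
  finally show ?thesis by (simp add: mult.commute)
qed

text \<open>
  A positive value would persist up to \<open>T\<close> by the preceding estimate started at \<open>s\<close>.  This makes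
  comparison of two solutions strict.
\<close>

lemma lipschitz_growth_zero:
  fixes d d' :: "real \<Rightarrow> real"
  assumes der: "\<And>s. 0 \<le> s \<Longrightarrow> (d has_real_derivative d' s) (at s)"
    and low: "\<And>s. 0 \<le> s \<Longrightarrow> d' s \<ge> - K * \<bar>d s\<bar>"
    and d0: "d 0 \<ge> 0" and T: "d T \<le> 0" "0 \<le> s" "s \<le> T"
  shows "d s = 0"
proof -
  have 1: "d s \<ge> 0" 
    using lipschitz_growth_lower[OF der low d0 T(2)] d0 by (smt (verit) exp_ge_zero mult_nonneg_nonneg)
  have "d (s + (T - s)) \<ge> d (s + 0) * exp (- K * (T - s))"
    using T 1 by (intro lipschitz_growth_lower[where d = "\<lambda>x. d (s + x)" and d' = "\<lambda>x. d' (s + x)"])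
      (auto intro!: der simp: add.commute[of s] DERIV_shift[symmetric] low[simplified])
  then have "d s * exp (- K * (T - s)) \<le> 0" using T by simp
  then show ?thesis using 1 by (simp add: mult_le_0_iff)
qed

lemma antiderivative_exists:
  fixes f :: "real \<Rightarrow> real"
  assumes "continuous_on UNIV f"
  shows "\<exists>G. G 0 = 0 \<and> (\<forall>s. (G has_real_derivative f s) (at s))"
proof -
  obtain G where G: "\<And>x. (G has_vector_derivative f x) (at x)"
    using einterval_antiderivative[of "-\<infinity>" "\<infinity>" f] assms
    by (auto simp: continuous_on_eq_continuous_at)
  have "((\<lambda>s. G s - G 0) has_real_derivative f s) (at s)" for s
    using G[of s] by (auto intro!: derivative_eq_intros simp: has_real_derivative_iff_has_vector_derivative)
  then show ?thesis by (intro exI[of _ "\<lambda>s. G s - G 0"]) auto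
qed

text \<open>
  The antiderivative on the whole line with value 0 at 0.  It avoids the case distinction that
  integrals over \<open>{0..s}\<close> need for negative \<open>s\<close>.
\<close>

definition antideriv :: "(real \<Rightarrow> real) \<Rightarrow> real \<Rightarrow> real" where
  "antideriv f = (SOME G. G 0 = 0 \<and> (\<forall>s. (G has_real_derivative f s) (at s)))"

lemma antideriv:
  assumes "continuous_on UNIV f"
  shows "antideriv f 0 = 0" "(antideriv f has_real_derivative f s) (at s)"
  using someI_ex[OF antiderivative_exists[OF assms]] by (auto simp: antideriv_def)

text \<open>
  The right-hand side of the hypothesis is the slope of \<open>C * exp (2 * K * s)\<close> for \<open>s \<ge> 0\<close>; negative
  \<open>s\<close> follow by reflection.
\<close>

lemma exp_weighted_bound:
  fixes D D' :: "real \<Rightarrow> real"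
  assumes der: "\<And>s. (D has_real_derivative D' s) (at s)" and D0: "D 0 = 0"
    and b: "\<And>s. \<bar>D' s\<bar> \<le> C * (2 * K) * exp (2 * K * \<bar>s\<bar>)" and K: "K > 0" and C: "C \<ge> 0"
  shows "\<bar>D s\<bar> \<le> C * exp (2 * K * \<bar>s\<bar>)"
proof -
  have pos: "\<bar>D s\<bar> \<le> C * exp (2 * K * s)" if s: "s \<ge> 0" 
    and der: "\<And>s. (D has_real_derivative D' s) (at s)" and D0: "D 0 = 0"
    and b: "\<And>s. s \<ge> 0 \<Longrightarrow> \<bar>D' s\<bar> \<le> C * (2 * K) * exp (2 * K * s)" for s and D D' :: "real \<Rightarrow> real"
  proof -
    have "C * exp (2 * K * 0) - D 0 \<le> C * exp (2 * K * s) - D s"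
    proof (rule DERIV_nonneg_imp_nondecreasing[OF s])
      fix x assume x: "0 \<le> x" "x \<le> s"
      show "\<exists>y. ((\<lambda>x. C * exp (2 * K * x) - D x) has_real_derivative y) (at x) \<and> 0 \<le> y"
        using b[of x] x by (intro exI[of _ "C * (2 * K) * exp (2 * K * x) - D' x"])
          (auto intro!: derivative_eq_intros der)
    qed
    moreover have "C * exp (2 * K * 0) + D 0 \<le> C * exp (2 * K * s) + D s"
    proof (rule DERIV_nonneg_imp_nondecreasing[OF s])
      fix x assume x: "0 \<le> x" "x \<le> s"
      show "\<exists>y. ((\<lambda>x. C * exp (2 * K * x) + D x) has_real_derivative y) (at x) \<and> 0 \<le> y"
        using b[of x] x by (intro exI[of _ "C * (2 * K) * exp (2 * K * x) + D' x"])
          (auto intro!: derivative_eq_intros der)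
    qed
    ultimately show ?thesis using D0 C by auto
  qed
  show ?thesis
  proof (cases "s \<ge> 0")
    case True
    then show ?thesis using pos[of s D D'] der D0 b by (metis abs_of_nonneg)
  next
    case False
    have "((\<lambda>x. D (- x)) has_real_derivative - D' (- x)) (at x)" for x
      using DERIV_mirror[of D "D' (-x)" "x"] der by auto
    then have "\<bar>D (- (- s))\<bar> \<le> C * exp (2 * K * (- s))"
      using b False D0 by (intro pos[where D' = "\<lambda>x. - D' (- x)"]) (auto, metis abs_minus_cancel abs_of_nonneg)
    then show ?thesis using False by simp
  qed
qed

text \<open>
  In the norm with weight \<open>exp (- 2 * K * \<bar>s\<bar>)\<close> the Picard map contracts by the factor \<open>1 / 2\<close> on
  the whole line at once, so that no continuation of local solutions is involved.  The fixed point
  \<open>z\<close> is the solution divided by \<open>wt\<close>; boundedness of \<open>F\<close> puts it into the Banach space of bounded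
  continuous functions.
\<close>

lemma lipschitz_ode_exists:
  fixes F :: "real \<Rightarrow> real \<Rightarrow> real"
  assumes cont: "continuous_on UNIV (\<lambda>(s, y). F s y)"
    and lip: "\<And>s y y'. \<bar>F s y - F s y'\<bar> \<le> K * \<bar>y - y'\<bar>" and K: "K > 0"
    and bound: "\<And>s y. \<bar>F s y\<bar> \<le> B"
  shows "\<exists>y. y 0 = a \<and> (\<forall>s. (y has_real_derivative F s (y s)) (at s))"
proof -
  define wt where "wt s = exp (2 * K * \<bar>s\<bar>)" for s
  have wt: "wt s \<ge> 1" "continuous_on UNIV wt" for s
    using K by (auto simp: wt_def intro!: continuous_intros)
  have wt0: "wt s > 0" for s using wt(1)[of s] by linarith
  define y where "y z s = wt s * apply_bcontfun z s" for z s
  have ycont: "continuous_on UNIV (\<lambda>s. F s (y z s))" for z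
  proof -
    have "continuous_on UNIV (\<lambda>s. (s, y z s))" unfolding y_def
      by (intro continuous_intros wt) auto
    from continuous_on_compose2[OF cont this] show ?thesis by simp
  qed
  define \<Phi> where "\<Phi> z s = (a + antideriv (\<lambda>s. F s (y z s)) s) / wt s" for z s
  have B: "B \<ge> 0" using bound[of 0 0] by linarith
  have \<Phi>_bcont: "\<Phi> z \<in> bcontfun" for z
  proof (rule bcontfun_normI)
    show "continuous_on UNIV (\<Phi> z)" unfolding \<Phi>_def
      using less_imp_neq[OF wt0]
      by (intro continuous_on_divide continuous_on_add continuous_on_const wt(2)
            continuous_at_imp_continuous_on ballI DERIV_isCont[OF antideriv(2)[OF ycont]]) metis
    fix s
    have "\<bar>antideriv (\<lambda>s. F s (y z s)) s\<bar> \<le> B / (2 * K) * exp (2 * K * \<bar>s\<bar>)"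
    proof (rule exp_weighted_bound[OF antideriv(2)[OF ycont] antideriv(1)[OF ycont]])
      fix s 
      have "\<bar>F s (y z s)\<bar> \<le> B * 1" using bound by simp
      also have "\<dots> \<le> B * wt s" using B wt by (intro mult_left_mono) auto
      finally show "\<bar>F s (y z s)\<bar> \<le> B / (2 * K) * (2 * K) * exp (2 * K * \<bar>s\<bar>)"
        using K by (simp add: wt_def)
    qed (use K B in auto)
    then have "\<bar>a + antideriv (\<lambda>s. F s (y z s)) s\<bar> \<le> \<bar>a\<bar> * 1 + B / (2 * K) * wt s" 
      unfolding wt_def by linarith
    also have "\<dots> \<le> \<bar>a\<bar> * wt s + B / (2 * K) * wt s" using wt by (intro add_right_mono mult_left_mono) auto
    finally show "norm (\<Phi> z s) \<le> \<bar>a\<bar> + B / (2 * K)"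
      using wt0[of s] by (simp add: \<Phi>_def abs_div divide_le_eq algebra_simps)
  qed
  define \<Psi> where "\<Psi> z = Bcontfun (\<Phi> z)" for z
  have \<Psi>: "apply_bcontfun (\<Psi> z) = \<Phi> z" for z
    unfolding \<Psi>_def by (rule Bcontfun_inverse[OF \<Phi>_bcont])
  have contr: "dist (\<Psi> z) (\<Psi> z') \<le> (1 / 2) * dist z z'" for z z'
  proof (rule dist_bound)
    fix s
    have "\<bar>antideriv (\<lambda>s. F s (y z s)) s - antideriv (\<lambda>s. F s (y z' s)) s\<bar> \<le> (dist z z' / 2) * exp (2 * K * \<bar>s\<bar>)"
    proof (rule exp_weighted_bound[where D' = "\<lambda>s. F s (y z s) - F s (y z' s)"])
      fix s
      show "((\<lambda>s. antideriv (\<lambda>s. F s (y z s)) s - antideriv (\<lambda>s. F s (y z' s)) s) has_real_derivative F s (y z s) - F s (y z' s)) (at s)"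
        by (intro DERIV_diff antideriv ycont)
      have "\<bar>F s (y z s) - F s (y z' s)\<bar> \<le> K * \<bar>y z s - y z' s\<bar>" by (rule lip)
      also have "\<bar>y z s - y z' s\<bar> = wt s * dist (apply_bcontfun z s) (apply_bcontfun z' s)"
        using wt0[of s] unfolding y_def dist_real_def by (metis abs_mult abs_of_pos right_diff_distrib)
      also have "K * \<dots> \<le> K * (wt s * dist z z')"
        using K wt0[of s] by (intro mult_left_mono dist_bounded) auto
      finally show "\<bar>F s (y z s) - F s (y z' s)\<bar> \<le> dist z z' / 2 * (2 * K) * exp (2 * K * \<bar>s\<bar>)"
        by (simp add: wt_def mult_ac)
    qed (use K in \<open>auto simp: antideriv(1)[OF ycont]\<close>)
    then show "dist (apply_bcontfun (\<Psi> z) s) (apply_bcontfun (\<Psi> z') s) \<le> 1 / 2 * dist z z'"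
      using wt0[of s] unfolding \<Psi> \<Phi>_def dist_real_def
      by (simp add: diff_divide_distrib[symmetric] abs_div divide_le_eq wt_def mult_ac)
  qed
  obtain z where z: "\<Psi> z = z"
    using banach_fix_type[of "1/2" \<Psi>] contr by auto
  have "wt s * \<Phi> z s = y z s" for s unfolding y_def using \<Psi>[of z] z by simp
  then have y_eq: "y z s = a + antideriv (\<lambda>s. F s (y z s)) s" for s
    using wt0[of s] unfolding \<Phi>_def by (metis less_irrefl nonzero_mult_div_cancel_left times_divide_eq_right)
  have "(y z has_real_derivative F s (y z s)) (at s)" for s
    by (subst y_eq[abs_def]) (auto intro!: derivative_eq_intros antideriv ycont)
  moreover have "y z 0 = a" using y_eq[of 0] antideriv(1)[OF ycont] by simp
  ultimately show ?thesis by blast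
qed

section \<open>Periodic functions\<close>

lemma periodic_int:
  fixes f :: "real \<Rightarrow> 'a"
  assumes "\<And>s. f (s + 2 * pi) = f s"
  shows "f (s + 2 * pi * of_int n) = f s"
proof -
  have nat: "f (s + 2 * pi * of_nat m) = f s" for m s
  proof (induction m)
    case (Suc m)
    then show ?case using assms[of "s + 2 * pi * of_nat m"] by (simp add: algebra_simps)
  qed simp
  show ?thesis
  proof (cases "n \<ge> 0")
    case True then show ?thesis using nat[of s "nat n"] by simp
  next
    case False then show ?thesis using nat[of "s + 2 * pi * of_int n" "nat (- n)"] by simp
  qed
qed

lemma periodic_reduce:
  fixes f :: "real \<Rightarrow> 'a"
  assumes "\<And>s. f (s + 2 * pi) = f s"
  obtains s' where "s' \<in> {0..2*pi}" "f s = f s'"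
proof -
  define n where "n = \<lfloor>s / (2 * pi)\<rfloor>"
  have "of_int n \<le> s / (2 * pi)" "s / (2 * pi) < of_int n + 1" unfolding n_def by linarith+
  then have "s - 2 * pi * of_int n \<in> {0..2*pi}" by (auto simp: field_simps)
  moreover have "f s = f (s - 2 * pi * of_int n)" 
    using periodic_int[of f "s - 2 * pi * of_int n" n] assms by simp
  ultimately show ?thesis using that by blast
qed

lemma periodic_attains_sup:
  fixes f :: "real \<Rightarrow> real"
  assumes "continuous_on UNIV f" "\<And>s. f (s + 2 * pi) = f s"
  shows "\<exists>s0. \<forall>s. f s \<le> f s0"
proof -
  have "continuous_on {0..2*pi} f" using assms(1) continuous_on_subset by blast
  then obtain s0 where s0: "\<forall>s\<in>{0..2*pi}. f s \<le> f s0"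
    using continuous_attains_sup[of "{0..2*pi}" f] by auto
  have "f s \<le> f s0" for s
    by (rule periodic_reduce[of f s, OF assms(2)]) (use s0 in auto)
  then show ?thesis by blast
qed

lemma periodic_bounded:
  fixes f :: "real \<Rightarrow> real"
  assumes "continuous_on UNIV f" "\<And>s. f (s + 2 * pi) = f s"
  shows "\<exists>B>0. \<forall>s. \<bar>f s\<bar> \<le> B"
proof -
  have "\<exists>s0. \<forall>s. \<bar>f s\<bar> \<le> \<bar>f s0\<bar>"
    by (rule periodic_attains_sup) (auto intro: continuous_on_rabs assms simp: assms(2))
  then obtain s0 where s0: "\<bar>f s\<bar> \<le> \<bar>f s0\<bar>" for s by blast
  show ?thesis
  proof (intro exI[of _ "\<bar>f s0\<bar> + 1"] conjI allI)
    show "\<bar>f s\<bar> \<le> \<bar>f s0\<bar> + 1" for s using s0[of s] by linarith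
  qed linarith
qed

lemma periodic_pos_bounded_below:
  fixes f :: "real \<Rightarrow> real"
  assumes "continuous_on UNIV f" "\<And>s. f (s + 2 * pi) = f s" "\<And>s. f s > 0"
  shows "\<exists>b>0. \<forall>s. f s \<ge> b"
proof -
  have "\<exists>s0. \<forall>s. - f s \<le> - f s0"
    by (rule periodic_attains_sup) (auto intro: continuous_on_minus assms simp: assms(2))
  then show ?thesis using assms(3) by auto
qed

lemma abs_sin_diff_le: "\<bar>sin x - sin y\<bar> \<le> \<bar>x - y\<bar>" for x y :: real
proof -
  have "\<bar>sin x - sin y\<bar> = 2 * \<bar>sin ((x - y) / 2)\<bar> * \<bar>cos ((x + y) / 2)\<bar>"
    by (simp add: sin_diff_sin abs_mult)
  also have "\<dots> \<le> 2 * \<bar>(x - y) / 2\<bar> * 1"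
    by (intro mult_mono abs_sin_x_le_abs_x) auto
  finally show ?thesis by simp
qed

lemma abs_sin_sq_diff_le: "\<bar>(sin x)\<^sup>2 - (sin y)\<^sup>2\<bar> \<le> 2 * \<bar>x - y\<bar>" for x y :: real
proof -
  have "\<bar>(sin x)\<^sup>2 - (sin y)\<^sup>2\<bar> = \<bar>sin x - sin y\<bar> * \<bar>sin x + sin y\<bar>"
    by (simp add: power2_eq_square abs_mult[symmetric] algebra_simps)
  also have "\<dots> \<le> \<bar>x - y\<bar> * 2"
    using abs_sin_le_one[of x] abs_sin_le_one[of y]
    by (intro mult_mono abs_sin_diff_le) (auto simp del: abs_sin_le_one)
  finally show ?thesis by simp
qed

section \<open>The rotation angle of a periodic Sturm-Liouville equation\<close>

text \<open>
  The coefficients stand for the first-order system \<open>g' = P h\<close>, \<open>h' = - (Q + l W) g\<close>, that is, for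
  the equation \<open>(g' / P)' + (Q + l W) g = 0\<close> with eigenvalue parameter \<open>l\<close>.
\<close>

locale sturm_liouville =
  fixes P Q W :: "real \<Rightarrow> real"
  assumes cont: "continuous_on UNIV P" "continuous_on UNIV Q" "continuous_on UNIV W"
    and per: "P (s + 2 * pi) = P s" "Q (s + 2 * pi) = Q s" "W (s + 2 * pi) = W s"
    and pos: "P s > 0" "W s > 0"
begin

text \<open>
  The rate of the angle \<open>y\<close> for solutions written as \<open>g = \<rho> sin y\<close>, \<open>h = \<rho> cos y\<close>.
\<close>

definition ang_rhs :: "real \<Rightarrow> real \<Rightarrow> real \<Rightarrow> real" where
  "ang_rhs l s y = P s * (cos y)\<^sup>2 + (Q s + l * W s) * (sin y)\<^sup>2"

lemma ang_rhs_alt: "ang_rhs l s y = P s + (Q s + l * W s - P s) * (sin y)\<^sup>2"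
  by (simp add: ang_rhs_def cos_squared_eq algebra_simps)

lemma ang_rhs_bounds_ex:
  "\<exists>K. K > 0 \<and>
    (\<forall>l s y y'. \<bar>l\<bar> \<le> \<Lambda> \<longrightarrow> \<bar>ang_rhs l s y - ang_rhs l s y'\<bar> \<le> K * \<bar>y - y'\<bar>) \<and>
    (\<forall>l s y. \<bar>l\<bar> \<le> \<Lambda> \<longrightarrow> \<bar>ang_rhs l s y\<bar> \<le> K) \<and>
    (\<forall>l l' s y. \<bar>ang_rhs l s y - ang_rhs l' s y\<bar> \<le> K * \<bar>l - l'\<bar>) \<and>
    (\<forall>l s. \<bar>l\<bar> \<le> \<Lambda> \<longrightarrow> \<bar>Q s + l * W s\<bar> \<le> K) \<and> (\<forall>s. P s \<le> K)"
proof -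
  obtain A where A: "A > 0" "\<And>s. \<bar>P s\<bar> \<le> A" using periodic_bounded[OF cont(1) per(1)] by blast
  obtain B where B: "B > 0" "\<And>s. \<bar>Q s\<bar> \<le> B" using periodic_bounded[OF cont(2) per(2)] by blast
  obtain C where C: "C > 0" "\<And>s. \<bar>W s\<bar> \<le> C" using periodic_bounded[OF cont(3) per(3)] by blast
  define D where "D = A + B + \<bar>\<Lambda>\<bar> * C"
  define K where "K = 2 * D + C"
  have D: "D \<ge> 0" "A \<le> D" using A B C by (auto simp: D_def)
  have DB: "B + \<bar>\<Lambda>\<bar> * C \<le> D" using A by (simp add: D_def)
  have Ql: "\<bar>Q s + l * W s\<bar> \<le> B + \<bar>\<Lambda>\<bar> * C" if "\<bar>l\<bar> \<le> \<Lambda>" for l s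
  proof -
    have "\<bar>Q s + l * W s\<bar> \<le> \<bar>Q s\<bar> + \<bar>l\<bar> * \<bar>W s\<bar>" by (metis abs_mult abs_triangle_ineq)
    also have "\<dots> \<le> B + \<bar>\<Lambda>\<bar> * C" using that by (intro add_mono mult_mono B C) auto
    finally show ?thesis .
  qed
  have QPl: "\<bar>Q s + l * W s - P s\<bar> \<le> D" if "\<bar>l\<bar> \<le> \<Lambda>" for l s
    using Ql[OF that, of s] A(2)[of s] unfolding D_def by linarith
  have sq: "0 \<le> (sin y)\<^sup>2" "(sin y)\<^sup>2 \<le> 1" for y :: real
    by (auto simp: abs_square_le_1)
  show ?thesis
  proof (intro exI[of _ K] conjI allI impI)
    show "K > 0" using C D A by (auto simp: K_def)
  next
    fix l s y y' :: real assume l: "\<bar>l\<bar> \<le> \<Lambda>"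
    have "\<bar>ang_rhs l s y - ang_rhs l s y'\<bar> = \<bar>Q s + l * W s - P s\<bar> * \<bar>(sin y)\<^sup>2 - (sin y')\<^sup>2\<bar>"
      unfolding ang_rhs_alt abs_mult[symmetric] by (simp add: algebra_simps)
    also have "\<dots> \<le> D * (2 * \<bar>y - y'\<bar>)" using QPl[OF l] D by (intro mult_mono abs_sin_sq_diff_le) auto
    also have "\<dots> \<le> K * \<bar>y - y'\<bar>" using C unfolding K_def by (simp add: mult_right_mono algebra_simps)
    finally show "\<bar>ang_rhs l s y - ang_rhs l s y'\<bar> \<le> K * \<bar>y - y'\<bar>" .
  next
    fix l s y :: real assume l: "\<bar>l\<bar> \<le> \<Lambda>"
    have "\<bar>ang_rhs l s y\<bar> \<le> \<bar>P s\<bar> + \<bar>Q s + l * W s - P s\<bar> * \<bar>(sin y)\<^sup>2\<bar>"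
      unfolding ang_rhs_alt by (metis abs_mult abs_triangle_ineq)
    also have "\<dots> \<le> A + D * 1" using sq by (intro add_mono mult_mono A QPl l D) auto
    also have "\<dots> \<le> K" using D C by (auto simp: K_def)
    finally show "\<bar>ang_rhs l s y\<bar> \<le> K" .
  next
    fix l s :: real assume l: "\<bar>l\<bar> \<le> \<Lambda>"
    show "\<bar>Q s + l * W s\<bar> \<le> K" using Ql[OF l, of s] D A(1) C(1) DB unfolding K_def by linarith
  next
    fix s show "P s \<le> K" using A(2)[of s] D C unfolding K_def by linarith
  next
    fix l l' s y
    have "ang_rhs l s y - ang_rhs l' s y = W s * (sin y)\<^sup>2 * (l - l')"
      unfolding ang_rhs_alt by (simp add: algebra_simps)
    then have "\<bar>ang_rhs l s y - ang_rhs l' s y\<bar> = \<bar>W s\<bar> * (sin y)\<^sup>2 * \<bar>l - l'\<bar>"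
      by (simp add: abs_mult)
    also have "\<dots> \<le> (C * 1) * \<bar>l - l'\<bar>" using sq C by (intro mult_mono) auto
    also have "\<dots> \<le> K * \<bar>l - l'\<bar>" unfolding K_def using D by (intro mult_right_mono) auto
    finally show "\<bar>ang_rhs l s y - ang_rhs l' s y\<bar> \<le> K * \<bar>l - l'\<bar>" .
  qed
qed

text \<open>
  One constant serves as bound and as Lipschitz constant, uniformly for \<open>\<bar>l\<bar> \<le> \<Lambda>\<close>.
\<close>

definition rate_bound :: "real \<Rightarrow> real" where
  "rate_bound \<Lambda> = (SOME K. K > 0 \<and>
    (\<forall>l s y y'. \<bar>l\<bar> \<le> \<Lambda> \<longrightarrow> \<bar>ang_rhs l s y - ang_rhs l s y'\<bar> \<le> K * \<bar>y - y'\<bar>) \<and>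
    (\<forall>l s y. \<bar>l\<bar> \<le> \<Lambda> \<longrightarrow> \<bar>ang_rhs l s y\<bar> \<le> K) \<and>
    (\<forall>l l' s y. \<bar>ang_rhs l s y - ang_rhs l' s y\<bar> \<le> K * \<bar>l - l'\<bar>) \<and>
    (\<forall>l s. \<bar>l\<bar> \<le> \<Lambda> \<longrightarrow> \<bar>Q s + l * W s\<bar> \<le> K) \<and> (\<forall>s. P s \<le> K))"

lemma rate_bound:
  shows rate_bound_pos: "rate_bound \<Lambda> > 0"
    and ang_rhs_lipschitz: "\<bar>l\<bar> \<le> \<Lambda> \<Longrightarrow> \<bar>ang_rhs l s y - ang_rhs l s y'\<bar> \<le> rate_bound \<Lambda> * \<bar>y - y'\<bar>"
    and ang_rhs_bound: "\<bar>l\<bar> \<le> \<Lambda> \<Longrightarrow> \<bar>ang_rhs l s y\<bar> \<le> rate_bound \<Lambda>"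
    and ang_rhs_lipschitz_param: "\<bar>ang_rhs l s y - ang_rhs l' s y\<bar> \<le> rate_bound \<Lambda> * \<bar>l - l'\<bar>"
    and coeff_bound: "\<bar>l\<bar> \<le> \<Lambda> \<Longrightarrow> \<bar>Q s + l * W s\<bar> \<le> rate_bound \<Lambda>"
    and P_bound: "P s \<le> rate_bound \<Lambda>"
  using someI_ex[OF ang_rhs_bounds_ex[of \<Lambda>], folded rate_bound_def] by blast+

lemma ang_rhs_cont: "continuous_on UNIV (\<lambda>(s, y). ang_rhs l s y)"
  unfolding ang_rhs_def case_prod_unfold
  by (intro continuous_intros continuous_on_compose2[OF cont(1)] continuous_on_compose2[OF cont(2)]
       continuous_on_compose2[OF cont(3)]) auto

definition ang :: "real \<Rightarrow> real \<Rightarrow> real \<Rightarrow> real" where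
  "ang l a = (SOME y. y 0 = a \<and> (\<forall>s. (y has_real_derivative ang_rhs l s (y s)) (at s)))"

lemma ang: "ang l a 0 = a" "(ang l a has_real_derivative ang_rhs l s (ang l a s)) (at s)"
proof -
  from lipschitz_ode_exists[OF ang_rhs_cont ang_rhs_lipschitz rate_bound_pos ang_rhs_bound, OF order_refl order_refl, of a l]
  have "ang l a 0 = a \<and> (\<forall>s. (ang l a has_real_derivative ang_rhs l s (ang l a s)) (at s))"
    unfolding ang_def by (rule someI_ex)
  then show "ang l a 0 = a" "(ang l a has_real_derivative ang_rhs l s (ang l a s)) (at s)" by auto
qed

lemma ang_rhs_mono: "l \<le> l' \<Longrightarrow> ang_rhs l s y \<le> ang_rhs l' s y"
  unfolding ang_rhs_def using pos(2)[of s] by (auto intro!: mult_right_mono)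

lemma ang_rhs_diff_low:
  assumes "l \<le> l'"
  shows "ang_rhs l' s y' - ang_rhs l s y \<ge> - rate_bound \<bar>l'\<bar> * \<bar>y' - y\<bar>"
  using ang_rhs_mono[OF assms, of s y] ang_rhs_lipschitz[of l' "\<bar>l'\<bar>" s y' y] by linarith

lemma ang_strict_mono:
  assumes "a < a'" "s \<ge> 0"
  shows "ang l a s < ang l a' s"
proof -
  define K where "K = rate_bound \<bar>l\<bar>"
  have K: "K > 0" "\<And>s y y'. ang_rhs l s y' - ang_rhs l s y \<ge> - K * \<bar>y' - y\<bar>"
    unfolding K_def by (rule rate_bound_pos ang_rhs_diff_low order_refl)+
  have "ang l a' s - ang l a s \<ge> (ang l a' 0 - ang l a 0) * exp (- K * s)"
    by (rule lipschitz_growth_lower[where d' = "\<lambda>s. ang_rhs l s (ang l a' s) - ang_rhs l s (ang l a s)"])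
       (use assms in \<open>auto intro!: derivative_eq_intros ang K[simplified] simp: ang(1)\<close>)
  moreover have "(ang l a' 0 - ang l a 0) * exp (- K * s) > 0" using assms by (simp add: ang)
  ultimately show ?thesis by linarith
qed

lemma ang_unique:
  assumes "y 0 = a" "\<And>s. s \<ge> 0 \<Longrightarrow> (y has_real_derivative ang_rhs l s (y s)) (at s)" "s \<ge> 0"
  shows "y s = ang l a s"
proof -
  define K where "K = rate_bound \<bar>l\<bar>"
  have K: "K > 0" "\<And>s y y'. ang_rhs l s y' - ang_rhs l s y \<ge> - K * \<bar>y' - y\<bar>"
    unfolding K_def by (rule rate_bound_pos ang_rhs_diff_low order_refl)+
  have "y s - ang l a s \<ge> (y 0 - ang l a 0) * exp (- K * s)"
    by (rule lipschitz_growth_lower[where d' = "\<lambda>s. ang_rhs l s (y s) - ang_rhs l s (ang l a s)"])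
       (use assms in \<open>auto intro!: derivative_eq_intros ang K[simplified] simp: ang(1)\<close>)
  moreover have "ang l a s - y s \<ge> (ang l a 0 - y 0) * exp (- K * s)"
    by (rule lipschitz_growth_lower[where d' = "\<lambda>s. ang_rhs l s (ang l a s) - ang_rhs l s (y s)"])
       (use assms in \<open>auto intro!: derivative_eq_intros ang K[simplified] simp: ang(1)\<close>)
  ultimately show ?thesis using assms by (simp add: ang)
qed

text \<open>
  The rate has period \<open>pi\<close> in the angle, as \<open>(g, h)\<close> and \<open>(- g, - h)\<close> solve the same system.
\<close>

lemma ang_shift: "s \<ge> 0 \<Longrightarrow> ang l (a + pi) s = ang l a s + pi"
  by (rule ang_unique[symmetric, where y = "\<lambda>s. ang l a s + pi"])
     (auto intro!: derivative_eq_intros ang simp: ang(1) ang_rhs_def)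

text \<open>
  The total rotation over one period of the solution with initial angle \<open>a\<close>.
\<close>

definition adv :: "real \<Rightarrow> real \<Rightarrow> real" where
  "adv l a = ang l a (2 * pi) - a"

lemma adv_shift: "adv l (a + pi) = adv l a"
  by (simp add: adv_def ang_shift)

lemma adv_shift_int: "adv l (a + pi * of_int n) = adv l a"
proof -
  have nat: "adv l (s + pi * of_nat m) = adv l s" for m s
  proof (induction m)
    case (Suc m)
    then show ?case using adv_shift[of l "s + pi * of_nat m"] by (simp add: algebra_simps)
  qed simp
  show ?thesis
  proof (cases "n \<ge> 0")
    case True then show ?thesis using nat[of a "nat n"] by simp
  next
    case False then show ?thesis using nat[of "a + pi * of_int n" "nat (- n)"] by simp
  qed
qed

lemma adv_reduce:
  obtains n :: int where "b \<le> a + pi * of_int n" "a + pi * of_int n < b + pi"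
proof -
  define n where "n = - \<lfloor>(a - b) / pi\<rfloor>"
  have "of_int (- n) \<le> (a - b) / pi" "(a - b) / pi < of_int (- n) + 1" unfolding n_def by linarith+
  then have "b \<le> a + pi * of_int n" "a + pi * of_int n < b + pi" by (auto simp: field_simps)
  then show ?thesis using that by blast
qed

lemma ang_mono: "a \<le> a' \<Longrightarrow> s \<ge> 0 \<Longrightarrow> ang l a s \<le> ang l a' s"
  using ang_strict_mono[of a a' s l] by (cases "a = a'") auto

text \<open>
  Modulo \<open>pi\<close> the initial angles differ by less than \<open>pi\<close>; by monotonicity in the initial angle, the
  final angles then are in the same order and also differ by less than \<open>pi\<close>.
\<close>

lemma adv_diff: "\<bar>adv l a - adv l b\<bar> < pi"
proof -
  obtain n :: int where n: "b \<le> a + pi * of_int n" "a + pi * of_int n < b + pi" using adv_reduce by blast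
  have "ang l b (2 * pi) \<le> ang l (a + pi * of_int n) (2 * pi)" by (intro ang_mono n) simp
  moreover have "ang l (a + pi * of_int n) (2 * pi) < ang l (b + pi) (2 * pi)" by (intro ang_strict_mono n) simp
  moreover have "ang l (b + pi) (2 * pi) = ang l b (2 * pi) + pi" by (rule ang_shift) simp
  ultimately have "\<bar>adv l (a + pi * of_int n) - adv l b\<bar> < pi" 
    using n unfolding adv_def by linarith
  then show ?thesis by (simp only: adv_shift_int)
qed

text \<open>
  Comparison of the rates gives the weak inequality.  Equality would make the two angles agree over
  the whole period, which forces the sine to vanish where the two rates must coincide.
\<close>

lemma adv_strict_mono:
  assumes "l < l'"
  shows "adv l a < adv l' a"
proof (rule ccontr)
  assume neg: "\<not> adv l a < adv l' a"
  define K where "K = rate_bound \<bar>l'\<bar>"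
  have K: "K > 0" "\<And>s y y'. ang_rhs l' s y' - ang_rhs l s y \<ge> - K * \<bar>y' - y\<bar>"
    unfolding K_def by (rule rate_bound_pos ang_rhs_diff_low less_imp_le[OF assms])+
  have der: "((\<lambda>s. ang l' a s - ang l a s) has_real_derivative 
    ang_rhs l' s (ang l' a s) - ang_rhs l s (ang l a s)) (at s)" for s
    by (auto intro!: derivative_eq_intros ang)
  have eq: "ang l' a s - ang l a s = 0" if "0 \<le> s" "s \<le> 2 * pi" for s
    by (rule lipschitz_growth_zero[where d' = "\<lambda>s. ang_rhs l' s (ang l' a s) - ang_rhs l s (ang l a s)" and T = "2 * pi"])
       (use that neg in \<open>auto intro!: der K[simplified] simp: ang(1) adv_def\<close>)
  have sin0: "sin (ang l a s) = 0" if s: "0 < s" "s < 2 * pi" for s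
  proof -
    have "((\<lambda>s. ang l' a s - ang l a s) has_real_derivative 0) (at s)"
      by (rule has_field_derivative_transform_within_open[where S = "{0<..<2*pi}", OF DERIV_const[where k = 0]])
         (use s eq in auto)
    with der[of s] have "ang_rhs l' s (ang l' a s) - ang_rhs l s (ang l a s) = 0"
      using DERIV_unique by blast
    moreover have "ang l' a s = ang l a s" using eq[of s] s by auto
    ultimately have "(l' - l) * W s * (sin (ang l a s))\<^sup>2 = 0" by (simp add: ang_rhs_def algebra_simps)
    then show ?thesis using assms pos(2)[of s] by simp
  qed
  \<comment> \<open>So the angle is locally constant, although its rate is \<open>P > 0\<close> where the sine vanishes.\<close>
  have "((\<lambda>s. sin (ang l a s)) has_real_derivative 0) (at 1)"
    by (rule has_field_derivative_transform_within_open[where S = "{0<..<2*pi}", OF DERIV_const[where k = 0]])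
       (use sin0 pi_gt3 in auto)
  moreover have "((\<lambda>s. sin (ang l a s)) has_real_derivative cos (ang l a 1) * ang_rhs l 1 (ang l a 1)) (at 1)"
    by (auto intro!: derivative_eq_intros ang)
  ultimately have "cos (ang l a 1) * ang_rhs l 1 (ang l a 1) = 0" using DERIV_unique by blast
  moreover have s1: "sin (ang l a 1) = 0" using sin0[of 1] pi_gt3 by auto
  then have "cos (ang l a 1) \<noteq> 0" by (metis cos_zero_iff_int2 sin_zero_abs_cos_one zero_neq_one abs_zero)
  ultimately show False using pos(1)[of 1] s1 by (auto simp: ang_rhs_def)
qed

text \<open>
  A solution crosses the ray \<open>g = 0\<close> only upwards, since there the angle has rate \<open>P > 0\<close>.
\<close>

lemma adv_zero_pos: "adv l 0 > 0"
proof (rule ccontr)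
  assume neg: "\<not> adv l 0 > 0"
  define K where "K = rate_bound \<bar>l\<bar>"
  have K: "K > 0" "\<And>s. \<bar>Q s + l * W s\<bar> \<le> K"
    unfolding K_def by (rule rate_bound_pos coeff_bound order_refl)+
  have low: "ang_rhs l s y \<ge> - K * \<bar>y\<bar>" for s y
  proof -
    have "\<bar>(Q s + l * W s) * (sin y)\<^sup>2\<bar> = \<bar>Q s + l * W s\<bar> * \<bar>sin y\<bar> * \<bar>sin y\<bar>"
      by (simp add: abs_mult power2_eq_square)
    also have "\<dots> \<le> K * \<bar>y\<bar> * 1" using K by (intro mult_mono abs_sin_x_le_abs_x) auto
    finally show ?thesis using pos(1)[of s] unfolding ang_rhs_def
      by (smt (verit) mult_nonneg_nonneg zero_le_power2 minus_mult_left)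
  qed
  have eq: "ang l 0 s = 0" if "0 \<le> s" "s \<le> 2 * pi" for s
    by (rule lipschitz_growth_zero[where d' = "\<lambda>s. ang_rhs l s (ang l 0 s)" and T = "2 * pi"])
       (use that neg in \<open>auto intro!: ang low[simplified] simp: ang(1) adv_def\<close>)
  have "(ang l 0 has_real_derivative 0) (at 1)"
    by (rule has_field_derivative_transform_within_open[where S = "{0<..<2*pi}", OF DERIV_const[where k = 0]])
       (use eq pi_gt3 in auto)
  with ang(2)[of l 0 1] have "ang_rhs l 1 (ang l 0 1) = 0" using DERIV_unique by blast
  then show False using eq[of 1] pos(1)[of 1] pi_gt3 by (auto simp: ang_rhs_def)
qed

text \<open>
  If \<open>Q + l W < 0\<close>, a solution crosses the ray \<open>h = 0\<close> only downwards, since there the angle has rate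
  \<open>Q + l W\<close>.
\<close>

lemma adv_neg:
  "\<exists>\<Lambda>>0. adv (- \<Lambda>) (pi / 2) < 0 \<and> (\<forall>a. adv (- \<Lambda>) a < pi)"
proof -
  obtain B where B: "B > 0" "\<And>s. \<bar>Q s\<bar> \<le> B" using periodic_bounded[OF cont(2) per(2)] by blast
  obtain w where w: "w > 0" "\<And>s. W s \<ge> w" using periodic_pos_bounded_below[OF cont(3) per(3) pos(2)] by blast
  define \<Lambda> where "\<Lambda> = (B + 1) / w"
  have neg: "Q s + - \<Lambda> * W s < 0" for s
  proof -
    have "\<Lambda> * w \<le> \<Lambda> * W s" using w B by (intro mult_left_mono) (auto simp: \<Lambda>_def)
    moreover have "\<Lambda> * w = B + 1" using w by (simp add: \<Lambda>_def)
    ultimately show ?thesis using B(2)[of s] by linarith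
  qed
  define K where "K = rate_bound 0"
  have K: "K > 0" "\<And>s. P s \<le> K"
    unfolding K_def by (rule rate_bound_pos P_bound)+
  have low: "- ang_rhs (- \<Lambda>) s y \<ge> - K * \<bar>pi / 2 - y\<bar>" for s y
  proof -
    have "P s * (cos y)\<^sup>2 = P s * \<bar>sin (pi / 2 - y)\<bar> * \<bar>sin (pi / 2 - y)\<bar>"
      by (simp add: cos_sin_eq power2_eq_square)
    also have "\<dots> \<le> K * \<bar>pi / 2 - y\<bar> * 1" 
      using K pos(1)[of s] by (intro mult_mono abs_sin_x_le_abs_x) (auto simp: less_imp_le)
    finally show ?thesis using neg[of s] unfolding ang_rhs_def
      by (smt (verit) mult_nonpos_nonneg zero_le_power2 minus_mult_left)
  qed
  have 1: "adv (- \<Lambda>) (pi / 2) < 0"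
  proof (rule ccontr)
    assume neg': "\<not> adv (- \<Lambda>) (pi / 2) < 0"
    have eq: "pi / 2 - ang (- \<Lambda>) (pi / 2) s = 0" if "0 \<le> s" "s \<le> 2 * pi" for s
      by (rule lipschitz_growth_zero[where d' = "\<lambda>s. - ang_rhs (- \<Lambda>) s (ang (- \<Lambda>) (pi / 2) s)" and T = "2 * pi"])
         (use that neg' in \<open>auto intro!: ang low[simplified] derivative_eq_intros simp: ang(1) adv_def\<close>)
    have "(ang (- \<Lambda>) (pi / 2) has_real_derivative 0) (at 1)"
      by (rule has_field_derivative_transform_within_open[where S = "{0<..<2*pi}", OF DERIV_const[where k = "pi / 2"]])
         (use eq pi_gt3 in auto)
    with ang(2)[of "-\<Lambda>" "pi / 2" 1] have "ang_rhs (- \<Lambda>) 1 (ang (- \<Lambda>) (pi / 2) 1) = 0" using DERIV_unique by blast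
    moreover have "ang (- \<Lambda>) (pi / 2) 1 = pi / 2" using eq[of 1] pi_gt3 by auto
    ultimately show False using neg[of 1] by (auto simp: ang_rhs_def)
  qed
  show ?thesis
  proof (intro exI[of _ \<Lambda>] conjI allI)
    fix a
    show "adv (- \<Lambda>) a < pi" using adv_diff[of "- \<Lambda>" a "pi / 2"] 1 by linarith
  qed (use 1 B w in \<open>auto simp: \<Lambda>_def\<close>)
qed

text \<open>
  The difference of two angles stays below the majorant \<open>m\<close>, which solves the corresponding linear
  equation.
\<close>

lemma ang_lipschitz:
  "\<exists>C>0. \<forall>l l' a a'. \<bar>l\<bar> \<le> \<Lambda> \<longrightarrow> \<bar>l'\<bar> \<le> \<Lambda> \<longrightarrow> \<bar>adv l a - adv l' a'\<bar> \<le> C * (\<bar>l - l'\<bar> + \<bar>a - a'\<bar>)"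
proof -
  define K where "K = rate_bound \<Lambda>"
  have K: "K > 0" 
    "\<And>l s y y'. \<bar>l\<bar> \<le> \<Lambda> \<Longrightarrow> \<bar>ang_rhs l s y - ang_rhs l s y'\<bar> \<le> K * \<bar>y - y'\<bar>"
    "\<And>l l' s y. \<bar>ang_rhs l s y - ang_rhs l' s y\<bar> \<le> K * \<bar>l - l'\<bar>"
    unfolding K_def by (rule rate_bound_pos ang_rhs_lipschitz ang_rhs_lipschitz_param, assumption?)+
  define C where "C = (2 * pi * K + 1) * exp (K * (2 * pi)) + 1"
  have one: "ang l a (2 * pi) - ang l' a' (2 * pi) \<le> (\<bar>a - a'\<bar> + K * \<bar>l - l'\<bar> * (2 * pi)) * exp (K * (2 * pi))"
    if l: "\<bar>l\<bar> \<le> \<Lambda>" "\<bar>l'\<bar> \<le> \<Lambda>" for l l' a a'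
  proof -
    define m where "m s = (\<bar>a - a'\<bar> + K * \<bar>l - l'\<bar> * s) * exp (K * s)" for s
    define d where "d s = m s - (ang l a s - ang l' a' s)" for s
    define d' where "d' s = K * \<bar>l - l'\<bar> * exp (K * s) + K * m s - (ang_rhs l s (ang l a s) - ang_rhs l' s (ang l' a' s))" for s
    have "d (2 * pi) \<ge> d 0 * exp (- K * (2 * pi))"
    proof (rule lipschitz_growth_lower[where d' = d'])
      fix s :: real assume s: "0 \<le> s"
      show "(d has_real_derivative d' s) (at s)"
        unfolding d_def m_def d'_def by (auto intro!: derivative_eq_intros ang simp: algebra_simps)
      have m: "m s \<ge> 0" using K s by (auto simp: m_def)
      have "ang_rhs l s (ang l a s) - ang_rhs l' s (ang l' a' s) \<le> K * \<bar>ang l a s - ang l' a' s\<bar> + K * \<bar>l - l'\<bar>"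
        using K(2)[OF l(1), of s "ang l a s" "ang l' a' s"] K(3)[of l s "ang l' a' s" l'] by linarith
      moreover have "K * \<bar>l - l'\<bar> * 1 \<le> K * \<bar>l - l'\<bar> * exp (K * s)" 
        using K s by (intro mult_left_mono) auto
      moreover have "K * \<bar>ang l a s - ang l' a' s\<bar> \<le> K * (\<bar>d s\<bar> + m s)"
        using K m unfolding d_def by (intro mult_left_mono) auto
      ultimately show "- K * \<bar>d s\<bar> \<le> d' s" unfolding d'_def by (simp add: algebra_simps)
    qed (auto simp: d_def m_def ang)
    moreover have "d 0 \<ge> 0" by (auto simp: d_def m_def ang)
    ultimately have "d (2 * pi) \<ge> 0" by (meson dual_order.trans exp_ge_zero mult_nonneg_nonneg)
    then show ?thesis by (simp add: d_def m_def)
  qed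
  show ?thesis
  proof (intro exI[of _ C] conjI allI impI)
    show "C > 0" using K by (auto simp: C_def intro!: add_nonneg_pos)
  next
    fix l l' a a' assume l: "\<bar>l\<bar> \<le> \<Lambda>" "\<bar>l'\<bar> \<le> \<Lambda>"
    define E where "E = exp (K * (2 * pi))"
    have E: "E \<ge> 0" by (simp add: E_def)
    have "\<bar>ang l a (2 * pi) - ang l' a' (2 * pi)\<bar> \<le> (\<bar>a - a'\<bar> + K * \<bar>l - l'\<bar> * (2 * pi)) * E"
      using one[OF l, of a a'] one[OF l(2,1), of a' a] unfolding E_def by (simp add: abs_minus_commute abs_le_iff)
    moreover have "\<bar>adv l a - adv l' a'\<bar> \<le> \<bar>ang l a (2 * pi) - ang l' a' (2 * pi)\<bar> + \<bar>a - a'\<bar>"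
      unfolding adv_def by linarith
    moreover have "C * (\<bar>l - l'\<bar> + \<bar>a - a'\<bar>) = (\<bar>a - a'\<bar> + K * \<bar>l - l'\<bar> * (2 * pi)) * E + \<bar>a - a'\<bar> 
       + (2 * pi * K * \<bar>a - a'\<bar> * E + \<bar>l - l'\<bar> * E + \<bar>l - l'\<bar>)"
      unfolding C_def E_def[symmetric] by (simp add: algebra_simps)
    moreover have "2 * pi * K * \<bar>a - a'\<bar> * E + \<bar>l - l'\<bar> * E + \<bar>l - l'\<bar> \<ge> 0" using K E by auto
    ultimately show "\<bar>adv l a - adv l' a'\<bar> \<le> C * (\<bar>l - l'\<bar> + \<bar>a - a'\<bar>)" by linarith
  qed
qed

lemma adv_continuous: "continuous_on (S \<times> {-\<Lambda>..\<Lambda>}) (\<lambda>(a, l). adv l a)"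
proof -
  obtain C where C: "C > 0" 
    "\<And>l l' a a'. \<bar>l\<bar> \<le> \<Lambda> \<Longrightarrow> \<bar>l'\<bar> \<le> \<Lambda> \<Longrightarrow> \<bar>adv l a - adv l' a'\<bar> \<le> C * (\<bar>l - l'\<bar> + \<bar>a - a'\<bar>)"
    using ang_lipschitz[of \<Lambda>] by blast
  show ?thesis
  proof (rule continuous_onI)
    fix x :: "real \<times> real" and e :: real assume x: "x \<in> S \<times> {-\<Lambda>..\<Lambda>}" and e: "e > 0"
    obtain a l where xal: "x = (a, l)" by fastforce
    show "\<exists>d>0. \<forall>x'\<in>S \<times> {-\<Lambda>..\<Lambda>}. dist x' x < d \<longrightarrow> dist (case x' of (a, l) \<Rightarrow> adv l a) (case x of (a, l) \<Rightarrow> adv l a) \<le> e"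
    proof (intro exI[of _ "e / (2 * C)"] conjI ballI impI)
      show "e / (2 * C) > 0" using e C by simp
      fix x' assume x': "x' \<in> S \<times> {-\<Lambda>..\<Lambda>}" "dist x' x < e / (2 * C)"
      obtain a' l' where xal': "x' = (a', l')" by fastforce
      have "\<bar>l' - l\<bar> \<le> dist x' x" "\<bar>a' - a\<bar> \<le> dist x' x"
        using dist_snd_le[of x' x] dist_fst_le[of x' x] by (auto simp: xal xal' dist_real_def)
      then have "C * (\<bar>l' - l\<bar> + \<bar>a' - a\<bar>) \<le> C * (e / (2 * C) + e / (2 * C))"
        using C x'(2) by (intro mult_left_mono) auto
      also have "\<dots> = e" using C by (simp add: field_simps)
      finally show "dist (case x' of (a, l) \<Rightarrow> adv l a) (case x of (a, l) \<Rightarrow> adv l a) \<le> e"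
        using C(2)[of l' l a' a] x x'(1) by (auto simp: xal xal' dist_real_def abs_le_iff)
    qed
  qed
qed

text \<open>
  If \<open>Q = P\<close> and \<open>l = 0\<close>, every angle has rate \<open>P\<close>, so every direction turns by exactly \<open>len\<close>.
\<close>

definition len :: real where "len = antideriv P (2 * pi)"

lemma len_pos: "len > 0"
proof -
  have "antideriv P 0 < antideriv P (2 * pi)"
    by (rule DERIV_pos_imp_increasing) (use antideriv(2)[OF cont(1)] pos(1) in auto)
  then show ?thesis by (simp add: len_def antideriv(1)[OF cont(1)])
qed

lemma adv_le_len:
  assumes "\<And>s. Q s \<le> P s"
  shows "adv 0 a \<le> len"
proof -
  have "antideriv P 0 - ang 0 a 0 \<le> antideriv P (2 * pi) - ang 0 a (2 * pi)"
  proof (rule DERIV_nonneg_imp_nondecreasing[where f = "\<lambda>s. antideriv P s - ang 0 a s"])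
    fix s
    have "ang_rhs 0 s (ang 0 a s) \<le> P s" 
      unfolding ang_rhs_alt using assms[of s] by (simp add: mult_nonpos_nonneg)
    then show "\<exists>y. ((\<lambda>s. antideriv P s - ang 0 a s) has_real_derivative y) (at s) \<and> 0 \<le> y"
      by (intro exI[of _ "P s - ang_rhs 0 s (ang 0 a s)"]) 
         (auto intro!: derivative_eq_intros ang antideriv cont)
  qed simp
  then show ?thesis by (simp add: len_def adv_def ang antideriv(1)[OF cont(1)])
qed

lemma adv_ge_len:
  assumes "\<And>s. Q s \<ge> P s"
  shows "adv 0 a \<ge> len"
proof -
  have "ang 0 a 0 - antideriv P 0 \<le> ang 0 a (2 * pi) - antideriv P (2 * pi)"
  proof (rule DERIV_nonneg_imp_nondecreasing[where f = "\<lambda>s. ang 0 a s - antideriv P s"])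
    fix s
    have "ang_rhs 0 s (ang 0 a s) \<ge> P s" 
      unfolding ang_rhs_alt using assms[of s] by simp
    then show "\<exists>y. ((\<lambda>s. ang 0 a s - antideriv P s) has_real_derivative y) (at s) \<and> 0 \<le> y"
      by (intro exI[of _ "ang_rhs 0 s (ang 0 a s) - P s"]) 
         (auto intro!: derivative_eq_intros ang antideriv cont)
  qed simp
  then show ?thesis by (simp add: len_def adv_def ang antideriv(1)[OF cont(1)])
qed

end

section \<open>Dimensions of spaces of functions\<close>

text \<open>
  Real-valued functions on a set as a vector space under pointwise operations, so that the results on
  bases and dimension apply to spaces of solutions and to eigenspaces alike.
\<close>

interpretation fs: vector_space "\<lambda>(c::real) (f::'a \<Rightarrow> real) x. c * f x"
  by unfold_locales (auto simp: fun_eq_iff algebra_simps)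

text \<open>
  As a predicate, since a numerical dimension would be 0 for infinite-dimensional spaces too.
\<close>

definition has_dim :: "('a \<Rightarrow> real) set \<Rightarrow> nat \<Rightarrow> bool" where
  "has_dim V n \<longleftrightarrow> (\<exists>B. finite B \<and> fs.independent B \<and> fs.span B = V \<and> card B = n)"

lemma has_dim_unique:
  assumes "has_dim V m" "has_dim V n"
  shows "m = n"
proof -
  have "m = fs.dim V" if "has_dim V m" for m
    using that fs.dim_span_eq_card_independent unfolding has_dim_def by metis
  then show ?thesis using assms by metis
qed

lemma sum_fun_eq: "(\<Sum>v\<in>S. F v) = (\<lambda>x. \<Sum>v\<in>S. F v x)" for F :: "'i \<Rightarrow> 'a \<Rightarrow> real"
  by (induction S rule: infinite_finite_induct) (auto simp: fun_eq_iff)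

lemma fs_independent_iff:
  assumes "finite B"
  shows "fs.independent B \<longleftrightarrow> (\<forall>u. (\<lambda>x. \<Sum>v\<in>B. u v * v x) = (\<lambda>_. 0) \<longrightarrow> (\<forall>v\<in>B. u v = 0))"
  unfolding fs.dependent_finite[OF assms] sum_fun_eq by (auto simp: zero_fun_def)

lemma fs_span_finite:
  assumes "finite B"
  shows "fs.span B = {\<lambda>x. \<Sum>v\<in>B. u v * v x |u. True}"
  unfolding fs.span_finite[OF assms] sum_fun_eq by auto

lemma has_dim_family:
  fixes f :: "'i \<Rightarrow> 'a \<Rightarrow> real"
  assumes fin: "finite I" 
    and ind: "\<And>c. (\<lambda>x. \<Sum>i\<in>I. c i * f i x) = (\<lambda>_. 0) \<Longrightarrow> \<forall>i\<in>I. c i = 0"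
    and V: "V = {\<lambda>x. \<Sum>i\<in>I. c i * f i x |c. True}"
  shows "has_dim V (card I)"
proof -
  have inj: "inj_on f I"
  proof (rule inj_onI, rule ccontr)
    fix i j assume ij: "i \<in> I" "j \<in> I" "f i = f j" "i \<noteq> j"
    have "(\<lambda>x. \<Sum>k\<in>I. (if k = i then 1 else if k = j then - 1 else 0) * f k x) = (\<lambda>_. 0)"
    proof
      fix x
      have "(\<Sum>k\<in>I. (if k = i then 1 else if k = j then - 1 else 0) * f k x) = 
         (\<Sum>k\<in>I. (if k = i then f i x else 0) + (if k = j then - f j x else 0))"
        using ij(4) by (intro sum.cong) auto
      also have "\<dots> = f i x - f j x" using fin ij by (simp add: sum.distrib)
      finally show "(\<Sum>k\<in>I. (if k = i then 1 else if k = j then - 1 else 0) * f k x) = 0" using ij by simp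
    qed
    from ind[OF this] ij show False by auto
  qed
  have sum_fun: "(\<Sum>v\<in>f ` I. u v * v x) = (\<Sum>i\<in>I. u (f i) * f i x)" for u x
    by (subst sum.reindex[OF inj]) simp
  have "fs.independent (f ` I)"
    unfolding fs_independent_iff[OF finite_imageI[OF fin]] sum_fun
  proof (intro allI impI ballI)
    fix u v assume "(\<lambda>x. \<Sum>i\<in>I. u (f i) * f i x) = (\<lambda>_. 0)" "v \<in> f ` I"
    then show "u v = 0" using ind[of "\<lambda>i. u (f i)"] by auto
  qed
  moreover have "fs.span (f ` I) = V"
    unfolding fs_span_finite[OF finite_imageI[OF fin]] sum_fun V
  proof (intro set_eqI iffI; clarsimp)
    fix c
    have "(\<lambda>x. \<Sum>i\<in>I. c i * f i x) = (\<lambda>x. \<Sum>i\<in>I. c (the_inv_into I f (f i)) * f i x)"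
      by (intro ext sum.cong) (auto simp: the_inv_into_f_f[OF inj])
    then show "\<exists>u. (\<lambda>x. \<Sum>i\<in>I. c i * f i x) = (\<lambda>x. \<Sum>i\<in>I. u (f i) * f i x)"
      by (intro exI[of _ "\<lambda>v. c (the_inv_into I f v)"])
  qed auto
  ultimately show ?thesis unfolding has_dim_def
    by (intro exI[of _ "f ` I"]) (auto simp: fin card_image inj)
qed

lemma has_dim_0: "has_dim {\<lambda>_. 0} 0"
  using has_dim_family[of "{}" undefined "{\<lambda>_. 0}"] by auto

lemma has_dim_1:
  assumes "f \<noteq> (\<lambda>_. 0)" "V = {\<lambda>x. c * f x |c. True}"
  shows "has_dim V 1"
proof -
  have "has_dim V (card {()})"
  proof (rule has_dim_family[where f = "\<lambda>_. f"])
    fix c :: "unit \<Rightarrow> real" assume "(\<lambda>x. \<Sum>i\<in>{()}. c i * f x) = (\<lambda>_. 0)"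
    then show "\<forall>i\<in>{()}. c i = 0" using assms(1) by (auto simp: fun_eq_iff)
  next
    have "\<exists>c'. (\<lambda>x. c * f x) = (\<lambda>x. c' () * f x)" for c by (rule exI[of _ "\<lambda>_. c"]) simp
    then show "V = {\<lambda>x. \<Sum>i\<in>{()}. c i * f x |c. True}" unfolding assms(2) by auto
  qed auto
  then show ?thesis by simp
qed

lemma has_dim_2:
  assumes "\<And>a b. (\<lambda>x. a * f x + b * g x) = (\<lambda>_. 0) \<Longrightarrow> a = 0 \<and> b = 0" "V = {\<lambda>x. a * f x + b * g x |a b. True}"
  shows "has_dim V 2"
proof -
  have eq: "(\<Sum>i\<in>UNIV. c i * (if i then f else g) x) = c True * f x + c False * g x" for c :: "bool \<Rightarrow> real" and x
    by (simp add: UNIV_bool)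
  have "V = {\<lambda>x. \<Sum>i\<in>UNIV. c i * (if i then f else g) x |c. True}"
    unfolding assms(2) eq
  proof (intro subset_antisym subsetI)
    fix h assume "h \<in> {\<lambda>x. a * f x + b * g x |a b. True}"
    then obtain a b where "h = (\<lambda>x. a * f x + b * g x)" by blast
    then have "h = (\<lambda>x. (if True then a else b) * f x + (if False then a else b) * g x)" by simp
    then show "h \<in> {\<lambda>x. c True * f x + c False * g x |c. True}" by (intro CollectI exI[of _ "\<lambda>i. if i then a else b"]) simp
  qed blast
  moreover have "\<forall>i\<in>UNIV. c i = 0" if "(\<lambda>x. \<Sum>i\<in>UNIV. c i * (if i then f else g) x) = (\<lambda>_. 0)" for c :: "bool \<Rightarrow> real"
    using assms(1)[OF that[unfolded eq]] by (auto simp: all_bool_eq)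
  ultimately have "has_dim V (card (UNIV :: bool set))"
    by (intro has_dim_family[where f = "\<lambda>i. if i then f else g"]) auto
  then show ?thesis by simp
qed

lemma has_dim_subspace: "has_dim V n \<Longrightarrow> fs.subspace V"
  unfolding has_dim_def by auto

lemma has_dim_mono:
  assumes "has_dim V m" "has_dim U n" "V \<subseteq> U"
  shows "m \<le> n"
proof -
  obtain B C where B: "fs.independent B" "card B = m" "fs.span B = V" "finite C" "fs.span C = U" "card C = n"
    using assms unfolding has_dim_def by blast
  have "B \<subseteq> fs.span C" using fs.span_superset[of B] B assms by auto
  then show ?thesis using fs.independent_span_bound[OF B(4,1)] B by auto
qed

lemma has_dim_extend:
  assumes "has_dim V n" "fs.independent T" "T \<subseteq> V"
  obtains B where "T \<subseteq> B" "finite B" "fs.independent B" "fs.span B = V" "card B = n"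
proof -
  obtain B where B: "T \<subseteq> B" "B \<subseteq> V" "fs.independent B" "V \<subseteq> fs.span B"
    using fs.maximal_independent_subset_extend[OF assms(3,2)] by blast
  obtain B' where B': "finite B'" "fs.span B' = V" "card B' = n" using assms(1) unfolding has_dim_def by blast
  have fin: "finite B" using fs.independent_span_bound[OF B'(1) B(3)] B B' by auto
  have "fs.span B = V" using B fs.span_subspace has_dim_subspace[OF assms(1)] by blast
  moreover have "card B = n" 
    using has_dim_unique[OF assms(1), of "card B"] B(3) fin calculation unfolding has_dim_def by blast
  ultimately show ?thesis using that B fin by blast
qed

text \<open>
  Extend a basis of \<open>V \<inter> W\<close> to a basis of \<open>V\<close>: the added vectors are independent modulo \<open>W\<close>.
  Conversely, vectors of \<open>V\<close> that are independent modulo \<open>W\<close> remain independent together with a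
  basis of \<open>V \<inter> W\<close>.
\<close>

lemma dim_mod_eq:
  assumes V: "has_dim V n" and VW: "has_dim (V \<inter> W) m" and W: "fs.subspace W"
  shows "dim_mod V W = enat (n - m)"
proof -
  obtain T where T: "finite T" "fs.independent T" "fs.span T = V \<inter> W" "card T = m"
    using VW unfolding has_dim_def by blast
  have TV: "T \<subseteq> V" "T \<subseteq> W" using T(3) fs.span_superset[of T] by auto
  obtain B where B: "T \<subseteq> B" "finite B" "fs.independent B" "fs.span B = V" "card B = n"
    using has_dim_extend[OF V T(2) TV(1)] by blast
  define C where "C = B - T"
  have C: "finite C" "card C = n - m" using B T by (auto simp: C_def card_Diff_subset)
  obtain f where f: "bij_betw f {..<n - m} C"
    using ex_bij_betw_nat_finite[OF C(1)] C(2) by (auto simp: atLeast0LessThan)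
  have lower: "(\<forall>i<n - m. f i \<in> V) \<and> (\<forall>c. (\<lambda>p. \<Sum>i<n - m. c i * f i p) \<in> W \<longrightarrow> (\<forall>i<n - m. c i = 0))"
  proof (intro conjI allI impI)
    fix i assume "i < n - m" 
    then have "f i \<in> B" using f by (auto simp: bij_betw_def C_def)
    then show "f i \<in> V" using B fs.span_superset[of B] by auto
  next
    fix c i assume cW: "(\<lambda>p. \<Sum>i<n - m. c i * f i p) \<in> W" and i: "i < n - m"
    define c' where "c' v = c (the_inv_into {..<n - m} f v)" for v
    have c'f: "c' (f j) = c j" if "j < n - m" for j
      using f that unfolding c'_def bij_betw_def by (simp add: the_inv_into_f_f)
    have eq: "(\<Sum>i<n - m. c i * f i p) = (\<Sum>v\<in>C. c' v * v p)" for p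
    proof -
      have "(\<Sum>v\<in>C. c' v * v p) = (\<Sum>i<n - m. c' (f i) * f i p)"
        using f by (auto simp: bij_betw_def sum.reindex)
      also have "\<dots> = (\<Sum>i<n - m. c i * f i p)" using c'f by (intro sum.cong) auto
      finally show ?thesis by simp
    qed
    have "(\<lambda>p. \<Sum>v\<in>C. c' v * v p) \<in> fs.span C" unfolding fs_span_finite[OF C(1)] by auto
    then have "(\<lambda>p. \<Sum>v\<in>C. c' v * v p) \<in> V" using fs.span_mono[of C B] B C_def by auto
    with cW have "(\<lambda>p. \<Sum>v\<in>C. c' v * v p) \<in> fs.span T" unfolding T(3) eq by auto
    then obtain u where u: "(\<lambda>p. \<Sum>v\<in>C. c' v * v p) = (\<lambda>p. \<Sum>v\<in>T. u v * v p)"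
      unfolding fs_span_finite[OF T(1)] by auto
    have "(\<lambda>p. \<Sum>v\<in>B. (if v \<in> T then - u v else c' v) * v p) = (\<lambda>_. 0)"
    proof
      fix p
      have "(\<Sum>v\<in>B. (if v \<in> T then - u v else c' v) * v p) = 
         (\<Sum>v\<in>C. (if v \<in> T then - u v else c' v) * v p) + (\<Sum>v\<in>T. (if v \<in> T then - u v else c' v) * v p)"
        unfolding C_def by (rule sum.subset_diff[OF B(1,2)])
      also have "\<dots> = (\<Sum>v\<in>C. c' v * v p) + (\<Sum>v\<in>T. - (u v * v p))"
        by (intro arg_cong2[where f = "(+)"] sum.cong) (auto simp: C_def)
      also have "\<dots> = 0" using fun_cong[OF u, of p] by (simp add: sum_negf)
      finally show "(\<Sum>v\<in>B. (if v \<in> T then - u v else c' v) * v p) = 0" .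
    qed
    then have "\<forall>v\<in>B. (if v \<in> T then - u v else c' v) = 0"
      by (rule B(3)[unfolded fs_independent_iff[OF B(2)], THEN spec, THEN mp])
    moreover have "f i \<in> C" using f i by (auto simp: bij_betw_def)
    ultimately have "c' (f i) = 0" unfolding C_def by auto
    then show "c i = 0" using c'f[OF i] by simp
  qed
  have upper: "k \<le> n - m" if k: "\<forall>i<k. f i \<in> V" 
    "\<forall>c. (\<lambda>p. \<Sum>i<k. c i * f i p) \<in> W \<longrightarrow> (\<forall>i<k. c i = 0)" for k and f :: "nat \<Rightarrow> 'a \<Rightarrow> real"
  proof -
    define g where "g = case_sum f (\<lambda>v. v)"
    define I where "I = {..<k} <+> T"
    have fin: "finite I" using T by (simp add: I_def)
    have sumI: "(\<Sum>i\<in>I. c i * g i x) = (\<Sum>i<k. c (Inl i) * f i x) + (\<Sum>v\<in>T. c (Inr v) * v x)" for c x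
      unfolding I_def g_def using T(1) by (subst sum.Plus) auto
    have Tspan: "(\<lambda>x. \<Sum>v\<in>T. u v * v x) \<in> V \<inter> W" for u
      using fs_span_finite[OF T(1)] T(3) by auto
    have dimI: "has_dim {\<lambda>x. \<Sum>i\<in>I. c i * g i x |c. True} (card I)"
    proof (rule has_dim_family[OF fin _ refl])
      fix c assume c: "(\<lambda>x. \<Sum>i\<in>I. c i * g i x) = (\<lambda>_. 0)"
      have "(\<lambda>x. \<Sum>i<k. c (Inl i) * f i x) = (\<lambda>x. \<Sum>v\<in>T. (- c (Inr v)) * v x)"
        using fun_cong[OF c] unfolding sumI by (auto simp: fun_eq_iff sum_negf eq_neg_iff_add_eq_0)
      with Tspan[of "\<lambda>v. - c (Inr v)"] have "(\<lambda>x. \<Sum>i<k. c (Inl i) * f i x) \<in> W" by simp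
      with k(2) have 1: "\<forall>i<k. c (Inl i) = 0" by (elim allE[where x = "\<lambda>i. c (Inl i)"]) simp
      then have "(\<lambda>x. \<Sum>v\<in>T. c (Inr v) * v x) = (\<lambda>_. 0)"
        using fun_cong[OF c] unfolding sumI by (auto simp: fun_eq_iff)
      then have "\<forall>v\<in>T. c (Inr v) = 0" 
        using T(2) unfolding fs_independent_iff[OF T(1)] by (elim allE[where x = "\<lambda>v. c (Inr v)"]) simp
      with 1 show "\<forall>i\<in>I. c i = 0" by (auto simp: I_def)
    qed
    have "(\<lambda>x. \<Sum>i\<in>I. c i * g i x) \<in> V" for c
    proof -
      have sub: "fs.subspace V" by (rule has_dim_subspace[OF V])
      have "(\<Sum>i<k. (\<lambda>x. c (Inl i) * f i x)) \<in> V"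
        using k(1) by (intro fs.subspace_sum[OF sub] fs.subspace_scale[OF sub]) auto
      then have "(\<lambda>x. \<Sum>i<k. c (Inl i) * f i x) + (\<lambda>x. \<Sum>v\<in>T. c (Inr v) * v x) \<in> V"
        using Tspan[of "\<lambda>v. c (Inr v)"] unfolding sum_fun_eq by (intro fs.subspace_add[OF sub]) auto
      then show ?thesis unfolding sumI by (simp add: plus_fun_def)
    qed
    then have "card I \<le> n" by (intro has_dim_mono[OF dimI V]) auto
    moreover have "card I = k + m" unfolding I_def using T by (simp add: card_Plus)
    ultimately show ?thesis by simp
  qed
  show ?thesis unfolding dim_mod_def
  proof (rule antisym)
    show "Sup {enat k |k. \<exists>f. (\<forall>i<k. f i \<in> V) \<and> (\<forall>c. (\<lambda>p. \<Sum>i<k. c i * f i p) \<in> W \<longrightarrow> (\<forall>i<k. c i = 0))}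
      \<le> enat (n - m)"
      by (rule Sup_least) (use upper in auto)
    show "enat (n - m) \<le> Sup {enat k |k. \<exists>f. (\<forall>i<k. f i \<in> V) \<and> (\<forall>c. (\<lambda>p. \<Sum>i<k. c i * f i p) \<in> W \<longrightarrow> (\<forall>i<k. c i = 0))}"
      by (rule Sup_upper) (use lower in auto)
  qed
qed

lemma infsum_enat_finite:
  fixes f :: "'a \<Rightarrow> enat"
  assumes "finite F" "F \<subseteq> A" "\<And>x. x \<in> A - F \<Longrightarrow> f x = 0"
  shows "infsum f A = sum f F"
proof -
  have "infsum f A = infsum f F"
    by (rule infsum_cong_neutral) (use assms in auto)
  then show ?thesis using assms by (simp add: infsum_finite)
qed

section \<open>Periodic solutions and the monodromy matrix\<close>

lemma quadratic_form_semidefinite: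
  fixes A B C :: real
  assumes "B\<^sup>2 = 4 * A * C"
  shows "(\<forall>x y. A * y\<^sup>2 + B * x * y + C * x\<^sup>2 \<ge> 0) \<or> (\<forall>x y. A * y\<^sup>2 + B * x * y + C * x\<^sup>2 \<le> 0)"
proof (cases "A = 0")
  case True
  then have "B = 0" using assms by simp
  then show ?thesis using True by (cases "C \<ge> 0") (auto simp: mult_nonneg_nonneg mult_nonpos_nonneg)
next
  case False
  have eq: "A * (A * y\<^sup>2 + B * x * y + C * x\<^sup>2) = (A * y + B * x / 2)\<^sup>2" for x y
  proof -
    have "4 * (A * (A * y\<^sup>2 + B * x * y + C * x\<^sup>2)) = 4 * (A * y)\<^sup>2 + 4 * (A * y) * (B * x) + (4 * A * C) * x\<^sup>2"
      by (simp add: power2_eq_square algebra_simps)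
    also have "\<dots> = 4 * (A * y + B * x / 2)\<^sup>2" unfolding assms[symmetric] by (simp add: power2_eq_square algebra_simps)
    finally show ?thesis by simp
  qed
  have "A * (A * y\<^sup>2 + B * x * y + C * x\<^sup>2) \<ge> 0" for x y unfolding eq by simp
  then show ?thesis using False by (cases "A > 0") (auto simp: zero_le_mult_iff)
qed

lemma quadratic_form_discriminant:
  fixes A B C :: real
  assumes "\<And>x y. A * y\<^sup>2 + B * x * y + C * x\<^sup>2 \<ge> 0"
  shows "B\<^sup>2 \<le> 4 * A * C"
proof -
  have A: "A \<ge> 0" using assms[of 1 0] by simp
  have C: "C \<ge> 0" using assms[of 0 1] by simp
  have 1: "A * (4 * A * C - B\<^sup>2) \<ge> 0" using assms[of "- B" "2 * A"] by (simp add: power2_eq_square algebra_simps)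
  have 2: "C * (4 * A * C - B\<^sup>2) \<ge> 0" using assms[of "2 * C" "- B"] by (simp add: power2_eq_square algebra_simps)
  show ?thesis
  proof (cases "A = 0 \<and> C = 0")
    case True
    then have "B = 0" using assms[of 1 1] assms[of "-1" 1] by simp
    then show ?thesis using True by simp
  next
    case False
    then show ?thesis using 1 2 A C by (auto simp: zero_le_mult_iff)
  qed
qed

context sturm_liouville
begin

definition is_sol :: "real \<Rightarrow> (real \<Rightarrow> real) \<Rightarrow> (real \<Rightarrow> real) \<Rightarrow> bool" where
  "is_sol l g h \<longleftrightarrow> (\<forall>s. (g has_real_derivative P s * h s) (at s) \<and>
     (h has_real_derivative - (Q s + l * W s) * g s) (at s))"

lemma is_sol_lin:
  assumes "is_sol l g1 h1" "is_sol l g2 h2"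
  shows "is_sol l (\<lambda>s. a * g1 s + b * g2 s) (\<lambda>s. a * h1 s + b * h2 s)"
  using assms unfolding is_sol_def
  by (auto intro!: derivative_eq_intros simp: algebra_simps)

lemma is_sol_shift:
  assumes "is_sol l g h"
  shows "is_sol l (\<lambda>s. g (s + 2 * pi)) (\<lambda>s. h (s + 2 * pi))"
  unfolding is_sol_def
proof (intro allI conjI)
  fix s
  show "((\<lambda>s. g (s + 2 * pi)) has_real_derivative P s * h (s + 2 * pi)) (at s)"
    using assms per(1)[of s] DERIV_shift[of g _ s "2 * pi"] unfolding is_sol_def by metis
  show "((\<lambda>s. h (s + 2 * pi)) has_real_derivative - (Q s + l * W s) * g (s + 2 * pi)) (at s)"
    using assms per(2,3)[of s] DERIV_shift[of h _ s "2 * pi"] unfolding is_sol_def by metis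
qed

text \<open>
  The energy \<open>g\<^sup>2 + h\<^sup>2\<close> satisfies a linear differential inequality in both time directions.
\<close>

lemma is_sol_zero:
  assumes "is_sol l g h" "g 0 = 0" "h 0 = 0"
  shows "g s = 0 \<and> h s = 0"
proof -
  define K where "K = rate_bound \<bar>l\<bar>"
  have K: "K > 0" "\<And>s. \<bar>Q s + l * W s\<bar> \<le> K" "\<And>s. P s \<le> K"
    unfolding K_def by (rule rate_bound_pos coeff_bound P_bound order_refl)+
  define E where "E s = (g s)\<^sup>2 + (h s)\<^sup>2" for s
  define E' where "E' s = (P s - (Q s + l * W s)) * (2 * (g s * h s))" for s
  have E: "(E has_real_derivative E' s) (at s)" for s
    using assms unfolding is_sol_def E_def E'_def
    by (auto intro!: derivative_eq_intros simp: algebra_simps)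
  have Ebound: "\<bar>E' s\<bar> \<le> 2 * K * \<bar>E s\<bar>" for s
  proof -
    have "2 * \<bar>g s * h s\<bar> \<le> E s"
      using zero_le_power2[of "\<bar>g s\<bar> - \<bar>h s\<bar>"] unfolding E_def by (simp add: power2_diff abs_mult)
    moreover have "\<bar>P s - (Q s + l * W s)\<bar> \<le> 2 * K" using K(2,3)[of s] pos(1)[of s] by linarith
    ultimately have "\<bar>P s - (Q s + l * W s)\<bar> * (2 * \<bar>g s * h s\<bar>) \<le> 2 * K * E s"
      using K by (intro mult_mono) auto
    moreover have "E s \<ge> 0" by (simp add: E_def)
    moreover have "\<bar>E' s\<bar> = \<bar>P s - (Q s + l * W s)\<bar> * (2 * \<bar>g s * h s\<bar>)"
      unfolding E'_def abs_mult by simp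
    ultimately show ?thesis by simp
  qed
  have E0: "E 0 = 0" using assms by (simp add: E_def)
  have "E s \<le> 0"
  proof (cases "s \<ge> 0")
    case True
    have "- E s \<ge> - E 0 * exp (- (2 * K) * s)"
      by (rule lipschitz_growth_lower[where d' = "\<lambda>s. - E' s"])
        (use True E0 Ebound[THEN abs_le_D1] in \<open>auto intro!: derivative_eq_intros E\<close>)
    then show ?thesis using E0 by simp
  next
    case False
    have "- E (- (- s)) \<ge> - E (- 0) * exp (- (2 * K) * (- s))"
    proof (rule lipschitz_growth_lower[where d = "\<lambda>s. - E (- s)" and d' = "\<lambda>s. E' (- s)"])
      show "((\<lambda>s. - E (- s)) has_real_derivative E' (- s)) (at s)" for s
        using DERIV_mirror[of E "E' (- s)" s] E[of "- s"] by (auto intro!: derivative_eq_intros)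
      show "- (2 * K) * \<bar>- E (- s)\<bar> \<le> E' (- s)" for s
        using Ebound[of "- s"] by (simp add: abs_le_iff)
    qed (use False E0 in auto)
    then show ?thesis using E0 by simp
  qed
  then show ?thesis unfolding E_def by (smt (verit) zero_le_power2 power2_less_eq_zero_iff)
qed

text \<open>
  The radius that accompanies the angle \<open>ang l a\<close>, normalised to 1 at 0.
\<close>

definition amp :: "real \<Rightarrow> real \<Rightarrow> real \<Rightarrow> real" where
  "amp l a s = exp (antideriv (\<lambda>s. (P s - (Q s + l * W s)) * sin (ang l a s) * cos (ang l a s)) s)"

definition psin where "psin l a s = amp l a s * sin (ang l a s)"
definition pcos where "pcos l a s = amp l a s * cos (ang l a s)"

lemma amp_cont: "continuous_on UNIV (\<lambda>s. (P s - (Q s + l * W s)) * sin (ang l a s) * cos (ang l a s))"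
  by (intro continuous_intros cont continuous_at_imp_continuous_on ballI DERIV_isCont[OF ang(2)])

lemma amp_pos: "amp l a s > 0" by (simp add: amp_def)

lemma amp_0: "amp l a 0 = 1" by (simp add: amp_def antideriv(1)[OF amp_cont])

lemma polar_0: "psin l a 0 = sin a" "pcos l a 0 = cos a"
  by (auto simp: psin_def pcos_def amp_0 ang)

lemma amp_deriv: "(amp l a has_real_derivative amp l a s * ((P s - (Q s + l * W s)) * sin (ang l a s) * cos (ang l a s))) (at s)"
  unfolding amp_def by (auto intro!: derivative_eq_intros antideriv(2)[OF amp_cont])

lemma is_sol_polar: "is_sol l (psin l a) (pcos l a)"
  unfolding is_sol_def
proof (intro allI conjI)
  fix s
  have sc: "(sin (ang l a s))\<^sup>2 = 1 - (cos (ang l a s))\<^sup>2" by (simp add: sin_squared_eq)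
  have "(psin l a has_real_derivative 
     amp l a s * ((P s - (Q s + l * W s)) * sin (ang l a s) * cos (ang l a s)) * sin (ang l a s) + 
     (cos (ang l a s) * ang_rhs l s (ang l a s)) * amp l a s) (at s)"
    unfolding psin_def by (rule DERIV_mult[OF amp_deriv]) (auto intro!: derivative_eq_intros ang)
  also have "amp l a s * ((P s - (Q s + l * W s)) * sin (ang l a s) * cos (ang l a s)) * sin (ang l a s) + 
     (cos (ang l a s) * ang_rhs l s (ang l a s)) * amp l a s = 
     P s * pcos l a s * ((sin (ang l a s))\<^sup>2 + (cos (ang l a s))\<^sup>2)"
    unfolding ang_rhs_def pcos_def by algebra
  finally show "(psin l a has_real_derivative P s * pcos l a s) (at s)" by simp
  have "(pcos l a has_real_derivative 
     amp l a s * ((P s - (Q s + l * W s)) * sin (ang l a s) * cos (ang l a s)) * cos (ang l a s) + 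
     (- sin (ang l a s) * ang_rhs l s (ang l a s)) * amp l a s) (at s)"
    unfolding pcos_def by (rule DERIV_mult[OF amp_deriv]) (auto intro!: derivative_eq_intros ang)
  also have "amp l a s * ((P s - (Q s + l * W s)) * sin (ang l a s) * cos (ang l a s)) * cos (ang l a s) + 
     (- sin (ang l a s) * ang_rhs l s (ang l a s)) * amp l a s = 
     - (Q s + l * W s) * psin l a s * ((sin (ang l a s))\<^sup>2 + (cos (ang l a s))\<^sup>2)"
    unfolding ang_rhs_def psin_def by algebra
  finally show "(pcos l a has_real_derivative - (Q s + l * W s) * psin l a s) (at s)" by simp
qed

lemma is_sol_unique:
  assumes "is_sol l g1 h1" "is_sol l g2 h2" "g1 0 = g2 0" "h1 0 = h2 0"
  shows "g1 s = g2 s" "h1 s = h2 s"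
  using is_sol_zero[OF is_sol_lin[OF assms(1,2), of 1 "-1"], of s] assms(3,4) by auto

lemma is_sol_fundamental:
  assumes "is_sol l g h"
  shows "g s = g 0 * psin l (pi / 2) s + h 0 * psin l 0 s"
    "h s = g 0 * pcos l (pi / 2) s + h 0 * pcos l 0 s"
  using is_sol_unique[OF assms is_sol_lin[OF is_sol_polar[of l "pi / 2"] is_sol_polar[of l 0], of "g 0" "h 0"], of s]
  by (auto simp: polar_0)

lemma is_sol_wronskian:
  assumes "is_sol l g1 h1" "is_sol l g2 h2"
  shows "g1 s * h2 s - h1 s * g2 s = g1 0 * h2 0 - h1 0 * g2 0"
proof -
  have "((\<lambda>s. g1 s * h2 s - h1 s * g2 s) has_real_derivative 0) (at s)" for s
    using assms unfolding is_sol_def by (auto intro!: derivative_eq_intros simp: algebra_simps)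
  then show ?thesis by (rule DERIV_isconst_all[rule_format])
qed

text \<open>
  The monodromy matrix, which carries \<open>(g, h)\<close> at 0 to \<open>(g, h)\<close> at \<open>2 * pi\<close>.
\<close>

definition m11 where "m11 l = psin l (pi / 2) (2 * pi)"
definition m21 where "m21 l = pcos l (pi / 2) (2 * pi)"
definition m12 where "m12 l = psin l 0 (2 * pi)"
definition m22 where "m22 l = pcos l 0 (2 * pi)"

lemma monodromy:
  assumes "is_sol l g h"
  shows "g (2 * pi) = m11 l * g 0 + m12 l * h 0" "h (2 * pi) = m21 l * g 0 + m22 l * h 0"
  using is_sol_fundamental[OF assms, of "2 * pi"] by (auto simp: m11_def m12_def m21_def m22_def)

lemma monodromy_det: "m11 l * m22 l - m12 l * m21 l = 1"
  using is_sol_wronskian[OF is_sol_polar[of l "pi / 2"] is_sol_polar[of l 0], of "2 * pi"]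
  by (simp add: m11_def m12_def m21_def m22_def polar_0 mult.commute)

definition periodic_sols :: "real \<Rightarrow> (real \<Rightarrow> real) set" where
  "periodic_sols l = {g. (\<exists>h. is_sol l g h) \<and> (\<forall>s. g (s + 2 * pi) = g s)}"

lemma is_sol_second: "is_sol l g h \<Longrightarrow> is_sol l g h' \<Longrightarrow> h = h'"
proof
  fix s assume "is_sol l g h" "is_sol l g h'"
  then have "P s * h s = P s * h' s" unfolding is_sol_def using DERIV_unique by blast
  then show "h s = h' s" using pos(1)[of s] by simp
qed

text \<open>
  Periodicity of \<open>g\<close> alone includes that of \<open>h = g' / P\<close>, and by uniqueness it is enough to compare
  the two ends of one period.
\<close>

lemma periodic_sols_iff:
  assumes "is_sol l g h"
  shows "g \<in> periodic_sols l \<longleftrightarrow> g (2 * pi) = g 0 \<and> h (2 * pi) = h 0"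
proof
  assume "g \<in> periodic_sols l"
  then have per: "\<forall>s. g (s + 2 * pi) = g s" by (auto simp: periodic_sols_def)
  then have "is_sol l g (\<lambda>s. h (s + 2 * pi))" using is_sol_shift[OF assms] by simp
  from is_sol_second[OF assms this] have "h 0 = h (0 + 2 * pi)" by metis
  then show "g (2 * pi) = g 0 \<and> h (2 * pi) = h 0" using per[rule_format, of 0] by simp
next
  assume "g (2 * pi) = g 0 \<and> h (2 * pi) = h 0"
  then have "g (s + 2 * pi) = g s" for s
    using is_sol_unique(1)[OF is_sol_shift[OF assms] assms, of s] by simp
  then show "g \<in> periodic_sols l" using assms by (auto simp: periodic_sols_def)
qed

lemma adv_polar:
  "psin l a (2 * pi) = amp l a (2 * pi) * sin (a + adv l a)"
  "pcos l a (2 * pi) = amp l a (2 * pi) * cos (a + adv l a)"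
  by (auto simp: psin_def pcos_def adv_def)

text \<open>
  The cross product of an initial vector with its image under the monodromy matrix.  On the unit vector
  of angle \<open>a\<close> its sign is that of \<open>sin (adv l a)\<close>, so this quadratic form decides on which side of a
  multiple of \<open>pi\<close> the rotation lies.
\<close>

definition disp :: "real \<Rightarrow> real \<Rightarrow> real \<Rightarrow> real" where
  "disp l x y = m12 l * y\<^sup>2 + (m11 l - m22 l) * x * y + (- m21 l) * x\<^sup>2"

lemma disp_polar: "disp l (sin a) (cos a) = amp l a (2 * pi) * sin (adv l a)"
proof -
  have "amp l a (2 * pi) * sin (adv l a) = amp l a (2 * pi) * sin ((a + adv l a) - a)" by simp
  also have "\<dots> = psin l a (2 * pi) * cos a - pcos l a (2 * pi) * sin a"
    unfolding sin_diff adv_polar by (simp add: algebra_simps)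
  also have "\<dots> = disp l (sin a) (cos a)"
    unfolding monodromy[OF is_sol_polar] disp_def polar_0 by (simp add: power2_eq_square algebra_simps)
  finally show ?thesis by simp
qed

lemma disp_scale: "disp l (c * x) (c * y) = c\<^sup>2 * disp l x y"
  by (simp add: disp_def power2_eq_square algebra_simps)

lemma polar_coords: obtains r a :: real where "x = r * sin a" "y = r * cos a"
  using polar_Ex[of y x] by (metis mult.commute)

lemma disp_nonneg_iff:
  assumes "adv l a0 = 2 * pi * of_int j"
  shows "disp l (sin a) (cos a) \<ge> 0 \<longleftrightarrow> adv l a \<ge> 2 * pi * of_int j"
    and "disp l (sin a) (cos a) \<le> 0 \<longleftrightarrow> adv l a \<le> 2 * pi * of_int j"
proof -
  define x where "x = adv l a - 2 * pi * of_int j"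
  have x: "\<bar>x\<bar> < pi" using adv_diff[of l a a0] assms by (simp add: x_def)
  have sin: "sin (adv l a) = sin x"
  proof -
    have "sin (x + 2 * pi * of_int j) = sin x" by (rule periodic_int) simp
    then show ?thesis by (simp add: x_def)
  qed
  have pos: "sin x > 0" if "x > 0" using sin_gt_zero[of x] that x by auto
  have neg: "sin x < 0" if "x < 0" using sin_gt_zero[of "- x"] that x by auto
  have "sin x \<ge> 0 \<longleftrightarrow> x \<ge> 0" "sin x \<le> 0 \<longleftrightarrow> x \<le> 0"
    using pos neg by (cases x "0 :: real" rule: linorder_cases; auto)+
  then show "disp l (sin a) (cos a) \<ge> 0 \<longleftrightarrow> adv l a \<ge> 2 * pi * of_int j"
    "disp l (sin a) (cos a) \<le> 0 \<longleftrightarrow> adv l a \<le> 2 * pi * of_int j"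
    unfolding disp_polar sin using amp_pos[of l a "2 * pi"] 
    by (auto simp: x_def zero_le_mult_iff mult_le_0_iff)
qed

lemma disp_disc: "(m11 l - m22 l)\<^sup>2 - 4 * m12 l * (- m21 l) = (m11 l + m22 l)\<^sup>2 - 4"
  using monodromy_det[of l] by (simp add: power2_eq_square algebra_simps)

text \<open>
  A direction that turns by full turns is an eigenvector with eigenvalue \<open>\<rho> > 0\<close>; as the determinant
  is 1, the other eigenvalue is \<open>1 / \<rho>\<close>.
\<close>

lemma eigen_trace:
  assumes "adv l a = 2 * pi * of_int j"
  shows "m11 l + m22 l = amp l a (2 * pi) + 1 / amp l a (2 * pi)"
proof -
  define \<rho> where "\<rho> = amp l a (2 * pi)"
  have \<rho>: "\<rho> > 0" by (simp add: \<rho>_def amp_pos)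
  have "sin (a + 2 * pi * of_int j) = sin a" "cos (a + 2 * pi * of_int j) = cos a"
    by (rule periodic_int; simp)+
  then have e: "\<rho> * sin a = m11 l * sin a + m12 l * cos a" "\<rho> * cos a = m21 l * sin a + m22 l * cos a"
    using adv_polar[of l a] monodromy[OF is_sol_polar, of l a] assms by (auto simp: \<rho>_def polar_0)
  have "(\<rho>\<^sup>2 - (m11 l + m22 l) * \<rho> + 1) * sin a = 0 \<and> (\<rho>\<^sup>2 - (m11 l + m22 l) * \<rho> + 1) * cos a = 0"
    using e monodromy_det[of l] by algebra
  then have "\<rho>\<^sup>2 - (m11 l + m22 l) * \<rho> + 1 = 0" 
    using sin_cos_squared_add[of a] by (metis mult_eq_0_iff power_zero_numeral add_0 zero_neq_one)
  then show ?thesis using \<rho> unfolding \<rho>_def[symmetric] by (simp add: field_simps power2_eq_square)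
qed

text \<open>
  If \<open>2 * pi * j\<close> is an extreme value of the rotation, the form \<open>disp\<close> is semidefinite, and so its
  discriminant \<open>tr\<^sup>2 - 4\<close> is not positive.  But \<open>tr = \<rho> + 1 / \<rho> \<ge> 2\<close>, whence \<open>\<rho> = 1\<close>.
\<close>

lemma touching_imp_periodic:
  assumes a: "adv l a = 2 * pi * of_int j"
    and side: "(\<forall>b. adv l b \<ge> 2 * pi * of_int j) \<or> (\<forall>b. adv l b \<le> 2 * pi * of_int j)"
  shows "amp l a (2 * pi) = 1" "psin l a \<in> periodic_sols l"
proof -
  define \<rho> where "\<rho> = amp l a (2 * pi)"
  have \<rho>: "\<rho> > 0" by (simp add: \<rho>_def amp_pos)
  have "(m11 l - m22 l)\<^sup>2 \<le> 4 * m12 l * (- m21 l)"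
    using side
  proof
    assume s: "\<forall>b. adv l b \<ge> 2 * pi * of_int j"
    have "disp l x y \<ge> 0" for x y
    proof -
      obtain r b where "x = r * sin b" "y = r * cos b" by (rule polar_coords)
      then show ?thesis using disp_nonneg_iff(1)[OF a, of b] s by (simp add: disp_scale)
    qed
    then show ?thesis unfolding disp_def by (rule quadratic_form_discriminant)
  next
    assume s: "\<forall>b. adv l b \<le> 2 * pi * of_int j"
    have "- disp l x y \<ge> 0" for x y
    proof -
      obtain r b where "x = r * sin b" "y = r * cos b" by (rule polar_coords)
      then show ?thesis using disp_nonneg_iff(2)[OF a, of b] s by (simp add: disp_scale mult_nonneg_nonpos)
    qed
    then have "(- (m11 l - m22 l))\<^sup>2 \<le> 4 * (- m12 l) * (m21 l)"
      by (intro quadratic_form_discriminant) (simp add: disp_def algebra_simps)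
    then show ?thesis by (simp add: power2_commute)
  qed
  then have "(\<rho> + 1 / \<rho>)\<^sup>2 \<le> 4" using disp_disc[of l] eigen_trace[OF a] by (simp add: \<rho>_def)
  then have "(\<rho> - 1 / \<rho>)\<^sup>2 \<le> 0" using \<rho> by (simp add: power2_eq_square field_simps)
  then have "\<rho> - 1 / \<rho> = 0" by simp
  then have "\<rho>\<^sup>2 = 1" using \<rho> by (simp add: field_simps power2_eq_square)
  then show r1: "amp l a (2 * pi) = 1" using \<rho> by (simp add: power2_eq_1_iff \<rho>_def)
  have "sin (a + 2 * pi * of_int j) = sin a" "cos (a + 2 * pi * of_int j) = cos a"
    by (rule periodic_int; simp)+
  then show "psin l a \<in> periodic_sols l"
    unfolding periodic_sols_iff[OF is_sol_polar] adv_polar a r1 by (simp add: polar_0)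
qed

text \<open>
  A fixed vector of a matrix with determinant 1 forces the trace 2, so the discriminant of \<open>disp\<close> is 0
  and the form is semidefinite: the rotation by \<open>2 * pi * j\<close> of the fixed direction is extreme.
\<close>

lemma periodic_imp_touching:
  assumes g: "g \<in> periodic_sols l" "g \<noteq> (\<lambda>_. 0)"
  obtains a j where "adv l a = 2 * pi * of_int j"
    "(\<forall>b. adv l b \<ge> 2 * pi * of_int j) \<or> (\<forall>b. adv l b \<le> 2 * pi * of_int j)"
proof -
  obtain h where h: "is_sol l g h" using g(1) by (auto simp: periodic_sols_def)
  have T: "g (2 * pi) = g 0" "h (2 * pi) = h 0" using periodic_sols_iff[OF h] g(1) by auto
  obtain r a where ra: "g 0 = r * sin a" "h 0 = r * cos a" by (rule polar_coords)
  have "r \<noteq> 0" using is_sol_zero[OF h] g(2) ra by auto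
  have fixd: "m11 l * sin a + m12 l * cos a = sin a" "m21 l * sin a + m22 l * cos a = cos a"
  proof -
    have "r * (m11 l * sin a + m12 l * cos a) = r * sin a" "r * (m21 l * sin a + m22 l * cos a) = r * cos a"
      using monodromy[OF h] T ra by (auto simp: algebra_simps)
    then show "m11 l * sin a + m12 l * cos a = sin a" "m21 l * sin a + m22 l * cos a = cos a"
      using \<open>r \<noteq> 0\<close> by auto
  qed
  define \<rho> where "\<rho> = amp l a (2 * pi)"
  have e: "\<rho> * sin (a + adv l a) = sin a" "\<rho> * cos (a + adv l a) = cos a"
    using adv_polar[of l a] monodromy[OF is_sol_polar, of l a] fixd by (auto simp: \<rho>_def polar_0)
  have "\<rho>\<^sup>2 * ((sin (a + adv l a))\<^sup>2 + (cos (a + adv l a))\<^sup>2) = (sin a)\<^sup>2 + (cos a)\<^sup>2"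
    unfolding e[symmetric] by (simp only: power_mult_distrib distrib_left)
  then have \<rho>: "\<rho> = 1" using amp_pos[of l a "2 * pi"] by (simp add: \<rho>_def power2_eq_1_iff)
  then obtain j where j: "a + adv l a = a + 2 * pi * of_int j"
    using e sin_cos_eq_iff[of "a + adv l a" a] by auto
  then have a: "adv l a = 2 * pi * of_int j" by simp
  have "m11 l + m22 l = 2" using eigen_trace[OF a] \<rho> by (simp add: \<rho>_def)
  then have "(m11 l - m22 l)\<^sup>2 = 4 * m12 l * (- m21 l)" using disp_disc[of l] by simp
  from quadratic_form_semidefinite[OF this]
  have "(\<forall>b. disp l (sin b) (cos b) \<ge> 0) \<or> (\<forall>b. disp l (sin b) (cos b) \<le> 0)" unfolding disp_def by blast
  then have "(\<forall>b. adv l b \<ge> 2 * pi * of_int j) \<or> (\<forall>b. adv l b \<le> 2 * pi * of_int j)"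
    unfolding disp_nonneg_iff[OF a] .
  then show ?thesis using that a by blast
qed

end

section \<open>Counting negative eigenvalues of the periodic problem\<close>

context sturm_liouville
begin

text \<open>
  The number of full turns \<open>2 * pi * j\<close> is the minimum (\<open>touch_lo\<close>) or the maximum (\<open>touch_hi\<close>) of the
  rotation over all initial directions.
\<close>

definition touch_lo :: "real \<Rightarrow> int \<Rightarrow> bool" where
  "touch_lo l j \<longleftrightarrow> (\<forall>b. adv l b \<ge> 2 * pi * of_int j) \<and> (\<exists>a. adv l a = 2 * pi * of_int j)"

definition touch_hi :: "real \<Rightarrow> int \<Rightarrow> bool" where
  "touch_hi l j \<longleftrightarrow> (\<forall>b. adv l b \<le> 2 * pi * of_int j) \<and> (\<exists>a. adv l a = 2 * pi * of_int j)"

definition mult :: "real \<Rightarrow> nat" where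
  "mult l = of_bool (\<exists>j. touch_lo l j) + of_bool (\<exists>j. touch_hi l j)"

text \<open>
  The rotation of the direction 0 is positive and no other rotation is smaller by \<open>pi\<close> or more.  A
  maximum is even positive itself, so that \<open>j = 0\<close> occurs for minima only.
\<close>

lemma touch_lo_nonneg: "touch_lo l j \<Longrightarrow> j \<ge> 0"
proof -
  assume "touch_lo l j"
  then obtain a where "adv l a = 2 * pi * of_int j" by (auto simp: touch_lo_def)
  then have "2 * pi * of_int j > - pi" using adv_diff[of l 0 a] adv_zero_pos[of l] by auto
  then have "pi * (2 * of_int j + 1) > 0" by (simp add: algebra_simps)
  then have "2 * real_of_int j + 1 > 0" by (simp add: zero_less_mult_iff)
  then show "j \<ge> 0" by linarith
qed

lemma touch_hi_pos: "touch_hi l j \<Longrightarrow> j \<ge> 1"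
proof -
  assume "touch_hi l j"
  then have "2 * pi * of_int j \<ge> adv l 0" by (auto simp: touch_hi_def)
  then have "2 * pi * of_int j > 0" using adv_zero_pos[of l] by linarith
  then show "j \<ge> 1" by (simp add: zero_less_mult_iff)
qed

lemma adv_level_unique:
  assumes "adv l a = 2 * pi * of_int i" "adv l b = 2 * pi * of_int j"
  shows "i = j"
proof -
  have "\<bar>2 * pi * (of_int i - of_int j)\<bar> < pi" using adv_diff[of l a b] assms by (simp add: algebra_simps)
  then have "pi * (2 * \<bar>real_of_int i - of_int j\<bar>) < pi * 1" by (simp add: abs_mult)
  then have "2 * \<bar>real_of_int i - of_int j\<bar> < 1" by (simp only: mult_less_cancel_left_pos[OF pi_gt_zero])
  then have "\<bar>real_of_int (i - j)\<bar> < 1" by simp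
  then show ?thesis by linarith
qed

lemma psin_nonzero: "psin l a \<noteq> (\<lambda>_. 0)"
proof
  assume z: "psin l a = (\<lambda>_. 0)"
  have "is_sol l (\<lambda>_. 0) (\<lambda>_. 0)" by (simp add: is_sol_def)
  then have "pcos l a = (\<lambda>_. 0)" using is_sol_second[of l "\<lambda>_. 0"] is_sol_polar[of l a] z by metis
  then have "sin a = 0" "cos a = 0" using polar_0[of l a] z by auto
  then show False using sin_cos_squared_add[of a] by simp
qed

lemma periodic_sols_multiple:
  assumes a: "adv l a = 2 * pi * of_int j" "amp l a (2 * pi) = 1"
    and nt: "\<not> (touch_lo l j \<and> touch_hi l j)"
    and g: "g \<in> periodic_sols l"
  shows "\<exists>c. g = (\<lambda>s. c * psin l a s)"
proof -
  obtain h where h: "is_sol l g h" using g by (auto simp: periodic_sols_def)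
  have T: "g (2 * pi) = g 0" "h (2 * pi) = h 0" using periodic_sols_iff[OF h] g by auto
  define d where "d = g 0 * cos a - h 0 * sin a"
  have "d = 0"
  proof (rule ccontr)
    assume d: "d \<noteq> 0"
    have "sin (a + 2 * pi * of_int j) = sin a" "cos (a + 2 * pi * of_int j) = cos a"
      by (rule periodic_int; simp)+
    then have e: "sin a = m11 l * sin a + m12 l * cos a" "cos a = m21 l * sin a + m22 l * cos a"
      using adv_polar[of l a] monodromy[OF is_sol_polar, of l a] a by (auto simp: polar_0)
    have f: "g 0 = m11 l * g 0 + m12 l * h 0" "h 0 = m21 l * g 0 + m22 l * h 0"
      using monodromy[OF h] T by auto
    have "(m11 l - 1) * d = 0" "m12 l * d = 0" "m21 l * d = 0" "(m22 l - 1) * d = 0"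
      unfolding d_def using e f by algebra+
    then have "disp l x y = 0" for x y using d by (simp add: disp_def)
    then have "adv l b \<ge> 2 * pi * of_int j" "adv l b \<le> 2 * pi * of_int j" for b
      using disp_nonneg_iff[OF a(1), of b] by auto
    then show False using nt a(1) by (auto simp: touch_lo_def touch_hi_def)
  qed
  define c where "c = g 0 * sin a + h 0 * cos a"
  have "g 0 = c * sin a" "h 0 = c * cos a"
    using \<open>d = 0\<close> sin_cos_squared_add[of a] unfolding c_def d_def by algebra+
  then have "g s = c * psin l a s" for s
    using is_sol_unique(1)[OF h is_sol_lin[OF is_sol_polar[of l a] is_sol_polar[of l a], of c 0]] by (simp add: polar_0)
  then show ?thesis by blast
qed

lemma zero_periodic: "(\<lambda>_. 0) \<in> periodic_sols l"
  by (auto simp: periodic_sols_def is_sol_def intro!: exI[of _ "\<lambda>_. 0"])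

lemma periodic_sols_scale: "g \<in> periodic_sols l \<Longrightarrow> (\<lambda>s. c * g s) \<in> periodic_sols l"
  using is_sol_lin[of l g _ g _ c 0] unfolding periodic_sols_def by fastforce

text \<open>
  If the minimum and the maximum are both multiples of the full turn, they agree, and the monodromy
  matrix is the identity.  If only one of them is, a single direction is fixed: two fixed directions
  would again give the identity.
\<close>

lemma has_dim_periodic_sols: "has_dim (periodic_sols l) (mult l)"
proof (cases "(\<exists>j. touch_lo l j) \<and> (\<exists>j. touch_hi l j)")
  case True
  then obtain i j where ij: "touch_lo l i" "touch_hi l j" by blast
  then have "i = j" using adv_level_unique by (metis touch_lo_def touch_hi_def)
  then have adv: "adv l a = 2 * pi * of_int j" for a
    using ij by (auto simp: touch_lo_def touch_hi_def intro!: antisym)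
  have per: "psin l a \<in> periodic_sols l" for a
    by (rule touching_imp_periodic[OF adv]) (simp add: adv)
  have "has_dim (periodic_sols l) 2"
  proof (rule has_dim_2)
    fix a b assume z: "(\<lambda>x. a * psin l (pi / 2) x + b * psin l 0 x) = (\<lambda>_. 0)"
    have "a = 0" using fun_cong[OF z, of 0] by (simp add: polar_0)
    moreover have "b = 0"
    proof (rule ccontr)
      assume "b \<noteq> 0"
      then have "psin l 0 = (\<lambda>_. 0)" using fun_cong[OF z] \<open>a = 0\<close> by (auto simp: fun_eq_iff)
      then show False using psin_nonzero by blast
    qed
    ultimately show "a = 0 \<and> b = 0" by simp
  next
    show "periodic_sols l = {\<lambda>x. a * psin l (pi / 2) x + b * psin l 0 x |a b. True}"
    proof (intro subset_antisym subsetI)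
      fix g assume "g \<in> periodic_sols l"
      then obtain h where "is_sol l g h" by (auto simp: periodic_sols_def)
      then show "g \<in> {\<lambda>x. a * psin l (pi / 2) x + b * psin l 0 x |a b. True}"
        using is_sol_fundamental(1)[of l g h] by blast
    next
      fix g assume "g \<in> {\<lambda>x. a * psin l (pi / 2) x + b * psin l 0 x |a b. True}"
      then obtain a b where g: "g = (\<lambda>x. a * psin l (pi / 2) x + b * psin l 0 x)" by blast
      have "is_sol l g (\<lambda>x. a * pcos l (pi / 2) x + b * pcos l 0 x)"
        unfolding g by (intro is_sol_lin is_sol_polar)
      then show "g \<in> periodic_sols l"
        using per[of "pi / 2"] per[of 0] unfolding g periodic_sols_def by auto
    qed
  qed
  then show ?thesis using True by (simp add: mult_def numeral_2_eq_2)
next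
  case False
  show ?thesis
  proof (cases "(\<exists>j. touch_lo l j) \<or> (\<exists>j. touch_hi l j)")
    case True
    then obtain a j where aj: "adv l a = 2 * pi * of_int j" 
      "(\<forall>b. adv l b \<ge> 2 * pi * of_int j) \<or> (\<forall>b. adv l b \<le> 2 * pi * of_int j)"
      by (auto simp: touch_lo_def touch_hi_def)
    have "has_dim (periodic_sols l) 1"
    proof (rule has_dim_1)
      show "psin l a \<noteq> (\<lambda>_. 0)" by (rule psin_nonzero)
      show "periodic_sols l = {\<lambda>x. c * psin l a x |c. True}"
        using periodic_sols_multiple[OF aj(1) touching_imp_periodic(1)[OF aj]] False
          periodic_sols_scale[OF touching_imp_periodic(2)[OF aj]] by blast
    qed
    moreover have "mult l = 1" using True False by (auto simp: mult_def)
    ultimately show ?thesis by simp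
  next
    case F2: False
    have "g = (\<lambda>_. 0)" if "g \<in> periodic_sols l" for g
    proof (rule ccontr)
      assume "g \<noteq> (\<lambda>_. 0)"
      then show False using periodic_imp_touching[OF that] F2 unfolding touch_lo_def touch_hi_def by metis
    qed
    then have "periodic_sols l = {\<lambda>_. 0}" using zero_periodic by auto
    then show ?thesis using F2 has_dim_0 by (simp add: mult_def)
  qed
qed

lemma touch_lo_inj:
  assumes "touch_lo l j" "touch_lo l' j"
  shows "l = l'"
proof (rule ccontr)
  have *: False if t: "l < l'" "touch_lo l j" "touch_lo l' j" for l l'
  proof -
    obtain a where "adv l' a = 2 * pi * of_int j" using t by (auto simp: touch_lo_def)
    moreover have "adv l a \<ge> 2 * pi * of_int j" using t by (auto simp: touch_lo_def)
    ultimately show False using adv_strict_mono[OF t(1), of a] by linarith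
  qed
  assume "l \<noteq> l'"
  then show False using *[of l l'] *[of l' l] assms by (cases l l' rule: linorder_cases) auto
qed

lemma touch_hi_inj:
  assumes "touch_hi l j" "touch_hi l' j"
  shows "l = l'"
proof (rule ccontr)
  have *: False if t: "l < l'" "touch_hi l j" "touch_hi l' j" for l l'
  proof -
    obtain a where "adv l a = 2 * pi * of_int j" using t by (auto simp: touch_hi_def)
    moreover have "adv l' a \<le> 2 * pi * of_int j" using t by (auto simp: touch_hi_def)
    ultimately show False using adv_strict_mono[OF t(1), of a] by linarith
  qed
  assume "l \<noteq> l'"
  then show False using *[of l l'] *[of l' l] assms by (cases l l' rule: linorder_cases) auto
qed

lemma adv_cont_l: "continuous_on {-\<Lambda>..\<Lambda>} (\<lambda>l. adv l a)"
proof -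
  have "continuous_on {-\<Lambda>..\<Lambda>} (\<lambda>l. (a, l))" by (intro continuous_intros)
  from continuous_on_compose2[OF adv_continuous[of UNIV \<Lambda>] this] show ?thesis by auto
qed

text \<open>
  The pairs \<open>(a, l)\<close> with \<open>adv l a = 2 * pi * j\<close> form a compact set \<open>S\<close> within \<open>-\<Lambda> \<le> l \<le> 0\<close>.  At a
  pair with the largest \<open>l\<close>, no direction can turn by less than \<open>2 * pi * j\<close>: between this \<open>l\<close> and 0 it
  would turn by exactly \<open>2 * pi * j\<close>, for a larger \<open>l\<close>.  The smallest \<open>l\<close> gives the maximum in the same
  way, where \<open>j \<ge> 1\<close> is needed because rotations at \<open>-\<Lambda>\<close> are only known to be below \<open>pi\<close>.
\<close>

lemma touch_exists:
  assumes b: "\<And>a. adv 0 a > 2 * pi * of_int j" and j: "j \<ge> 0"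
  shows "\<exists>l<0. touch_lo l j" "j \<ge> 1 \<Longrightarrow> \<exists>l<0. touch_hi l j"
proof -
  obtain \<Lambda> where L: "\<Lambda> > 0" "adv (- \<Lambda>) (pi / 2) < 0" "\<And>a. adv (- \<Lambda>) a < pi" using adv_neg by blast
  define S where "S = {x \<in> {0..pi} \<times> {-\<Lambda>..0}. (case x of (a, l) \<Rightarrow> adv l a) = 2 * pi * of_int j}"
  have cont: "continuous_on ({0..pi} \<times> {-\<Lambda>..0}) (\<lambda>(a, l). adv l a)"
    by (rule continuous_on_subset[OF adv_continuous[of "{0..pi}" \<Lambda>]]) (use L in auto)
  have cl: "continuous_on {x..y} (\<lambda>l. adv l a)" if "-\<Lambda> \<le> x" "y \<le> 0" for x y a
    by (rule continuous_on_subset[OF adv_cont_l[of \<Lambda>]]) (use L that in auto)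
  have "compact S" 
  proof -
    have "closed S" unfolding S_def
      by (rule continuous_closed_preimage_constant[OF cont]) (intro closed_Times; simp)
    moreover have "bounded S" 
      by (rule bounded_subset[OF bounded_Times[of "{0..pi}" "{-\<Lambda>..0}"]]) (auto simp: S_def)
    ultimately show ?thesis using compact_eq_bounded_closed by blast
  qed
  moreover have "S \<noteq> {}"
  proof -
    have "0 \<le> 2 * pi * of_int j" using j by simp
    then have "\<exists>l. -\<Lambda> \<le> l \<and> l \<le> 0 \<and> adv l (pi / 2) = 2 * pi * of_int j"
      using L b[of "pi / 2"] by (intro IVT' cl) auto
    then obtain l where "-\<Lambda> \<le> l" "l \<le> 0" "adv l (pi / 2) = 2 * pi * of_int j" by blast
    then have "(pi / 2, l) \<in> S" by (simp add: S_def)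
    then show ?thesis by blast
  qed
  ultimately have comp: "\<exists>x\<in>S. \<forall>y\<in>S. snd y \<le> snd x" "\<exists>x\<in>S. \<forall>y\<in>S. snd x \<le> snd y"
    using continuous_attains_sup[of S snd] continuous_attains_inf[of S snd] continuous_on_snd[OF continuous_on_id] by blast+
  have memS: "(a + pi * of_int n, l) \<in> S" 
    if "adv l a = 2 * pi * of_int j" "0 \<le> a + pi * of_int n" "a + pi * of_int n < 0 + pi" "-\<Lambda> \<le> l" "l \<le> 0" for a l n
    using that by (auto simp: S_def adv_shift_int)
  have neg: "l < 0" if "adv l a = 2 * pi * of_int j" "l \<le> 0" for a l
    using that b[of a] by (cases "l = 0") auto
  from comp(1) obtain a0 l0 where m: "(a0, l0) \<in> S" "\<And>a l. (a, l) \<in> S \<Longrightarrow> l \<le> l0" by force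
  have m': "adv l0 a0 = 2 * pi * of_int j" "-\<Lambda> \<le> l0" "l0 \<le> 0" using m by (auto simp: S_def)
  have "touch_lo l0 j" unfolding touch_lo_def
  proof (intro conjI allI exI[of _ a0] m')
    fix a
    show "2 * pi * of_int j \<le> adv l0 a"
    proof (rule ccontr)
      assume n: "\<not> 2 * pi * of_int j \<le> adv l0 a"
      have "\<exists>l. l0 \<le> l \<and> l \<le> 0 \<and> adv l a = 2 * pi * of_int j"
        using n b[of a] m' by (intro IVT' cl) auto
      then obtain l where l: "l0 \<le> l" "l \<le> 0" "adv l a = 2 * pi * of_int j" by blast
      obtain k :: int where "0 \<le> a + pi * of_int k" "a + pi * of_int k < 0 + pi" by (rule adv_reduce)
      then have "l \<le> l0" using memS[OF l(3)] l m' m(2) by (metis order_trans)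
      then show False using l n by auto
    qed
  qed
  then show "\<exists>l<0. touch_lo l j" using neg[OF m'(1,3)] by blast
  assume j1: "j \<ge> 1"
  from comp(2) obtain a1 l1 where n: "(a1, l1) \<in> S" "\<And>a l. (a, l) \<in> S \<Longrightarrow> l1 \<le> l" by force
  have n': "adv l1 a1 = 2 * pi * of_int j" "-\<Lambda> \<le> l1" "l1 \<le> 0" using n by (auto simp: S_def)
  have "touch_hi l1 j" unfolding touch_hi_def
  proof (intro conjI allI exI[of _ a1] n')
    fix a
    show "adv l1 a \<le> 2 * pi * of_int j"
    proof (rule ccontr)
      assume g: "\<not> adv l1 a \<le> 2 * pi * of_int j"
      have "1 \<le> 2 * real_of_int j" using j1 by linarith
      from mult_left_mono[OF this pi_ge_zero] have "pi \<le> 2 * pi * of_int j" by (simp only: mult_ac mult_1_right mult_1_left)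
      then have "adv (- \<Lambda>) a \<le> 2 * pi * of_int j" using L(3)[of a] by linarith
      then have "\<exists>l. -\<Lambda> \<le> l \<and> l \<le> l1 \<and> adv l a = 2 * pi * of_int j"
        using g n' by (intro IVT' cl) auto
      then obtain l where l: "-\<Lambda> \<le> l" "l \<le> l1" "adv l a = 2 * pi * of_int j" by blast
      obtain k :: int where "0 \<le> a + pi * of_int k" "a + pi * of_int k < 0 + pi" by (rule adv_reduce)
      then have "l1 \<le> l" using memS[OF l(3)] l n' n(2) by (metis order_trans)
      then show False using l g by auto
    qed
  qed
  then show "\<exists>l<0. touch_hi l j" using neg[OF n'(1,3)] by blast
qed

definition lo_levels where "lo_levels = {l. l < 0 \<and> (\<exists>j. touch_lo l j)}"
definition hi_levels where "hi_levels = {l. l < 0 \<and> (\<exists>j. touch_hi l j)}"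

lemma level_less:
  assumes "l < 0" "touch_lo l j \<or> touch_hi l j" "\<And>a. adv 0 a \<le> b"
  shows "j < \<lceil>b / (2 * pi)\<rceil>"
proof -
  obtain a where a: "adv l a = 2 * pi * of_int j" using assms(2) by (auto simp: touch_lo_def touch_hi_def)
  have "2 * pi * of_int j < b" using adv_strict_mono[OF assms(1), of a] assms(3)[of a] a by linarith
  then have "of_int j < b / (2 * pi)" by (simp add: field_simps)
  then show ?thesis by linarith
qed

text \<open>
  By strict monotonicity of the rotation in \<open>l\<close>, a negative level with \<open>j\<close> turns satisfies
  \<open>2 * pi * j < b\<close>, and different levels of the same kind have different \<open>j\<close>.
\<close>

lemma levels_upper:
  assumes "\<And>a. adv 0 a \<le> b"
  shows "finite lo_levels" "finite hi_levels"
    "card lo_levels \<le> nat \<lceil>b / (2 * pi)\<rceil>" "card hi_levels \<le> nat \<lceil>b / (2 * pi)\<rceil> - 1"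
proof -
  define f where "f l = (SOME j. touch_lo l j)" for l
  have f: "touch_lo l (f l)" if "l \<in> lo_levels" for l
    using that someI_ex[of "touch_lo l"] by (auto simp: lo_levels_def f_def)
  have "inj_on f lo_levels" by (rule inj_onI) (metis f touch_lo_inj)
  moreover have "f ` lo_levels \<subseteq> {0..<\<lceil>b / (2 * pi)\<rceil>}"
    using f touch_lo_nonneg level_less[OF _ _ assms] by (fastforce simp: lo_levels_def)
  ultimately show "finite lo_levels" "card lo_levels \<le> nat \<lceil>b / (2 * pi)\<rceil>"
    using inj_on_finite[of f lo_levels] card_inj_on_le[of f lo_levels "{0..<\<lceil>b / (2 * pi)\<rceil>}"] by auto
  define g where "g l = (SOME j. touch_hi l j)" for l
  have g: "touch_hi l (g l)" if "l \<in> hi_levels" for l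
    using that someI_ex[of "touch_hi l"] by (auto simp: hi_levels_def g_def)
  have "inj_on g hi_levels" by (rule inj_onI) (metis g touch_hi_inj)
  moreover have "g ` hi_levels \<subseteq> {1..<\<lceil>b / (2 * pi)\<rceil>}"
    using g touch_hi_pos level_less[OF _ _ assms] by (fastforce simp: hi_levels_def)
  ultimately show "finite hi_levels" "card hi_levels \<le> nat \<lceil>b / (2 * pi)\<rceil> - 1"
    using inj_on_finite[of g hi_levels] card_inj_on_le[of g hi_levels "{1..<\<lceil>b / (2 * pi)\<rceil>}"] by (auto simp: nat_diff_distrib')
qed

lemma finite_levels: "finite lo_levels" "finite hi_levels"
proof -
  have "adv 0 a \<le> adv 0 0 + pi" for a using adv_diff[of 0 a 0] by linarith
  from levels_upper(1,2)[OF this] show "finite lo_levels" "finite hi_levels" .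
qed

lemma levels_lower:
  assumes "\<And>a. adv 0 a \<ge> b"
  shows "card lo_levels \<ge> nat \<lceil>b / (2 * pi)\<rceil>" "card hi_levels \<ge> nat \<lceil>b / (2 * pi)\<rceil> - 1"
proof -
  have ex: "adv 0 a > 2 * pi * of_int j" if "j < \<lceil>b / (2 * pi)\<rceil>" for j a
  proof -
    have "of_int j < b / (2 * pi)" using that by linarith
    then have "2 * pi * of_int j < b" by (simp add: field_simps)
    then show ?thesis using assms[of a] by linarith
  qed
  define f where "f j = (SOME l. l < 0 \<and> touch_lo l j)" for j
  have f: "f j < 0 \<and> touch_lo (f j) j" if "j \<in> {0..<\<lceil>b / (2 * pi)\<rceil>}" for j
    unfolding f_def by (rule someI_ex) (use touch_exists(1)[OF ex] that in auto)
  have "inj_on f {0..<\<lceil>b / (2 * pi)\<rceil>}"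
    by (rule inj_onI) (metis f adv_level_unique touch_lo_def)
  moreover have "f ` {0..<\<lceil>b / (2 * pi)\<rceil>} \<subseteq> lo_levels" unfolding lo_levels_def using f by blast
  ultimately show "card lo_levels \<ge> nat \<lceil>b / (2 * pi)\<rceil>"
    using card_inj_on_le[OF _ _ finite_levels(1)] by fastforce
  define g where "g j = (SOME l. l < 0 \<and> touch_hi l j)" for j
  have g: "g j < 0 \<and> touch_hi (g j) j" if "j \<in> {1..<\<lceil>b / (2 * pi)\<rceil>}" for j
    unfolding g_def by (rule someI_ex) (use touch_exists(2)[OF ex] that in auto)
  have "inj_on g {1..<\<lceil>b / (2 * pi)\<rceil>}"
    by (rule inj_onI) (metis g adv_level_unique touch_hi_def)
  moreover have "g ` {1..<\<lceil>b / (2 * pi)\<rceil>} \<subseteq> hi_levels" unfolding hi_levels_def using g by blast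
  ultimately have "card {1..<\<lceil>b / (2 * pi)\<rceil>} \<le> card hi_levels"
    using card_inj_on_le[OF _ _ finite_levels(2)] by blast
  then show "card hi_levels \<ge> nat \<lceil>b / (2 * pi)\<rceil> - 1" by (simp add: nat_diff_distrib')
qed

lemma mult_levels: "{l. l < 0 \<and> mult l \<noteq> 0} = lo_levels \<union> hi_levels"
  by (auto simp: mult_def lo_levels_def hi_levels_def)

lemma sum_mult: "(\<Sum>l\<in>{l. l < 0 \<and> mult l \<noteq> 0}. mult l) = card lo_levels + card hi_levels"
proof -
  have fin: "finite (lo_levels \<union> hi_levels)" using finite_levels by auto
  have "(\<Sum>l\<in>lo_levels \<union> hi_levels. mult l) = 
     (\<Sum>l\<in>lo_levels \<union> hi_levels. of_bool (l \<in> lo_levels) + of_bool (l \<in> hi_levels))"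
    by (intro sum.cong) (auto simp: mult_def lo_levels_def hi_levels_def)
  also have "\<dots> = card lo_levels + card hi_levels"
    using fin by (simp add: sum.distrib of_bool_def sum.If_cases Int_absorb1)
  finally show ?thesis unfolding mult_levels .
qed

lemma finite_mult: "finite {l. l < 0 \<and> mult l \<noteq> 0}"
  unfolding mult_levels using finite_levels by auto

lemma sum_mult_upper:
  assumes "\<And>s. Q s \<le> P s"
  shows "real (\<Sum>l\<in>{l. l < 0 \<and> mult l \<noteq> 0}. mult l) < len / pi + 1"
proof -
  define n where "n = nat \<lceil>len / (2 * pi)\<rceil>"
  have "0 < \<lceil>len / (2 * pi)\<rceil>" using len_pos by simp
  then have n: "real n < len / (2 * pi) + 1" "n \<ge> 1" unfolding n_def by linarith+
  have "card lo_levels + card hi_levels \<le> n + (n - 1)"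
    unfolding n_def by (intro add_mono levels_upper adv_le_len assms)
  then have "real (card lo_levels + card hi_levels) \<le> 2 * real n - 1" using n by linarith
  also have "\<dots> < len / pi + 1" using n by simp
  finally show ?thesis unfolding sum_mult .
qed

lemma sum_mult_lower:
  assumes "\<And>s. Q s \<ge> P s"
  shows "real (\<Sum>l\<in>{l. l < 0 \<and> mult l \<noteq> 0}. mult l) \<ge> len / pi - 1"
proof -
  define n where "n = nat \<lceil>len / (2 * pi)\<rceil>"
  have "0 < \<lceil>len / (2 * pi)\<rceil>" using len_pos by simp
  then have n: "real n \<ge> len / (2 * pi)" "n \<ge> 1" unfolding n_def by linarith+
  have "card lo_levels + card hi_levels \<ge> n + (n - 1)"
    unfolding n_def by (intro add_mono levels_lower adv_ge_len assms)
  then have "real (card lo_levels + card hi_levels) \<ge> 2 * real n - 1" using n by linarith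
  moreover have "2 * real n - 1 \<ge> len / pi - 1" using n by simp
  ultimately show ?thesis unfolding sum_mult by linarith
qed

text \<open>
  Along a solution \<open>(g h)' = P h\<^sup>2 - (Q + l W) g\<^sup>2 \<ge> 0\<close>, so periodicity makes \<open>g h\<close> constant.
\<close>

lemma mult_zero:
  assumes "\<And>s. Q s \<le> 0" "l < 0"
  shows "mult l = 0"
proof -
  have "g = (\<lambda>_. 0)" if g: "g \<in> periodic_sols l" for g
  proof -
    obtain h where h: "is_sol l g h" using g by (auto simp: periodic_sols_def)
    have T: "g (2 * pi) = g 0" "h (2 * pi) = h 0" using periodic_sols_iff[OF h] g by auto
    define k where "k s = P s * (h s)\<^sup>2 - (Q s + l * W s) * (g s)\<^sup>2" for s
    have Ql: "Q s + l * W s < 0" for s using assms(1)[of s] mult_neg_pos[OF assms(2) pos(2)[of s]] by linarith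
    have der: "((\<lambda>s. g s * h s) has_real_derivative k s) (at s)" for s
      using h unfolding is_sol_def k_def
      by (auto intro!: derivative_eq_intros simp: power2_eq_square algebra_simps)
    have k0: "k s \<ge> 0" for s unfolding k_def using pos(1)[of s] Ql[of s]
      by (smt (verit) mult_nonneg_nonneg mult_nonpos_nonneg zero_le_power2)
    have mono: "g s * h s \<le> g t * h t" if "s \<le> t" for s t
      by (rule DERIV_nonneg_imp_nondecreasing[OF that]) (use der k0 in blast)
    have const: "g s * h s = g 0 * h 0" if "s \<in> {0..2*pi}" for s
    proof -
      have "g (2 * pi) * h (2 * pi) = g 0 * h 0" by (simp only: T)
      moreover have "g 0 * h 0 \<le> g s * h s" "g s * h s \<le> g (2 * pi) * h (2 * pi)"
        by (rule mono; use that in simp)+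
      ultimately show ?thesis by linarith
    qed
    have g0: "g s = 0" if "s \<in> {0<..<2*pi}" for s
    proof -
      have "((\<lambda>s. g s * h s) has_real_derivative 0) (at s)"
      proof (rule has_field_derivative_transform_within_open[where S = "{0<..<2*pi}", OF DERIV_const[where k = "g 0 * h 0"]])
        show "g 0 * h 0 = g x * h x" if "x \<in> {0<..<2*pi}" for x by (rule const[symmetric]) (use that in auto)
      qed (use that in auto)
      then have "k s = 0" using der DERIV_unique by blast
      moreover have "P s * (h s)\<^sup>2 \<ge> 0" using pos(1)[of s] by simp
      moreover have "- (Q s + l * W s) * (g s)\<^sup>2 \<ge> 0" using Ql[of s] by (intro mult_nonneg_nonneg) auto
      ultimately have "- (Q s + l * W s) * (g s)\<^sup>2 = 0" unfolding k_def by (simp add: algebra_simps)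
      then show ?thesis using Ql[of s] by simp
    qed
    show ?thesis
    proof
      fix s
      have cont: "continuous_on UNIV g" 
        using h unfolding is_sol_def by (intro continuous_at_imp_continuous_on ballI) (metis DERIV_isCont)
      have "g x = 0" if "x \<in> closure {0<..<2*pi}" for x
        by (rule continuous_constant_on_closure[OF continuous_on_subset[OF cont] g0 that]) auto
      then have "g x = 0" if "x \<in> {0..2*pi}" for x using that by simp
      moreover obtain s' where "s' \<in> {0..2*pi}" "g s = g s'"
        using periodic_reduce[of g s] g by (auto simp: periodic_sols_def)
      ultimately show "g s = 0" by simp
    qed
  qed
  then have "periodic_sols l = {\<lambda>_. 0}" using zero_periodic by auto
  then show ?thesis using has_dim_unique[OF has_dim_periodic_sols[of l]] has_dim_0 by auto
qed

end

section \<open>Calculus of smooth functions\<close>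

lemma C_k_Suc_imp: "C_k (Suc k) f \<Longrightarrow> C_k k f"
  by (induction k arbitrary: f) (auto intro: differentiable_imp_continuous_on)

lemma C_k_differentiable: "C_k (Suc k) f \<Longrightarrow> f differentiable (at p)"
  by (simp add: differentiable_on_def)

lemma C_k_SucI:
  assumes "\<And>p. (f has_derivative D p) (at p)" "\<And>b. b \<in> Basis \<Longrightarrow> C_k k (\<lambda>p. D p b)"
  shows "C_k (Suc k) f"
proof -
  have "frechet_derivative f (at p) = D p" for p using assms(1) by (metis frechet_derivative_at)
  then show ?thesis using assms by (auto simp: differentiable_on_def differentiable_def)
qed

lemma C_k_SucE:
  assumes "C_k (Suc k) f"
  shows "(f has_derivative frechet_derivative f (at p)) (at p)" 
    "b \<in> Basis \<Longrightarrow> C_k k (\<lambda>p. frechet_derivative f (at p) b)" "C_k k f"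
  using assms C_k_Suc_imp[OF assms] by (auto simp: differentiable_on_def frechet_derivative_works)

declare C_k.simps(2) [simp del]

lemma C_k_const: "C_k k (\<lambda>_. c)"
proof (induction k arbitrary: c)
  case (Suc k)
  show ?case by (rule C_k_SucI[where D = "\<lambda>_ _. 0"]) (auto intro: Suc)
qed simp

lemma C_k_linear: "bounded_linear L \<Longrightarrow> C_k k L"
proof (cases k)
  case (Suc j)
  assume "bounded_linear L"
  then show ?thesis unfolding Suc
    by (intro C_k_SucI[where D = "\<lambda>_. L"]) (auto intro: C_k_const bounded_linear_imp_has_derivative)
qed (auto intro: linear_continuous_on)

lemma C_k_linear_compose: "bounded_linear L \<Longrightarrow> C_k k f \<Longrightarrow> C_k k (\<lambda>p. L (f p))"
proof (induction k arbitrary: f)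
  case 0
  then show ?case by (auto intro: bounded_linear.continuous_on)
next
  case (Suc k)
  show ?case
    by (rule C_k_SucI[where D = "\<lambda>p b. L (frechet_derivative f (at p) b)"])
       (rule bounded_linear.has_derivative[OF Suc.prems(1) C_k_SucE(1)[OF Suc.prems(2)]]
         Suc.IH[OF Suc.prems(1)] C_k_SucE(2)[OF Suc.prems(2)] | assumption)+
qed

lemma C_k_add: "C_k k f \<Longrightarrow> C_k k g \<Longrightarrow> C_k k (\<lambda>p. f p + g p)"
proof (induction k arbitrary: f g)
  case 0
  then show ?case by (auto intro: continuous_intros)
next
  case (Suc k)
  show ?case
    by (rule C_k_SucI[where D = "\<lambda>p b. frechet_derivative f (at p) b + frechet_derivative g (at p) b"])
       (rule Suc.IH has_derivative_add C_k_SucE(1,2)[OF Suc.prems(1)] C_k_SucE(1,2)[OF Suc.prems(2)] | assumption)+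
qed

lemma C_k_mult: 
  fixes f g :: "'a::euclidean_space \<Rightarrow> real"
  shows "C_k k f \<Longrightarrow> C_k k g \<Longrightarrow> C_k k (\<lambda>p. f p * g p)"
proof (induction k arbitrary: f g)
  case 0
  then show ?case by (auto intro: continuous_intros)
next
  case (Suc k)
  show ?case
    by (rule C_k_SucI[where D = "\<lambda>p b. f p * frechet_derivative g (at p) b + frechet_derivative f (at p) b * g p"])
       (rule has_derivative_mult C_k_add Suc.IH C_k_SucE[OF Suc.prems(1)] C_k_SucE[OF Suc.prems(2)] | assumption)+
qed

text \<open>
  Turns the Frechet derivative of a function of one variable into a number, the form in which \<open>C_k\<close>
  sees it.
\<close>

lemma frechet_derivative_real:
  fixes f :: "real \<Rightarrow> real"
  assumes "f differentiable (at s)"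
  shows "frechet_derivative f (at s) x = frechet_derivative f (at s) 1 * x"
proof -
  have "frechet_derivative f (at s) (x *\<^sub>R 1) = x *\<^sub>R frechet_derivative f (at s) 1"
    by (rule linear_scale[OF linear_frechet_derivative[OF assms]])
  then show ?thesis by (simp only: real_scaleR_def mult_1_right mult_1_left mult.commute)
qed

lemma C_k_compose: 
  fixes h :: "real \<Rightarrow> real" and f :: "'a::euclidean_space \<Rightarrow> real"
  shows "C_k k h \<Longrightarrow> C_k k f \<Longrightarrow> C_k k (\<lambda>p. h (f p))"
proof (induction k arbitrary: f h)
  case 0
  then show ?case by (auto intro: continuous_on_compose2)
next
  case (Suc k)
  show ?case
  proof (rule C_k_SucI[where D = "\<lambda>p b. frechet_derivative h (at (f p)) 1 * frechet_derivative f (at p) b"])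
    fix p
    have A: "((\<lambda>p. h (f p)) has_derivative (\<lambda>b. frechet_derivative h (at (f p)) (frechet_derivative f (at p) b))) (at p)"
      by (rule has_derivative_compose[OF C_k_SucE(1)[OF Suc.prems(2)] C_k_SucE(1)[OF Suc.prems(1)]])
    show "((\<lambda>p. h (f p)) has_derivative (\<lambda>b. frechet_derivative h (at (f p)) 1 * frechet_derivative f (at p) b)) (at p)"
      by (rule has_derivative_eq_rhs[OF A]) (intro ext frechet_derivative_real C_k_differentiable[OF Suc.prems(1)])
    fix b :: 'a assume "b \<in> Basis"
    then show "C_k k (\<lambda>p. frechet_derivative h (at (f p)) 1 * frechet_derivative f (at p) b)"
      by (intro C_k_mult Suc.IH[of "\<lambda>x. frechet_derivative h (at x) 1"] C_k_SucE(2,3)[OF Suc.prems(2)] C_k_SucE(2)[OF Suc.prems(1)]) auto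
  qed
qed

lemma C_k_realI:
  fixes f :: "real \<Rightarrow> real"
  assumes "\<And>s. (f has_real_derivative f' s) (at s)" "C_k k f'"
  shows "C_k (Suc k) f"
  by (rule C_k_SucI[where D = "\<lambda>p b. f' p * b"]) (use assms in \<open>auto simp: has_field_derivative_def\<close>)

lemma C_k_inverse: 
  fixes f :: "'a::euclidean_space \<Rightarrow> real"
  assumes "\<And>p. f p \<noteq> 0"
  shows "C_k k f \<Longrightarrow> C_k k (\<lambda>p. inverse (f p))"
proof (induction k)
  case 0
  then show ?case using assms by (auto intro: continuous_intros)
next
  case (Suc k)
  show ?case
    by (rule C_k_SucI[where D = "\<lambda>p b. (- 1) * ((inverse (f p) * frechet_derivative f (at p) b) * inverse (f p))"])
       (rule C_k_mult C_k_const Suc.IH C_k_SucE(2,3)[OF Suc.prems(1)] | assumption |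
         force intro!: has_derivative_eq_rhs[OF Deriv.has_derivative_inverse[OF assms C_k_SucE(1)[OF Suc.prems(1)]]])+
qed

lemma C_k_sqrt: 
  fixes f :: "'a::euclidean_space \<Rightarrow> real"
  assumes "\<And>p. f p > 0"
  shows "C_k k f \<Longrightarrow> C_k k (\<lambda>p. sqrt (f p))"
proof (induction k)
  case 0
  then show ?case by (auto intro: continuous_intros)
next
  case (Suc k)
  have nz: "sqrt (f p) \<noteq> 0" for p using assms[of p] by simp
  show ?case
    by (rule C_k_SucI[where D = "\<lambda>p b. frechet_derivative f (at p) b * ((1 / 2) * inverse (sqrt (f p)))"])
       (rule C_k_mult C_k_const C_k_inverse nz Suc.IH C_k_SucE(2,3)[OF Suc.prems(1)] | assumption |
         force intro!: has_derivative_eq_rhs[OF has_derivative_real_sqrt[OF assms C_k_SucE(1)[OF Suc.prems(1)]]] simp: field_simps)+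
qed

lemma C_k_exp: "C_k k (exp :: real \<Rightarrow> real)"
  by (induction k) (auto intro!: C_k_realI[of exp exp] continuous_intros)

lemma C_k_sin_cos: "C_k k (sin :: real \<Rightarrow> real) \<and> C_k k (cos :: real \<Rightarrow> real)"
proof (induction k)
  case (Suc k)
  have "C_k k (\<lambda>s. (- 1) * sin s :: real)" using Suc by (intro C_k_mult C_k_const) auto
  then show ?case using Suc
    by (auto intro!: C_k_realI[of sin cos] C_k_realI[of cos "\<lambda>s. (-1) * sin s"] derivative_eq_intros)
qed (auto intro: continuous_intros)

named_theorems smooth_intros

lemma smooth_const [smooth_intros]: "smooth (\<lambda>_. c)"
  by (simp add: smooth_def C_k_const)
lemma smooth_add [smooth_intros]: "smooth f \<Longrightarrow> smooth g \<Longrightarrow> smooth (\<lambda>p. f p + g p)"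
  by (simp add: smooth_def C_k_add)
lemma smooth_mult [smooth_intros]: "smooth f \<Longrightarrow> smooth g \<Longrightarrow> smooth (\<lambda>p. f p * g p :: real)"
  by (simp add: smooth_def C_k_mult)
lemma smooth_minus [smooth_intros]: "smooth f \<Longrightarrow> smooth (\<lambda>p. - f p :: real)"
  using smooth_mult[OF smooth_const[of "-1"], of f] by simp
lemma smooth_diff [smooth_intros]: "smooth f \<Longrightarrow> smooth g \<Longrightarrow> smooth (\<lambda>p. f p - g p :: real)"
  using smooth_add[of f "\<lambda>p. - g p"] smooth_minus[of g] by simp
lemma smooth_inverse [smooth_intros]: "(\<And>p. f p \<noteq> 0) \<Longrightarrow> smooth f \<Longrightarrow> smooth (\<lambda>p. inverse (f p) :: real)"
  by (simp add: smooth_def C_k_inverse)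
lemma smooth_divide [smooth_intros]: "(\<And>p. g p \<noteq> 0) \<Longrightarrow> smooth f \<Longrightarrow> smooth g \<Longrightarrow> smooth (\<lambda>p. f p / g p :: real)"
  unfolding divide_inverse by (intro smooth_intros)
lemma smooth_power [smooth_intros]: "smooth f \<Longrightarrow> smooth (\<lambda>p. f p ^ n :: real)"
  by (induction n) (auto intro: smooth_intros)
lemma smooth_sqrt [smooth_intros]: "(\<And>p. f p > 0) \<Longrightarrow> smooth f \<Longrightarrow> smooth (\<lambda>p. sqrt (f p))"
  by (simp add: smooth_def C_k_sqrt)
lemma smooth_compose: "smooth h \<Longrightarrow> smooth f \<Longrightarrow> smooth (\<lambda>p. h (f p) :: real)" for h :: "real \<Rightarrow> real"
  by (simp add: smooth_def C_k_compose)
lemma smooth_exp [smooth_intros]: "smooth f \<Longrightarrow> smooth (\<lambda>p. exp (f p) :: real)"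
  by (rule smooth_compose) (simp_all add: smooth_def C_k_exp)
lemma smooth_sin [smooth_intros]: "smooth f \<Longrightarrow> smooth (\<lambda>p. sin (f p) :: real)"
  by (rule smooth_compose) (simp_all add: smooth_def C_k_sin_cos)
lemma smooth_cos [smooth_intros]: "smooth f \<Longrightarrow> smooth (\<lambda>p. cos (f p) :: real)"
  by (rule smooth_compose) (simp_all add: smooth_def C_k_sin_cos)
lemma smooth_linear_compose: "bounded_linear L \<Longrightarrow> smooth f \<Longrightarrow> smooth (\<lambda>p. L (f p))"
  by (simp add: smooth_def C_k_linear_compose)
lemma smooth_coord [smooth_intros]: "smooth (\<lambda>p. p $ i :: real)"
  by (simp add: smooth_def C_k_linear bounded_linear_vec_nth)
lemma smooth_coord_compose [smooth_intros]: "smooth u \<Longrightarrow> smooth (\<lambda>p :: real^'n. u (p $ i) :: real)"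
  by (rule smooth_compose[OF _ smooth_coord])

lemma smooth_C_k_Suc: "smooth f \<Longrightarrow> C_k (Suc k) f"
  by (simp only: smooth_def)

lemma smooth_has_derivative: "smooth f \<Longrightarrow> (f has_derivative frechet_derivative f (at p)) (at p)"
  by (rule C_k_SucE(1)[OF smooth_C_k_Suc])

lemma smooth_frechet: "smooth f \<Longrightarrow> b \<in> Basis \<Longrightarrow> smooth (\<lambda>p. frechet_derivative f (at p) b)"
  unfolding smooth_def using C_k_SucE(2) by blast

lemma smooth_continuous: "smooth f \<Longrightarrow> continuous_on S f"
  unfolding smooth_def using C_k.simps(1) continuous_on_subset by blast

lemma smooth_real_deriv:
  fixes f :: "real \<Rightarrow> real"
  assumes "smooth f"
  shows "(f has_real_derivative deriv f s) (at s)" "smooth (deriv f)"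
proof -
  have 1: "(f has_real_derivative frechet_derivative f (at s) 1) (at s)" for s
  proof -
    have "f differentiable (at s)" using smooth_has_derivative[OF assms] by (auto simp: differentiable_def)
    then show ?thesis unfolding has_field_derivative_def
      by (intro has_derivative_eq_rhs[OF smooth_has_derivative[OF assms]] ext frechet_derivative_real)
  qed
  then have 2: "deriv f = (\<lambda>s. frechet_derivative f (at s) 1)" by (auto intro: DERIV_imp_deriv)
  show "(f has_real_derivative deriv f s) (at s)" unfolding 2 by (rule 1)
  show "smooth (deriv f)" unfolding 2 by (rule smooth_frechet[OF assms]) simp
qed

text \<open>
  Each component is differentiated in terms of the other one, so regularity improves step by step.
\<close>

lemma smooth_real_system:
  fixes g h P Q :: "real \<Rightarrow> real"
  assumes "\<And>s. (g has_real_derivative P s * h s) (at s)" "\<And>s. (h has_real_derivative Q s * g s) (at s)"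
    and "smooth P" "smooth Q"
  shows "smooth g" "smooth h"
proof -
  have "C_k k g \<and> C_k k h" for k
  proof (induction k)
    case 0
    have "isCont g s" "isCont h s" for s using assms(1,2) DERIV_isCont by blast+
    then show ?case by (auto intro: continuous_at_imp_continuous_on)
  next
    case (Suc k)
    then show ?case using assms(3,4) 
      by (intro conjI C_k_realI[OF assms(1)] C_k_realI[OF assms(2)] C_k_mult) (auto simp: smooth_def)
  qed
  then show "smooth g" "smooth h" by (auto simp: smooth_def)
qed

section \<open>Partial derivatives in the plane\<close>

lemma partialI: "(f has_derivative f') (at p) \<Longrightarrow> partial i f p = f' (axis i 1)"
  unfolding partial_def by (metis frechet_derivative_at)

lemma axis_in_Basis: "axis i (1::real) \<in> Basis"
  by (simp add: axis_in_Basis_iff)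

lemma smooth_partial: "smooth f \<Longrightarrow> smooth (partial i f)" for f :: "real^'n \<Rightarrow> 'b::real_normed_vector"
  unfolding partial_def[abs_def] by (rule smooth_frechet[OF _ axis_in_Basis])

lemma DERIV_along_1:
  fixes f :: "real^2 \<Rightarrow> real"
  assumes "smooth f"
  shows "((\<lambda>s. f (vector [s, t])) has_real_derivative partial 1 f (vector [s, t])) (at s)"
proof -
  have eq: "vector [s, t] = s *\<^sub>R axis 1 1 + t *\<^sub>R (axis 2 1 :: real^2)" for s t
    by (simp add: vec_eq_iff forall_2 vector_2 axis_def)
  have "((\<lambda>s. s *\<^sub>R axis 1 1 + t *\<^sub>R (axis 2 1 :: real^2)) has_derivative (\<lambda>x. x *\<^sub>R axis 1 1)) (at s)"
    by (auto intro!: derivative_eq_intros)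
  from has_derivative_compose[OF this smooth_has_derivative[OF assms]]
  have "((\<lambda>s. f (vector [s, t])) has_derivative (\<lambda>x. frechet_derivative f (at (vector [s, t])) (x *\<^sub>R axis 1 1))) (at s)"
    unfolding eq .
  moreover have "frechet_derivative f (at (vector [s, t])) (x *\<^sub>R axis 1 1) = partial 1 f (vector [s, t]) * x" for x
    unfolding partial_def using smooth_has_derivative[OF assms, of "vector [s,t]"] 
    by (subst linear_scale) (auto dest: has_derivative_linear)
  ultimately show ?thesis by (simp add: has_field_derivative_def)
qed

lemma DERIV_along_2:
  fixes f :: "real^2 \<Rightarrow> real"
  assumes "smooth f"
  shows "((\<lambda>t. f (vector [s, t])) has_real_derivative partial 2 f (vector [s, t])) (at t)"
proof -
  have eq: "vector [s, t] = s *\<^sub>R axis 1 1 + t *\<^sub>R (axis 2 1 :: real^2)" for s t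
    by (simp add: vec_eq_iff forall_2 vector_2 axis_def)
  have "((\<lambda>t. s *\<^sub>R axis 1 1 + t *\<^sub>R (axis 2 1 :: real^2)) has_derivative (\<lambda>x. x *\<^sub>R axis 2 1)) (at t)"
    by (auto intro!: derivative_eq_intros)
  from has_derivative_compose[OF this smooth_has_derivative[OF assms]]
  have "((\<lambda>t. f (vector [s, t])) has_derivative (\<lambda>x. frechet_derivative f (at (vector [s, t])) (x *\<^sub>R axis 2 1))) (at t)"
    unfolding eq .
  moreover have "frechet_derivative f (at (vector [s, t])) (x *\<^sub>R axis 2 1) = partial 2 f (vector [s, t]) * x" for x
    unfolding partial_def using smooth_has_derivative[OF assms, of "vector [s,t]"] 
    by (subst linear_scale) (auto dest: has_derivative_linear)
  ultimately show ?thesis by (simp add: has_field_derivative_def)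
qed

lemma partial_mult_coord:
  fixes f :: "real^2 \<Rightarrow> real" and u :: "real \<Rightarrow> real"
  assumes "smooth f" "(u has_real_derivative u') (at (p $ 1))"
  shows "partial 1 (\<lambda>q. u (q $ 1) * f q) p = u' * f p + u (p $ 1) * partial 1 f p"
    "partial 2 (\<lambda>q. u (q $ 1) * f q) p = u (p $ 1) * partial 2 f p"
proof -
  have "((\<lambda>q. u (q $ 1)) has_derivative (\<lambda>x. u' * (x $ 1))) (at p)"
    using has_derivative_compose[OF bounded_linear_imp_has_derivative[OF bounded_linear_vec_nth] assms(2)[unfolded has_field_derivative_def]] .
  from has_derivative_mult[OF this smooth_has_derivative[OF assms(1)]]
  have "((\<lambda>q. u (q $ 1) * f q) has_derivative (\<lambda>h. u (p $ 1) * frechet_derivative f (at p) h + u' * (h $ 1) * f p)) (at p)" .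
  from partialI[OF this] show "partial 1 (\<lambda>q. u (q $ 1) * f q) p = u' * f p + u (p $ 1) * partial 1 f p"
    "partial 2 (\<lambda>q. u (q $ 1) * f q) p = u (p $ 1) * partial 2 f p"
    by (auto simp: partial_def axis_def)
qed

lemma has_derivative_sep:
  fixes p :: "real^2" and a f :: "real \<Rightarrow> real"
  assumes "(a has_real_derivative a') (at (p $ 1))" "(f has_real_derivative f') (at (p $ 2))"
  shows "((\<lambda>q. a (q $ 1) * f (q $ 2)) has_derivative (\<lambda>h. a' * f (p $ 2) * h $ 1 + a (p $ 1) * f' * h $ 2)) (at p)"
proof -
  have "((\<lambda>q. a (q $ 1)) has_derivative (\<lambda>x. a' * (x $ 1))) (at p)"
    using has_derivative_compose[OF bounded_linear_imp_has_derivative[OF bounded_linear_vec_nth] assms(1)[unfolded has_field_derivative_def]] .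
  moreover have "((\<lambda>q. f (q $ 2)) has_derivative (\<lambda>x. f' * (x $ 2))) (at p)"
    using has_derivative_compose[OF bounded_linear_imp_has_derivative[OF bounded_linear_vec_nth] assms(2)[unfolded has_field_derivative_def]] .
  ultimately show ?thesis
    by (rule has_derivative_eq_rhs[OF has_derivative_mult]) (auto simp: fun_eq_iff algebra_simps)
qed

text \<open>
  The position vector, its derivatives and the eigenfunctions in one Fourier mode are all built from
  products of a function of each coordinate.
\<close>

lemma partial_sep:
  fixes p :: "real^2" and a f :: "real \<Rightarrow> real"
  assumes "(a has_real_derivative a') (at (p $ 1))" "(f has_real_derivative f') (at (p $ 2))"
  shows "partial 1 (\<lambda>q. a (q $ 1) * f (q $ 2)) p = a' * f (p $ 2)"
    "partial 2 (\<lambda>q. a (q $ 1) * f (q $ 2)) p = a (p $ 1) * f'"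
  by (subst partialI[OF has_derivative_sep[OF assms]]; simp add: axis_def)+

lemma vector_3_eq: "vector [a, b, c] = a *\<^sub>R axis 1 1 + b *\<^sub>R axis 2 1 + c *\<^sub>R (axis 3 1 :: real^3)"
  by (simp add: vec_eq_iff forall_3 vector_3 axis_def)

lemma partial_sep_vector:
  fixes p :: "real^2" and a b c f g h :: "real \<Rightarrow> real"
  assumes "(a has_real_derivative a') (at (p $ 1))" "(f has_real_derivative f') (at (p $ 2))"
    "(b has_real_derivative b') (at (p $ 1))" "(g has_real_derivative g') (at (p $ 2))"
    "(c has_real_derivative c') (at (p $ 1))" "(h has_real_derivative h') (at (p $ 2))"
  shows "partial 1 (\<lambda>q. vector [a (q $ 1) * f (q $ 2), b (q $ 1) * g (q $ 2), c (q $ 1) * h (q $ 2)] :: real^3) p =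
      vector [a' * f (p $ 2), b' * g (p $ 2), c' * h (p $ 2)]"
    "partial 2 (\<lambda>q. vector [a (q $ 1) * f (q $ 2), b (q $ 1) * g (q $ 2), c (q $ 1) * h (q $ 2)] :: real^3) p =
      vector [a (p $ 1) * f', b (p $ 1) * g', c (p $ 1) * h']"
proof -
  note D = has_derivative_add[OF has_derivative_add[OF 
     has_derivative_scaleR_left[OF has_derivative_sep[OF assms(1,2)], of "axis 1 1"]
     has_derivative_scaleR_left[OF has_derivative_sep[OF assms(3,4)], of "axis 2 1"]]
     has_derivative_scaleR_left[OF has_derivative_sep[OF assms(5,6)], of "axis 3 1"]]
  show "partial 1 (\<lambda>q. vector [a (q $ 1) * f (q $ 2), b (q $ 1) * g (q $ 2), c (q $ 1) * h (q $ 2)] :: real^3) p =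
      vector [a' * f (p $ 2), b' * g (p $ 2), c' * h (p $ 2)]"
   "partial 2 (\<lambda>q. vector [a (q $ 1) * f (q $ 2), b (q $ 1) * g (q $ 2), c (q $ 1) * h (q $ 2)] :: real^3) p =
      vector [a (p $ 1) * f', b (p $ 1) * g', c (p $ 1) * h']"
    unfolding vector_3_eq by (subst partialI[OF D]; simp add: axis_def)+
qed

lemma inner_vector_3: "vector [a, b, c] \<bullet> (vector [a', b', c'] :: real^3) = a * a' + b * b' + c * c'"
  by (simp add: inner_vec_def sum_3 vector_3)

definition diag2 :: "real \<Rightarrow> real \<Rightarrow> real^2^2" where
  "diag2 a b = vector [vector [a, 0], vector [0, b]]"

lemma diag2_nth: "diag2 a b $ 1 $ 1 = a" "diag2 a b $ 1 $ 2 = 0" "diag2 a b $ 2 $ 1 = 0" "diag2 a b $ 2 $ 2 = b"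
  by (auto simp: diag2_def vector_2)

lemma eq_diag2: "M = diag2 a b \<longleftrightarrow> M $ 1 $ 1 = a \<and> M $ 1 $ 2 = 0 \<and> M $ 2 $ 1 = 0 \<and> M $ 2 $ 2 = b"
  by (simp add: vec_eq_iff forall_2 diag2_nth)

lemma diag2_mult: "diag2 a b ** diag2 c d = diag2 (a * c) (b * d)"
  unfolding eq_diag2 by (simp add: matrix_matrix_mult_def sum_2 diag2_nth)

lemma diag2_ops: "trace (diag2 a b) = a + b" "transpose (diag2 a b) = diag2 a b" "det (diag2 a b) = a * b"
  "diag2 a b *v x = vector [a * x $ 1, b * x $ 2]"
  unfolding eq_diag2
  by (auto simp: trace_def sum_2 diag2_nth transpose_def det_2 matrix_vector_mult_def vec_eq_iff forall_2 vector_2 eq_diag2)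

lemma matrix_inv_diag2:
  assumes "a \<noteq> 0" "b \<noteq> 0"
  shows "matrix_inv (diag2 a b) = diag2 (1 / a) (1 / b)"
proof -
  have one: "diag2 1 1 = mat 1" by (simp add: vec_eq_iff forall_2 diag2_nth mat_def)
  have inv: "diag2 a b ** diag2 (1 / a) (1 / b) = mat 1" "diag2 (1 / a) (1 / b) ** diag2 a b = mat 1"
    using assms by (simp_all add: diag2_mult one)
  then have "matrix_inv (diag2 a b) ** diag2 a b = mat 1"
    unfolding matrix_inv_def by (rule_tac someI2[of _ "diag2 (1 / a) (1 / b)"]) auto
  then have "(matrix_inv (diag2 a b) ** diag2 a b) ** diag2 (1 / a) (1 / b) = diag2 (1 / a) (1 / b)" by simp
  then show ?thesis by (simp add: matrix_mul_assoc[symmetric] inv)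
qed

section \<open>Geometry of a torus of revolution\<close>

locale profile =
  fixes r z :: "real \<Rightarrow> real"
  assumes smooth_rz: "smooth r" "smooth z"
    and per_rz: "r (s + 2 * pi) = r s" "z (s + 2 * pi) = z s"
    and r_pos: "r s > 0"
    and regular: "deriv r s \<noteq> 0 \<or> deriv z s \<noteq> 0"
begin

text \<open>
  Speed \<open>v\<close>, unit tangent \<open>(c, sg)\<close> and curvature \<open>kap\<close> of the profile, with the Frenet equations
  \<open>c' = - kap v sg\<close> and \<open>sg' = kap v c\<close>.  The weight \<open>w\<close> combines the radius of the circle of rotation
  with the Gaussian factor, so \<open>w v ds\<close> is the length element of the conformal metric.
\<close>

definition v where "v s = sqrt ((deriv r s)\<^sup>2 + (deriv z s)\<^sup>2)"
definition c where "c s = deriv r s / v s"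
definition sg where "sg s = deriv z s / v s"
definition kap where "kap s = (deriv r s * deriv (deriv z) s - deriv z s * deriv (deriv r) s) / v s ^ 3"
definition w where "w s = r s * exp (- ((r s)\<^sup>2 + (z s)\<^sup>2) / 4)"
abbreviation X where "X \<equiv> torus_of_revolution (\<lambda>s. (r s, z s))"

lemma v_arg_pos: "(deriv r s)\<^sup>2 + (deriv z s)\<^sup>2 > 0"
  using regular[of s] by (auto simp: sum_power2_gt_zero_iff)

lemma v_pos: "v s > 0" unfolding v_def using v_arg_pos[of s] by simp
lemma v_nz: "v s \<noteq> 0" using v_pos[of s] by simp
lemma r_nz: "r s \<noteq> 0" using r_pos[of s] by simp
lemma w_pos: "w s > 0" by (simp add: w_def r_pos)
lemma w_nz: "w s \<noteq> 0" using w_pos[of s] by simp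

lemma v_sq: "(v s)\<^sup>2 = (deriv r s)\<^sup>2 + (deriv z s)\<^sup>2"
  unfolding v_def using v_arg_pos[of s] by simp

lemma smooth_deriv: "smooth (deriv r)" "smooth (deriv z)" "smooth (deriv (deriv r))" "smooth (deriv (deriv z))"
  by (intro smooth_real_deriv(2) smooth_rz)+

lemma smooth_v [smooth_intros]: "smooth v"
  unfolding v_def[abs_def] by (intro smooth_intros smooth_deriv v_arg_pos)
lemma smooth_c [smooth_intros]: "smooth c"
  unfolding c_def[abs_def] by (intro smooth_intros smooth_deriv v_nz)
lemma smooth_sg [smooth_intros]: "smooth sg"
  unfolding sg_def[abs_def] by (intro smooth_intros smooth_deriv v_nz)
lemma smooth_w [smooth_intros]: "smooth w"
  unfolding w_def[abs_def] by (intro smooth_intros smooth_rz) auto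

lemma deriv_rz_eq: "deriv r s = v s * c s" "deriv z s = v s * sg s"
  by (simp_all add: c_def sg_def v_nz)

lemma DERIV_r: "(r has_real_derivative v s * c s) (at s)"
  using smooth_real_deriv(1)[OF smooth_rz(1)] by (simp add: deriv_rz_eq)
lemma DERIV_z: "(z has_real_derivative v s * sg s) (at s)"
  using smooth_real_deriv(1)[OF smooth_rz(2)] by (simp add: deriv_rz_eq)

lemma c_sg: "(c s)\<^sup>2 + (sg s)\<^sup>2 = 1"
proof -
  have "(v s)\<^sup>2 * ((c s)\<^sup>2 + (sg s)\<^sup>2) = (v s)\<^sup>2 * 1"
    using v_sq[of s] unfolding deriv_rz_eq by (simp add: power_mult_distrib distrib_left)
  then show ?thesis using v_nz[of s] by (simp only: mult_cancel_left) simp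
qed

lemma DERIV_v: "(v has_real_derivative (deriv r s * deriv (deriv r) s + deriv z s * deriv (deriv z) s) / v s) (at s)"
proof -
  define m where "m = deriv r s * deriv (deriv r) s + deriv z s * deriv (deriv z) s"
  have "((\<lambda>s. (deriv r s)\<^sup>2 + (deriv z s)\<^sup>2) has_real_derivative 2 * m) (at s)"
    by (auto intro!: derivative_eq_intros smooth_real_deriv(1) smooth_deriv simp: m_def algebra_simps)
  from DERIV_chain2[of sqrt _ "\<lambda>s. (deriv r s)\<^sup>2 + (deriv z s)\<^sup>2" s, OF DERIV_real_sqrt[OF v_arg_pos[of s]] this] 
  have "(v has_real_derivative inverse (v s) / 2 * (2 * m)) (at s)"
    by (simp only: v_def[abs_def])
  also have "inverse (v s) / 2 * (2 * m) = m / v s" using v_nz[of s] by (simp add: field_simps)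
  finally have "(v has_real_derivative m / v s) (at s)" .
  then show ?thesis by (simp add: m_def)
qed

lemma DERIV_c: "(c has_real_derivative - kap s * v s * sg s) (at s)"
proof -
  have "(c has_real_derivative (deriv (deriv r) s * v s - deriv r s * ((deriv r s * deriv (deriv r) s + deriv z s * deriv (deriv z) s) / v s)) / (v s * v s)) (at s)"
    unfolding c_def[abs_def] by (intro DERIV_divide smooth_real_deriv(1) smooth_deriv DERIV_v v_nz)
  also have "(deriv (deriv r) s * v s - deriv r s * ((deriv r s * deriv (deriv r) s + deriv z s * deriv (deriv z) s) / v s)) / (v s * v s)
     = (deriv (deriv r) s * (v s)\<^sup>2 - deriv r s * (deriv r s * deriv (deriv r) s + deriv z s * deriv (deriv z) s)) / v s ^ 3"
    using v_nz[of s] by (simp add: field_simps power2_eq_square power3_eq_cube)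
  also have "\<dots> = - kap s * v s * sg s"
    unfolding v_sq kap_def sg_def using v_nz[of s] by (simp add: field_simps power2_eq_square)
  finally show ?thesis .
qed

lemma DERIV_sg: "(sg has_real_derivative kap s * v s * c s) (at s)"
proof -
  have "(sg has_real_derivative (deriv (deriv z) s * v s - deriv z s * ((deriv r s * deriv (deriv r) s + deriv z s * deriv (deriv z) s) / v s)) / (v s * v s)) (at s)"
    unfolding sg_def[abs_def] by (intro DERIV_divide smooth_real_deriv(1) smooth_deriv DERIV_v v_nz)
  also have "(deriv (deriv z) s * v s - deriv z s * ((deriv r s * deriv (deriv r) s + deriv z s * deriv (deriv z) s) / v s)) / (v s * v s)
     = (deriv (deriv z) s * (v s)\<^sup>2 - deriv z s * (deriv r s * deriv (deriv r) s + deriv z s * deriv (deriv z) s)) / v s ^ 3"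
    using v_nz[of s] by (simp add: field_simps power2_eq_square power3_eq_cube)
  also have "\<dots> = kap s * v s * c s"
    unfolding v_sq kap_def c_def using v_nz[of s] by (simp add: field_simps power2_eq_square)
  finally show ?thesis .
qed

lemma DERIV_w: "(w has_real_derivative w s * v s * (c s / r s - (r s * c s + z s * sg s) / 2)) (at s)"
proof -
  have "(w has_real_derivative v s * c s * exp (- ((r s)\<^sup>2 + (z s)\<^sup>2) / 4) + 
     exp (- ((r s)\<^sup>2 + (z s)\<^sup>2) / 4) * (- (2 * r s * (v s * c s) + 2 * z s * (v s * sg s)) / 4) * r s) (at s)"
    unfolding w_def[abs_def] by (auto intro!: derivative_eq_intros DERIV_r DERIV_z)
  also have "v s * c s * exp (- ((r s)\<^sup>2 + (z s)\<^sup>2) / 4) + 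
     exp (- ((r s)\<^sup>2 + (z s)\<^sup>2) / 4) * (- (2 * r s * (v s * c s) + 2 * z s * (v s * sg s)) / 4) * r s =
     w s * v s * (c s / r s - (r s * c s + z s * sg s) / 2)"
    unfolding w_def using r_nz[of s] by (simp add: field_simps)
  finally show ?thesis .
qed

lemma deriv_per:
  assumes "smooth f" "\<And>s. f (s + 2 * pi) = f s"
  shows "deriv f (s + 2 * pi) = deriv f s"
proof -
  have "((\<lambda>s. f (s + 2 * pi)) has_real_derivative deriv f (s + 2 * pi)) (at s)"
    using DERIV_shift[of f "deriv f (s + 2 * pi)" s "2 * pi"] smooth_real_deriv(1)[OF assms(1)] by blast
  then show ?thesis using smooth_real_deriv(1)[OF assms(1), of s] unfolding assms(2) using DERIV_unique by blast
qed

lemma per_geo: "v (s + 2 * pi) = v s" "c (s + 2 * pi) = c s" "sg (s + 2 * pi) = sg s" "w (s + 2 * pi) = w s" "kap (s + 2 * pi) = kap s"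
  unfolding v_def c_def sg_def w_def kap_def per_rz deriv_per[OF smooth_rz(1) per_rz(1)] deriv_per[OF smooth_rz(2) per_rz(2)]
    deriv_per[OF smooth_deriv(1) deriv_per[OF smooth_rz(1) per_rz(1)]] deriv_per[OF smooth_deriv(2) deriv_per[OF smooth_rz(2) per_rz(2)]]
  by simp_all

lemma X_eq: "X = (\<lambda>p. vector [r (p $ 1) * cos (p $ 2), r (p $ 1) * sin (p $ 2), z (p $ 1) * 1])"
  by (rule ext) (simp add: torus_of_revolution_def Let_def)

lemma norm_X: "(norm (X p))\<^sup>2 = (r (p $ 1))\<^sup>2 + (z (p $ 1))\<^sup>2"
proof -
  have "(norm (X p))\<^sup>2 = (r (p $ 1))\<^sup>2 * ((cos (p $ 2))\<^sup>2 + (sin (p $ 2))\<^sup>2) + (z (p $ 1))\<^sup>2"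
    unfolding power2_norm_eq_inner X_eq inner_vector_3 by algebra
  then show ?thesis by simp
qed

lemma partial_X:
  "partial 1 X = (\<lambda>p. vector [(v (p $ 1) * c (p $ 1)) * cos (p $ 2), (v (p $ 1) * c (p $ 1)) * sin (p $ 2), (v (p $ 1) * sg (p $ 1)) * 1])"
  "partial 2 X = (\<lambda>p. vector [r (p $ 1) * (- sin (p $ 2)), r (p $ 1) * cos (p $ 2), z (p $ 1) * 0])"
proof -
  have "partial 1 X p = vector [(v (p $ 1) * c (p $ 1)) * cos (p $ 2), (v (p $ 1) * c (p $ 1)) * sin (p $ 2), (v (p $ 1) * sg (p $ 1)) * 1]"
    "partial 2 X p = vector [r (p $ 1) * (- sin (p $ 2)), r (p $ 1) * cos (p $ 2), z (p $ 1) * 0]" for p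
    unfolding X_eq
    using partial_sep_vector[OF DERIV_r DERIV_cos DERIV_r DERIV_sin DERIV_z DERIV_const[of 1], of p] by simp_all
  then show "partial 1 X = (\<lambda>p. vector [(v (p $ 1) * c (p $ 1)) * cos (p $ 2), (v (p $ 1) * c (p $ 1)) * sin (p $ 2), (v (p $ 1) * sg (p $ 1)) * 1])"
  "partial 2 X = (\<lambda>p. vector [r (p $ 1) * (- sin (p $ 2)), r (p $ 1) * cos (p $ 2), z (p $ 1) * 0])" by auto
qed

definition vd where "vd s = (deriv r s * deriv (deriv r) s + deriv z s * deriv (deriv z) s) / v s"

lemma DERIV_vc: "((\<lambda>s. v s * c s) has_real_derivative vd s * c s - kap s * (v s)\<^sup>2 * sg s) (at s)"
  "((\<lambda>s. v s * sg s) has_real_derivative vd s * sg s + kap s * (v s)\<^sup>2 * c s) (at s)"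
  by (auto intro!: derivative_eq_intros DERIV_v[folded vd_def] DERIV_c DERIV_sg simp: power2_eq_square)

lemma partial_partial_X:
  "partial 1 (partial 1 X) p = vector [(vd (p $ 1) * c (p $ 1) - kap (p $ 1) * (v (p $ 1))\<^sup>2 * sg (p $ 1)) * cos (p $ 2), 
     (vd (p $ 1) * c (p $ 1) - kap (p $ 1) * (v (p $ 1))\<^sup>2 * sg (p $ 1)) * sin (p $ 2), 
     (vd (p $ 1) * sg (p $ 1) + kap (p $ 1) * (v (p $ 1))\<^sup>2 * c (p $ 1)) * 1]"
  "partial 2 (partial 1 X) p = vector [(v (p $ 1) * c (p $ 1)) * (- sin (p $ 2)), (v (p $ 1) * c (p $ 1)) * cos (p $ 2), (v (p $ 1) * sg (p $ 1)) * 0]"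
  "partial 1 (partial 2 X) p = vector [(v (p $ 1) * c (p $ 1)) * (- sin (p $ 2)), (v (p $ 1) * c (p $ 1)) * cos (p $ 2), (v (p $ 1) * sg (p $ 1)) * 0]"
  "partial 2 (partial 2 X) p = vector [r (p $ 1) * (- cos (p $ 2)), r (p $ 1) * (- sin (p $ 2)), z (p $ 1) * 0]"
  unfolding partial_X
  using partial_sep_vector[OF DERIV_vc(1) DERIV_cos DERIV_vc(1) DERIV_sin DERIV_vc(2) DERIV_const[of 1], of p]
    partial_sep_vector[OF DERIV_r DERIV_minus[OF DERIV_sin] DERIV_r DERIV_cos DERIV_z DERIV_const[of 0], of p]
  by simp_all

lemma metric_X: "metric X p = diag2 ((v (p $ 1))\<^sup>2) ((r (p $ 1))\<^sup>2)"
proof -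
  have cs: "(cos (p $ 2))\<^sup>2 + (sin (p $ 2))\<^sup>2 = 1" by simp
  show ?thesis unfolding eq_diag2 metric_def vec_lambda_beta partial_X inner_vector_3
    by (intro conjI; ((simp add: algebra_simps; fail) | (insert cs c_sg[of "p $ 1"]; algebra)))
qed

lemma area_X: "area_density X p = v (p $ 1) * r (p $ 1)"
  unfolding area_density_def metric_X diag2_ops using v_pos[of "p $ 1"] r_pos[of "p $ 1"]
  by (simp add: real_sqrt_mult)

lemma normal_X: "unit_normal X p = vector [- sg (p $ 1) * cos (p $ 2), - sg (p $ 1) * sin (p $ 2), c (p $ 1)]"
proof -
  define N :: "real^3" where "N = vector [- sg (p $ 1) * cos (p $ 2), - sg (p $ 1) * sin (p $ 2), c (p $ 1)]"
  have "(cos (p $ 2))\<^sup>2 + (sin (p $ 2))\<^sup>2 = 1" by simp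
  then have e: "cross3 (partial 1 X p) (partial 2 X p) = (v (p $ 1) * r (p $ 1)) *\<^sub>R N"
    unfolding partial_X N_def cross3_def vec_eq_iff forall_3 vector_3 vector_scaleR_component real_scaleR_def
    by (intro conjI; ((simp add: algebra_simps; fail) | algebra))
  have "norm N ^ 2 = (sg (p $ 1))\<^sup>2 * ((cos (p $ 2))\<^sup>2 + (sin (p $ 2))\<^sup>2) + (c (p $ 1))\<^sup>2"
    unfolding power2_norm_eq_inner N_def inner_vector_3 by algebra
  then have "norm N ^ 2 = 1" using c_sg[of "p $ 1"] by simp
  then have "norm N = 1" by (simp add: power2_eq_1_iff) (metis norm_ge_zero zero_neq_one neg_0_le_iff_le not_one_le_zero)
  then have "sgn N = N" by (simp add: sgn_div_norm)
  then show ?thesis unfolding unit_normal_def e sgn_scaleR N_def[symmetric] 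
    using v_pos[of "p $ 1"] r_pos[of "p $ 1"] by simp
qed

lemma second_ff_X: "second_ff X p = diag2 (kap (p $ 1) * (v (p $ 1))\<^sup>2) (r (p $ 1) * sg (p $ 1))"
proof -
  have cs: "(cos (p $ 2))\<^sup>2 + (sin (p $ 2))\<^sup>2 = 1" by simp
  show ?thesis unfolding eq_diag2 second_ff_def vec_lambda_beta normal_X partial_partial_X inner_vector_3
    by (intro conjI; ((simp add: algebra_simps; fail) | (insert cs c_sg[of "p $ 1"]; algebra)))
qed

lemma mean_curvature_X: "mean_curvature X p = - (kap (p $ 1) + sg (p $ 1) / r (p $ 1))"
  unfolding mean_curvature_def metric_X second_ff_X
  using v_nz[of "p $ 1"] r_nz[of "p $ 1"]
  by (simp add: matrix_inv_diag2 diag2_mult diag2_ops power2_eq_square)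

lemma norm_A_X: "norm_A_squared X p = (kap (p $ 1))\<^sup>2 + (sg (p $ 1))\<^sup>2 / (r (p $ 1))\<^sup>2"
  unfolding norm_A_squared_def metric_X second_ff_X Let_def
  using v_nz[of "p $ 1"] r_nz[of "p $ 1"]
  by (simp add: matrix_inv_diag2 diag2_mult diag2_ops field_simps power2_eq_square)

definition q where "q s = w s / v s"

lemma smooth_q [smooth_intros]: "smooth q"
  unfolding q_def[abs_def] by (intro smooth_intros v_nz)

text \<open>
  The metric is the diagonal matrix of \<open>v\<^sup>2\<close> and \<open>r\<^sup>2\<close>.  The Gaussian factor depends on the first
  coordinate only, hence cancels in the angular part and turns the radial flux into \<open>q\<close> times the
  radial derivative.
\<close>

lemma stability_X:
  assumes "smooth f"
  shows "stability_operator X f p = 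
     (deriv q (p $ 1) * partial 1 f p + q (p $ 1) * partial 1 (partial 1 f) p) / (w (p $ 1) * v (p $ 1))
     + partial 2 (partial 2 f) p / (r (p $ 1))\<^sup>2 
     + ((kap (p $ 1))\<^sup>2 + (sg (p $ 1))\<^sup>2 / (r (p $ 1))\<^sup>2 + 1 / 2) * f p"
proof -
  define E where "E s = exp (- ((r s)\<^sup>2 + (z s)\<^sup>2) / 4)" for s
  define b where "b s = v s * E s / r s" for s
  have sb: "smooth b" unfolding b_def[abs_def] E_def[abs_def] by (intro smooth_intros smooth_rz r_nz) auto
  have grad: "surface_grad X f q' = vector [1 / (v (q' $ 1))\<^sup>2 * partial 1 f q', 1 / (r (q' $ 1))\<^sup>2 * partial 2 f q']" for q'
    unfolding surface_grad_def metric_X using v_nz[of "q' $ 1"] r_nz[of "q' $ 1"]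
    by (simp add: matrix_inv_diag2 diag2_ops)
  have 1: "(\<lambda>q'. area_density X q' * (exp (- (norm (X q'))\<^sup>2 / 4) *\<^sub>R surface_grad X f q') $ 1) = (\<lambda>q'. q (q' $ 1) * partial 1 f q')"
    unfolding grad area_X norm_X q_def w_def 
    by (rule ext) (simp add: field_simps power2_eq_square v_nz)
  have 2: "(\<lambda>q'. area_density X q' * (exp (- (norm (X q'))\<^sup>2 / 4) *\<^sub>R surface_grad X f q') $ 2) = (\<lambda>q'. b (q' $ 1) * partial 2 f q')"
    unfolding grad area_X norm_X b_def E_def
    by (rule ext) (simp add: field_simps power2_eq_square r_nz)
  have 3: "exp (((r (p $ 1))\<^sup>2 + (z (p $ 1))\<^sup>2) / 4) = 1 / E (p $ 1)"
    unfolding E_def by (simp only: minus_divide_left[symmetric] exp_minus inverse_eq_divide) simp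
  have E: "E (p $ 1) \<noteq> 0" by (simp add: E_def)
  have w: "w (p $ 1) = r (p $ 1) * E (p $ 1)" by (simp add: w_def E_def)
  have "drift_laplacian X f p = 
     1 / E (p $ 1) * ((deriv q (p $ 1) * partial 1 f p + q (p $ 1) * partial 1 (partial 1 f) p + b (p $ 1) * partial 2 (partial 2 f) p) 
     / (v (p $ 1) * r (p $ 1)))"
    unfolding drift_laplacian_def surface_div_def norm_X sum_2 1[unfolded norm_X area_X] 2[unfolded norm_X area_X] 3 area_X
    by (subst partial_mult_coord(1)[OF smooth_partial[OF assms] smooth_real_deriv(1)[OF smooth_q]], 
        subst partial_mult_coord(2)[OF smooth_partial[OF assms] smooth_real_deriv(1)[OF sb]]) simp
  also have "\<dots> = (deriv q (p $ 1) * partial 1 f p + q (p $ 1) * partial 1 (partial 1 f) p) / (w (p $ 1) * v (p $ 1))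
     + partial 2 (partial 2 f) p / (r (p $ 1))\<^sup>2"
    unfolding w b_def using E v_nz[of "p $ 1"] r_nz[of "p $ 1"] by (simp add: field_simps power2_eq_square)
  finally show ?thesis unfolding stability_operator_def norm_A_X by (simp add: algebra_simps)
qed

end

lemma profile_of_curve:
  assumes "closed_half_plane_curve \<gamma>"
  shows "profile (\<lambda>s. fst (\<gamma> s)) (\<lambda>s. snd (\<gamma> s))"
proof
  have sm: "smooth \<gamma>" using assms by (simp add: closed_half_plane_curve_def)
  show r: "smooth (\<lambda>s. fst (\<gamma> s))" by (rule smooth_linear_compose[OF bounded_linear_fst sm])
  show z: "smooth (\<lambda>s. snd (\<gamma> s))" by (rule smooth_linear_compose[OF bounded_linear_snd sm])
  fix s
  show "fst (\<gamma> (s + 2 * pi)) = fst (\<gamma> s)" "snd (\<gamma> (s + 2 * pi)) = snd (\<gamma> s)" "fst (\<gamma> s) > 0"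
    using assms by (auto simp: closed_half_plane_curve_def)
  have "((\<lambda>s. (fst (\<gamma> s), snd (\<gamma> s))) has_vector_derivative (deriv (\<lambda>s. fst (\<gamma> s)) s, deriv (\<lambda>s. snd (\<gamma> s)) s)) (at s)"
    using smooth_real_deriv(1)[OF r, of s] smooth_real_deriv(1)[OF z, of s]
    by (intro has_vector_derivative_Pair) (auto simp: has_real_derivative_iff_has_vector_derivative)
  then have "vector_derivative \<gamma> (at s) = (deriv (\<lambda>s. fst (\<gamma> s)) s, deriv (\<lambda>s. snd (\<gamma> s)) s)"
    by (simp add: vector_derivative_at)
  then show "deriv (\<lambda>s. fst (\<gamma> s)) s \<noteq> 0 \<or> deriv (\<lambda>s. snd (\<gamma> s)) s \<noteq> 0"
    using assms by (auto simp: closed_half_plane_curve_def zero_prod_def)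
qed

section \<open>Self-shrinking profiles and their radial operators\<close>

locale shrinker_profile = profile +
  assumes shrinker: "kap s = - sg s / r s - (z s * c s - r s * sg s) / 2"
begin

lemma c_sq: "(c s)\<^sup>2 = 1 - (sg s)\<^sup>2"
  using c_sg[of s] by simp

text \<open>
  Differentiating the shrinker equation instead of the definition of \<open>kap\<close> expresses \<open>kap'\<close> without
  third derivatives of the profile.
\<close>

lemma DERIV_kap: "(kap has_real_derivative 
    v s * (- kap s * c s / r s + sg s * c s / (r s)\<^sup>2 + kap s * (z s * sg s + r s * c s) / 2)) (at s)"
proof -
  have eq: "kap = (\<lambda>s. - sg s / r s - (z s * c s - r s * sg s) / 2)" using shrinker by auto
  have "((\<lambda>s. - sg s / r s - (z s * c s - r s * sg s) / 2) has_real_derivative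
     (- (kap s * v s * c s) * r s - - sg s * (v s * c s)) / (r s * r s) - 
     ((v s * sg s) * c s + (- kap s * v s * sg s) * z s - ((v s * c s) * sg s + (kap s * v s * c s) * r s)) / 2) (at s)"
    by (intro DERIV_diff DERIV_divide DERIV_cdivide DERIV_mult DERIV_minus DERIV_sg DERIV_c DERIV_r DERIV_z r_nz)
  also have "(- (kap s * v s * c s) * r s - - sg s * (v s * c s)) / (r s * r s) - 
     ((v s * sg s) * c s + (- kap s * v s * sg s) * z s - ((v s * c s) * sg s + (kap s * v s * c s) * r s)) / 2
     = v s * (- kap s * c s / r s + sg s * c s / (r s)\<^sup>2 + kap s * (z s * sg s + r s * c s) / 2)"
    using r_nz[of s] by (simp add: field_simps power2_eq_square)
  finally show ?thesis unfolding eq[symmetric] .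
qed

text \<open>
  The derivative of \<open>ln w\<close> by Euclidean arc length.
\<close>

definition om where "om s = c s / r s - (r s * c s + z s * sg s) / 2"

lemma DERIV_w': "(w has_real_derivative w s * v s * om s) (at s)"
  using DERIV_w unfolding om_def .

text \<open>
  On a self-shrinker, \<open>ln w\<close> has the second arc length derivative \<open>\<bar>A\<bar>\<^sup>2 - 1 / 2 - 1 / r\<^sup>2\<close>.  This is why
  the second fundamental form disappears from the radial equation after the substitution \<open>g = w u\<close>.
\<close>

lemma DERIV_om: "(om has_real_derivative v s * ((kap s)\<^sup>2 + (sg s)\<^sup>2 / (r s)\<^sup>2 - 1 / 2 - 1 / (r s)\<^sup>2)) (at s)"
proof -
  have "(om has_real_derivative (- kap s * v s * sg s * r s - c s * (v s * c s)) / (r s * r s) -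
     ((v s * c s) * c s + (- kap s * v s * sg s) * r s + ((v s * sg s) * sg s + (kap s * v s * c s) * z s)) / 2) (at s)"
    unfolding om_def[abs_def]
    by (intro DERIV_diff DERIV_divide DERIV_cdivide DERIV_add DERIV_mult DERIV_minus DERIV_sg DERIV_c DERIV_r DERIV_z r_nz)
  also have "(- kap s * v s * sg s * r s - c s * (v s * c s)) / (r s * r s) -
     ((v s * c s) * c s + (- kap s * v s * sg s) * r s + ((v s * sg s) * sg s + (kap s * v s * c s) * z s)) / 2
     = v s * (- kap s * sg s / r s - (c s)\<^sup>2 / (r s)\<^sup>2 - ((c s)\<^sup>2 + (sg s)\<^sup>2) / 2 - kap s * ((z s * c s - r s * sg s) / 2))"
    using r_nz[of s] by (simp add: field_simps power2_eq_square)
  also have "(z s * c s - r s * sg s) / 2 = - kap s - sg s / r s" using shrinker[of s] by simp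
  also have "v s * (- kap s * sg s / r s - (c s)\<^sup>2 / (r s)\<^sup>2 - ((c s)\<^sup>2 + (sg s)\<^sup>2) / 2 - kap s * (- kap s - sg s / r s)) 
    = v s * ((kap s)\<^sup>2 + (sg s)\<^sup>2 / (r s)\<^sup>2 - 1 / 2 - 1 / (r s)\<^sup>2)"
    unfolding c_sg unfolding c_sq using r_nz[of s] by (simp add: field_simps power2_eq_square)
  finally show ?thesis .
qed

definition pot where "pot k l s = (kap s)\<^sup>2 + (sg s)\<^sup>2 / (r s)\<^sup>2 + 1 / 2 - (real k)\<^sup>2 / (r s)\<^sup>2 + l"

text \<open>
  Coefficients of the radial equation after the substitution \<open>g = w u\<close>.  The quotient \<open>Qm k / Pm\<close> is
  the potential \<open>V\<^sub>k\<close> of the introduction.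
\<close>

definition Pm where "Pm s = w s * v s"
definition Wm where "Wm s = v s / w s"
definition Qm where "Qm k s = Wm s * (1 + (1 - (real k)\<^sup>2) / (r s)\<^sup>2)"

text \<open>
  The radial factors of the eigenfunctions in the \<open>k\<close>-th Fourier mode.
\<close>

definition mode_sols where
  "mode_sols k l = {u. smooth u \<and> (\<forall>s. u (s + 2 * pi) = u s) \<and>
    (\<forall>s. (deriv q s * deriv u s + q s * deriv (deriv u) s) / (w s * v s) + pot k l s * u s = 0)}"

lemma mode_solsI:
  assumes "smooth u" "\<And>s. u (s + 2 * pi) = u s" "\<And>s. deriv u s = u1 s" 
    "\<And>s. ((\<lambda>s. q s * u1 s) has_real_derivative b' s) (at s)"
    "\<And>s. b' s + w s * v s * pot k l s * u s = 0"
  shows "u \<in> mode_sols k l"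
proof -
  have u1: "deriv u = u1" using assms(3) by auto
  have "deriv q s * deriv u s + q s * deriv (deriv u) s = b' s" for s
  proof -
    have "((\<lambda>s. q s * u1 s) has_real_derivative deriv q s * u1 s + deriv u1 s * q s) (at s)"
      using smooth_real_deriv(2)[OF assms(1)] unfolding u1
      by (intro DERIV_mult smooth_real_deriv(1) smooth_q)
    from DERIV_unique[OF this assms(4)] show ?thesis unfolding u1 by (simp add: mult.commute)
  qed
  moreover have "b' s / (w s * v s) + pot k l s * u s = 0" for s
    using assms(5)[of s] w_nz[of s] v_nz[of s] by (simp add: field_simps)
  ultimately show ?thesis using assms by (auto simp: mode_sols_def)
qed

lemma smooth_coeffs: "smooth Pm" "smooth Wm" "smooth (Qm k)"
  unfolding Pm_def[abs_def] Wm_def[abs_def] Qm_def[abs_def]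
  by (intro smooth_intros smooth_rz w_nz; simp add: r_nz)+

lemma coeffs_pos: "Pm s > 0" "Wm s > 0"
  by (auto simp: Pm_def Wm_def w_pos v_pos)

lemma per_coeffs: "Pm (s + 2 * pi) = Pm s" "Wm (s + 2 * pi) = Wm s" "Qm k (s + 2 * pi) = Qm k s"
  unfolding Pm_def Wm_def Qm_def by (simp_all only: per_geo per_rz)

text \<open>
  Replacing \<open>h\<close> by \<open>h / K\<close> changes the coefficients but not the functions \<open>g\<close>.  The constant potential
  \<open>K\<^sup>2\<close> becomes the constant 1, for which the rotation is known exactly.
\<close>

lemma SL_scaled:
  assumes "K > 0"
  shows "sturm_liouville (\<lambda>s. K * Pm s) (\<lambda>s. Qm k s / K) (\<lambda>s. Wm s / K)"
  using assms coeffs_pos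
  by unfold_locales (auto simp: per_coeffs intro!: continuous_intros smooth_continuous[OF smooth_coeffs(1)]
      smooth_continuous[OF smooth_coeffs(2)] smooth_continuous[OF smooth_coeffs(3)])

text \<open>
  With \<open>g = w u\<close> the second component is \<open>h = om * u + u' / v\<close>.  In \<open>h'\<close> the terms with \<open>u'\<close> cancel, and
  the coefficient of \<open>u\<close> is \<open>om' - v * pot k l = - (Qm k + l * Wm) * w\<close> by the formula for \<open>om'\<close>.
\<close>

lemma mode_sols_iff:
  assumes K: "K > 0"
  shows "u \<in> mode_sols k l \<longleftrightarrow> (\<lambda>s. w s * u s) \<in> sturm_liouville.periodic_sols (\<lambda>s. K * Pm s) (\<lambda>s. Qm k s / K) (\<lambda>s. Wm s / K) l"
proof -
  interpret SL: sturm_liouville "\<lambda>s. K * Pm s" "\<lambda>s. Qm k s / K" "\<lambda>s. Wm s / K" by (rule SL_scaled[OF K])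
  define om' where "om' s = v s * ((kap s)\<^sup>2 + (sg s)\<^sup>2 / (r s)\<^sup>2 - 1 / 2 - 1 / (r s)\<^sup>2)" for s
  have om': "(om has_real_derivative om' s) (at s)" for s unfolding om'_def by (rule DERIV_om)
  have coef: "om' s - v s * pot k l s = - (Qm k s + l * Wm s) * w s" for s
    unfolding om'_def pot_def Qm_def Wm_def using r_nz[of s] w_nz[of s]
    by (simp add: field_simps power2_eq_square)
  show ?thesis
  proof
    assume u: "u \<in> mode_sols k l"
    then have sm: "smooth u" "smooth (deriv u)" and per: "\<And>s. u (s + 2 * pi) = u s" 
      and eq: "(deriv q s * deriv u s + q s * deriv (deriv u) s) / (w s * v s) + pot k l s * u s = 0" for s
      by (auto simp: mode_sols_def smooth_real_deriv(2))
    define h where "h s = om s * u s + (q s * deriv u s) / w s" for s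
    have "SL.is_sol l (\<lambda>s. w s * u s) (\<lambda>s. h s / K)"
      unfolding SL.is_sol_def
    proof (intro allI conjI)
      fix s
      have "((\<lambda>s. w s * u s) has_real_derivative w s * v s * om s * u s + deriv u s * w s) (at s)"
        by (intro DERIV_mult DERIV_w' smooth_real_deriv(1) sm)
      also have "w s * v s * om s * u s + deriv u s * w s = K * Pm s * (h s / K)"
        unfolding h_def Pm_def q_def using K w_nz[of s] v_nz[of s] by (simp add: field_simps)
      finally show "((\<lambda>s. w s * u s) has_real_derivative K * Pm s * (h s / K)) (at s)" .
      define b' where "b' = deriv q s * deriv u s + deriv (deriv u) s * q s"
      have b': "b' = - pot k l s * u s * (w s * v s)"
        using eq[of s] w_nz[of s] v_nz[of s] unfolding b'_def by (simp add: field_simps)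
      have "((\<lambda>s. h s / K) has_real_derivative 
        (om' s * u s + deriv u s * om s + (b' * w s - (q s * deriv u s) * (w s * v s * om s)) / (w s * w s)) / K) (at s)"
        unfolding h_def b'_def
        by (intro DERIV_cdivide DERIV_add DERIV_mult DERIV_divide om' DERIV_w' smooth_real_deriv(1) sm smooth_q w_nz)
      also have "(om' s * u s + deriv u s * om s + (b' * w s - (q s * deriv u s) * (w s * v s * om s)) / (w s * w s)) / K
        = (om' s - v s * pot k l s) * u s / K"
        unfolding b' q_def using K w_nz[of s] v_nz[of s] by (simp add: field_simps)
      also have "\<dots> = - (Qm k s / K + l * (Wm s / K)) * (w s * u s)"
        unfolding coef using K by (simp add: field_simps)
      finally show "((\<lambda>s. h s / K) has_real_derivative - (Qm k s / K + l * (Wm s / K)) * (w s * u s)) (at s)" .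
    qed
    then show "(\<lambda>s. w s * u s) \<in> SL.periodic_sols l"
      unfolding SL.periodic_sols_def using per per_geo(4) by auto
  next
    assume "(\<lambda>s. w s * u s) \<in> SL.periodic_sols l"
    then obtain h0 where h0: "SL.is_sol l (\<lambda>s. w s * u s) h0" and per: "\<And>s. w (s + 2 * pi) * u (s + 2 * pi) = w s * u s"
      unfolding SL.periodic_sols_def by blast
    define h where "h s = K * h0 s" for s
    have g': "((\<lambda>s. w s * u s) has_real_derivative Pm s * h s) (at s)" for s
      using h0 unfolding SL.is_sol_def h_def by (simp add: mult_ac)
    have h': "(h has_real_derivative - (Qm k s + l * Wm s) * (w s * u s)) (at s)" for s
    proof -
      have "(h has_real_derivative K * (- (Qm k s / K + l * (Wm s / K)) * (w s * u s))) (at s)"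
        unfolding h_def[abs_def] using h0 unfolding SL.is_sol_def by (intro DERIV_cmult) blast
      also have "K * (- (Qm k s / K + l * (Wm s / K)) * (w s * u s)) = - (Qm k s + l * Wm s) * (w s * u s)"
        using K by (simp add: field_simps)
      finally show ?thesis .
    qed
    have smg: "smooth (\<lambda>s. w s * u s)" 
      by (rule smooth_real_system(1)[OF g' h']) (intro smooth_intros smooth_coeffs)+
    have u_eq: "u = (\<lambda>s. (w s * u s) / w s)" using w_nz by (auto simp: fun_eq_iff)
    have smu: "smooth u" by (subst u_eq) (intro smooth_divide smg smooth_w w_nz)
    have hs: "h s = om s * u s + deriv u s / v s" for s
    proof -
      have "((\<lambda>s. w s * u s) has_real_derivative w s * v s * om s * u s + deriv u s * w s) (at s)"
        by (intro DERIV_mult DERIV_w' smooth_real_deriv(1) smu)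
      from DERIV_unique[OF this g'] have "w s * v s * om s * u s + deriv u s * w s = w s * v s * h s" by (simp add: Pm_def)
      then have "w s * (v s * om s * u s + deriv u s) = w s * (v s * h s)" by (simp add: algebra_simps)
      then have "v s * om s * u s + deriv u s = v s * h s" using w_nz[of s] by simp
      then show ?thesis using v_nz[of s] by (simp add: field_simps)
    qed
    show "u \<in> mode_sols k l"
    proof (rule mode_solsI[OF smu _ refl])
      fix s
      show "u (s + 2 * pi) = u s" using per[of s] w_nz[of s] by (simp add: per_geo)
      have qu: "(\<lambda>s. q s * deriv u s) = (\<lambda>s. w s * (h s - om s * u s))"
        unfolding hs q_def using v_nz by (auto simp: field_simps)
      have "((\<lambda>s. w s * (h s - om s * u s)) has_real_derivative w s * v s * om s * (h s - om s * u s) + 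
         (- (Qm k s + l * Wm s) * (w s * u s) - (om' s * u s + deriv u s * om s)) * w s) (at s)"
        by (intro DERIV_mult DERIV_diff DERIV_w' om' h' smooth_real_deriv(1) smu)
      then show "((\<lambda>s. q s * deriv u s) has_real_derivative w s * v s * om s * (h s - om s * u s) + 
         (- (Qm k s + l * Wm s) * (w s * u s) - (om' s * u s + deriv u s * om s)) * w s) (at s)"
        unfolding qu .
      have A: "w s * v s * om s * (h s - om s * u s) = w s * om s * deriv u s"
        unfolding hs using v_nz[of s] by (simp add: field_simps)
      have B: "- (Qm k s + l * Wm s) * (w s * u s) = (om' s - v s * pot k l s) * u s" unfolding coef by simp
      show "w s * v s * om s * (h s - om s * u s) + 
         (- (Qm k s + l * Wm s) * (w s * u s) - (om' s * u s + deriv u s * om s)) * w s + w s * v s * pot k l s * u s = 0"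
        unfolding A B by (simp add: algebra_simps)
    qed
  qed
qed

text \<open>
  The normal components of the horizontal translations are \<open>- sg\<close> times cosine and sine of the rotation
  angle, that of the vertical translation is \<open>c\<close>, and the mean curvature is \<open>eta / 2\<close>.
\<close>

lemma sg_mode: "sg \<in> mode_sols 1 (- 1 / 2)"
proof (rule mode_solsI[OF smooth_sg per_geo(3) DERIV_imp_deriv[OF DERIV_sg]])
  fix s
  have "(\<lambda>s. q s * (kap s * v s * c s)) = (\<lambda>s. w s * (kap s * c s))" 
    unfolding q_def using v_nz by (auto simp: field_simps)
  moreover have "((\<lambda>s. w s * (kap s * c s)) has_real_derivative w s * v s * om s * (kap s * c s) + 
     (v s * (- kap s * c s / r s + sg s * c s / (r s)\<^sup>2 + kap s * (z s * sg s + r s * c s) / 2) * c s + (- kap s * v s * sg s) * kap s) * w s) (at s)"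
    by (intro DERIV_mult DERIV_w' DERIV_kap DERIV_c)
  ultimately show "((\<lambda>s. q s * (kap s * v s * c s)) has_real_derivative w s * v s * om s * (kap s * c s) + 
     (v s * (- kap s * c s / r s + sg s * c s / (r s)\<^sup>2 + kap s * (z s * sg s + r s * c s) / 2) * c s + (- kap s * v s * sg s) * kap s) * w s) (at s)"
    by simp
  have "w s * v s * om s * (kap s * c s) + 
     (v s * (- kap s * c s / r s + sg s * c s / (r s)\<^sup>2 + kap s * (z s * sg s + r s * c s) / 2) * c s + (- kap s * v s * sg s) * kap s) * w s
     + w s * v s * pot 1 (- 1 / 2) s * sg s = w s * v s * sg s / (r s)\<^sup>2 * ((c s)\<^sup>2 + (sg s)\<^sup>2 - 1)"
    unfolding om_def pot_def using r_nz[of s] by (simp add: field_simps power2_eq_square)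
  then show "w s * v s * om s * (kap s * c s) + 
     (v s * (- kap s * c s / r s + sg s * c s / (r s)\<^sup>2 + kap s * (z s * sg s + r s * c s) / 2) * c s + (- kap s * v s * sg s) * kap s) * w s
     + w s * v s * pot 1 (- 1 / 2) s * sg s = 0" unfolding c_sg by simp
qed

lemma c_mode: "c \<in> mode_sols 0 (- 1 / 2)"
proof (rule mode_solsI[OF smooth_c per_geo(2) DERIV_imp_deriv[OF DERIV_c]])
  fix s
  have "(\<lambda>s. q s * (- kap s * v s * sg s)) = (\<lambda>s. w s * (- (kap s * sg s)))" 
    unfolding q_def using v_nz by (auto simp: field_simps)
  moreover have "((\<lambda>s. w s * (- (kap s * sg s))) has_real_derivative w s * v s * om s * (- (kap s * sg s)) + 
     (- (v s * (- kap s * c s / r s + sg s * c s / (r s)\<^sup>2 + kap s * (z s * sg s + r s * c s) / 2) * sg s + (kap s * v s * c s) * kap s)) * w s) (at s)"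
    by (intro DERIV_mult DERIV_minus DERIV_w' DERIV_kap DERIV_sg)
  ultimately show "((\<lambda>s. q s * (- kap s * v s * sg s)) has_real_derivative w s * v s * om s * (- (kap s * sg s)) + 
     (- (v s * (- kap s * c s / r s + sg s * c s / (r s)\<^sup>2 + kap s * (z s * sg s + r s * c s) / 2) * sg s + (kap s * v s * c s) * kap s)) * w s) (at s)"
    by simp
  show "w s * v s * om s * (- (kap s * sg s)) + 
     (- (v s * (- kap s * c s / r s + sg s * c s / (r s)\<^sup>2 + kap s * (z s * sg s + r s * c s) / 2) * sg s + (kap s * v s * c s) * kap s)) * w s
     + w s * v s * pot 0 (- 1 / 2) s * c s = 0"
    unfolding om_def pot_def using r_nz[of s] by (simp add: field_simps power2_eq_square)
qed

definition eta where "eta s = z s * c s - r s * sg s"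

lemma DERIV_eta: "(eta has_real_derivative - kap s * v s * (z s * sg s + r s * c s)) (at s)"
proof -
  have "(eta has_real_derivative (v s * sg s) * c s + (- kap s * v s * sg s) * z s - ((v s * c s) * sg s + (kap s * v s * c s) * r s)) (at s)"
    unfolding eta_def[abs_def] by (intro DERIV_diff DERIV_mult DERIV_r DERIV_z DERIV_c DERIV_sg)
  then show ?thesis by (simp add: algebra_simps)
qed

lemma smooth_eta: "smooth eta"
  unfolding eta_def[abs_def] by (intro smooth_intros smooth_rz)

lemma per_eta: "eta (s + 2 * pi) = eta s"
  by (simp only: eta_def per_geo per_rz)

lemma eta_mode: "eta \<in> mode_sols 0 (- 1)"
proof (rule mode_solsI[OF smooth_eta per_eta DERIV_imp_deriv[OF DERIV_eta]])
  fix s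
  define K' where "K' = v s * (- kap s * c s / r s + sg s * c s / (r s)\<^sup>2 + kap s * (z s * sg s + r s * c s) / 2)"
  define D where "D = w s * v s * om s * (- (kap s * (z s * sg s + r s * c s))) + 
     (- (K' * (z s * sg s + r s * c s) + 
        ((v s * sg s) * sg s + (kap s * v s * c s) * z s + ((v s * c s) * c s + (- kap s * v s * sg s) * r s)) * kap s)) * w s"
  have "(\<lambda>s. q s * (- kap s * v s * (z s * sg s + r s * c s))) = (\<lambda>s. w s * (- (kap s * (z s * sg s + r s * c s))))" 
    unfolding q_def using v_nz by (auto simp: field_simps)
  moreover have "((\<lambda>s. w s * (- (kap s * (z s * sg s + r s * c s)))) has_real_derivative D) (at s)"
    unfolding D_def K'_def
    by (intro DERIV_mult DERIV_add DERIV_minus DERIV_w' DERIV_kap DERIV_sg DERIV_c DERIV_r DERIV_z)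
  ultimately show "((\<lambda>s. q s * (- kap s * v s * (z s * sg s + r s * c s))) has_real_derivative D) (at s)" by simp
  have e: "eta s = - 2 * kap s - 2 * sg s / r s" using shrinker[of s] by (simp add: eta_def)
  define \<beta> where "\<beta> = z s * sg s + r s * c s"
  have b: "\<beta> * c s = r s + sg s * eta s"
    unfolding \<beta>_def eta_def using c_sg[of s] by algebra
  have "D = w s * v s * (- (\<beta> * c s) * sg s / (r s)\<^sup>2 - kap s * ((c s)\<^sup>2 + (sg s)\<^sup>2) - (kap s)\<^sup>2 * eta s)"
    unfolding D_def K'_def om_def \<beta>_def eta_def using r_nz[of s] by (simp add: field_simps power2_eq_square)
  then have "D + w s * v s * pot 0 (- 1) s * eta s = 
     w s * v s * (- (r s + sg s * eta s) * sg s / (r s)\<^sup>2 - kap s + ((sg s)\<^sup>2 / (r s)\<^sup>2 - 1 / 2) * eta s)"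
    unfolding b c_sg pot_def by (simp add: algebra_simps)
  also have "\<dots> = w s * v s * (- sg s / r s - kap s - eta s / 2)"
    using r_nz[of s] by (simp add: field_simps power2_eq_square)
  also have "\<dots> = 0" unfolding e by simp
  finally show "D + w s * v s * pot 0 (- 1) s * eta s = 0" .
qed

end

lemma shrinker_profile_of_curve:
  assumes "closed_half_plane_curve \<gamma>" "self_shrinker (torus_of_revolution \<gamma>)"
  shows "shrinker_profile (\<lambda>s. fst (\<gamma> s)) (\<lambda>s. snd (\<gamma> s))"
proof -
  interpret profile "\<lambda>s. fst (\<gamma> s)" "\<lambda>s. snd (\<gamma> s)" by (rule profile_of_curve[OF assms(1)])
  show ?thesis
  proof
    fix s
    define p :: "real^2" where "p = vector [s, 0]"
    have p: "p $ 1 = s" "p $ 2 = 0" by (auto simp: p_def vector_2)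
    have "mean_curvature X p = (X p \<bullet> unit_normal X p) / 2"
      using assms(2) by (simp add: self_shrinker_def)
    moreover have "X p = vector [fst (\<gamma> s), 0, snd (\<gamma> s)]" using p by (simp add: torus_of_revolution_def Let_def case_prod_unfold)
    ultimately have "- (kap s + sg s / fst (\<gamma> s)) = (- fst (\<gamma> s) * sg s + snd (\<gamma> s) * c s) / 2"
      unfolding mean_curvature_X normal_X using p by (simp add: inner_vector_3)
    then show "kap s = - sg s / fst (\<gamma> s) - (snd (\<gamma> s) * c s - fst (\<gamma> s) * sg s) / 2" by argo
  qed
qed

section \<open>Fourier coefficients of periodic functions\<close>

definition pint :: "(real \<Rightarrow> real) \<Rightarrow> real" where "pint f = integral {0..2*pi} f"

lemma pint_FTC:
  assumes "\<And>x. (F has_real_derivative f x) (at x)"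
  shows "pint f = F (2 * pi) - F 0"
  unfolding pint_def using assms
  by (intro integral_unique fundamental_theorem_of_calculus)
     (auto simp: has_real_derivative_iff_has_vector_derivative[symmetric] intro: has_field_derivative_at_within)

lemma pint_integrable: "continuous_on UNIV f \<Longrightarrow> f integrable_on {0..2*pi}" for f :: "real \<Rightarrow> real"
  by (intro integrable_continuous_real) (auto intro: continuous_on_subset)

lemma pint_add: "continuous_on UNIV f \<Longrightarrow> continuous_on UNIV g \<Longrightarrow> pint (\<lambda>t. f t + g t) = pint f + pint g"
  unfolding pint_def by (intro integral_add pint_integrable)

lemma pint_diff: "continuous_on UNIV f \<Longrightarrow> continuous_on UNIV g \<Longrightarrow> pint (\<lambda>t. f t - g t) = pint f - pint g"
  unfolding pint_def by (intro integral_diff pint_integrable)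

lemma pint_cmult: "pint (\<lambda>t. a * f t) = a * pint f"
  unfolding pint_def by simp

lemma pint_sum: "finite I \<Longrightarrow> (\<And>i. i \<in> I \<Longrightarrow> continuous_on UNIV (f i)) \<Longrightarrow> pint (\<lambda>t. \<Sum>i\<in>I. f i t) = (\<Sum>i\<in>I. pint (f i))"
  unfolding pint_def by (intro integral_sum pint_integrable) auto

lemma pint_shift:
  assumes "continuous_on UNIV f" "\<And>t. f (t + 2 * pi) = f t"
  shows "pint (\<lambda>t. f (t + a)) = pint f" "pint (\<lambda>t. f (- t)) = pint f"
proof -
  define G where "G = antideriv f"
  have G: "(G has_real_derivative f t) (at t)" for t unfolding G_def by (rule antideriv(2)[OF assms(1)])
  have Gs: "((\<lambda>t. G (t + b)) has_real_derivative f (t + b)) (at t)" for t b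
    using DERIV_shift[of G "f (t + b)" t b] G by blast
  have "((\<lambda>b. G (b + 2 * pi) - G b) has_real_derivative f (b + 2 * pi) - f b) (at b)" for b
    by (intro DERIV_diff Gs G)
  then have D: "G (b + 2 * pi) - G b = G (0 + 2 * pi) - G 0" for b
    unfolding assms(2) by (intro DERIV_isconst_all[of "\<lambda>b. G (b + 2 * pi) - G b"]) auto
  have e: "pint f = G (2 * pi) - G 0" by (rule pint_FTC[OF G])
  have "pint (\<lambda>t. f (t + a)) = G (2 * pi + a) - G (0 + a)" by (rule pint_FTC[OF Gs])
  then show "pint (\<lambda>t. f (t + a)) = pint f" using D[of a] e by (simp add: add.commute)
  have "((\<lambda>t. - G (- t)) has_real_derivative f (- t)) (at t)" for t
    using DERIV_mirror[of G "f (- t)" t] G[of "- t"] by (auto intro!: derivative_eq_intros)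
  then have "pint (\<lambda>t. f (- t)) = - G (- (2 * pi)) - (- G (- 0))" by (rule pint_FTC)
  then show "pint (\<lambda>t. f (- t)) = pint f" using D[of "- 2 * pi"] e by simp
qed

text \<open>
  Products of cosines are sums of cosines; integer frequencies keep \<open>j - 1\<close> meaningful at \<open>j = 0\<close>.
\<close>

lemma pint_cos_powers:
  assumes y: "continuous_on UNIV y" and z: "\<And>k::nat. pint (\<lambda>t. y t * cos (real k * t)) = 0"
  shows "pint (\<lambda>t. y t * cos t ^ m * cos (of_int j * t)) = 0"
proof (induction m arbitrary: j)
  case 0
  have "cos (of_int j * t) = cos (real (nat \<bar>j\<bar>) * t)" for t
    by (cases "j \<ge> 0") (auto simp: abs_if)
  then show ?case using z[of "nat \<bar>j\<bar>"] by simp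
next
  case (Suc m)
  have "y t * cos t ^ Suc m * cos (of_int j * t) = 
    (1 / 2) * (y t * cos t ^ m * cos (of_int (j + 1) * t) + y t * cos t ^ m * cos (of_int (j - 1) * t))" for t
    by (simp add: cos_add cos_diff algebra_simps)
  then have "pint (\<lambda>t. y t * cos t ^ Suc m * cos (of_int j * t)) = (1 / 2) * 
     (pint (\<lambda>t. y t * cos t ^ m * cos (of_int (j + 1) * t)) + pint (\<lambda>t. y t * cos t ^ m * cos (of_int (j - 1) * t)))"
    by (simp only: pint_cmult) (subst pint_add; auto intro!: continuous_intros y)
  then show ?case using Suc[of "j + 1"] Suc[of "j - 1"] by simp
qed

text \<open>
  An even periodic function is a continuous function \<open>H\<close> of \<open>cos t\<close>.  By the Weierstrass theorem \<open>H\<close> is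
  close to a polynomial \<open>p\<close>, and \<open>y\<close> is orthogonal to \<open>p (cos t)\<close>, so \<open>\<integral> y\<^sup>2 = \<integral> y (y - p (cos t))\<close> is
  arbitrarily small.
\<close>

lemma even_periodic_zero:
  assumes y: "continuous_on UNIV y" "\<And>t. y (t + 2 * pi) = y t" "\<And>t. y (- t) = y t"
    and z: "\<And>k::nat. pint (\<lambda>t. y t * cos (real k * t)) = 0"
  shows "y 0 = 0"
proof -
  define H where "H x = y (arccos x)" for x
  have Hc: "continuous_on {-1..1} H" unfolding H_def
    by (intro continuous_on_compose2[OF y(1)] continuous_on_arccos') auto
  have yH: "y t = H (cos t)" if "t \<in> {0..2*pi}" for t
  proof (cases "t \<le> pi")
    case True then show ?thesis using that by (simp add: H_def arccos_cos)
  next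
    case False
    have e: "cos t = cos (2 * pi - t)" by (simp add: cos_diff)
    have "arccos (cos t) = 2 * pi - t" unfolding e by (rule arccos_cos) (use that False in auto)
    then have "H (cos t) = y (2 * pi - t)" by (simp add: H_def)
    also have "\<dots> = y t" using y(2)[of "- t"] y(3)[of t] by (simp add: add.commute)
    finally show ?thesis by simp
  qed
  obtain B where B: "B > 0" "\<And>t. \<bar>y t\<bar> \<le> B" using periodic_bounded[OF y(1,2)] by blast
  have small: "pint (\<lambda>t. y t * y t) \<le> e * (2 * pi * B)" if e: "e > 0" for e
  proof -
    obtain p where p: "real_polynomial_function p" "\<And>x. x \<in> {-1..1} \<Longrightarrow> \<bar>H x - p x\<bar> < e"
      using Stone_Weierstrass_real_polynomial_function[OF compact_Icc Hc e] by blast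
    obtain a n where pn: "p = (\<lambda>x. \<Sum>i\<le>n. a i * x ^ i)" using p(1) by (auto simp: real_polynomial_function_iff_sum)
    have "pint (\<lambda>t. y t * p (cos t)) = pint (\<lambda>t. \<Sum>i\<le>n. a i * (y t * cos t ^ i * cos (of_int 0 * t)))"
      unfolding pn by (simp add: sum_distrib_left mult_ac)
    also have "\<dots> = (\<Sum>i\<le>n. pint (\<lambda>t. a i * (y t * cos t ^ i * cos (of_int 0 * t))))"
      by (intro pint_sum) (auto intro!: continuous_intros y)
    also have "\<dots> = 0" unfolding pint_cmult using pint_cos_powers[OF y(1) z, of _ 0] by simp
    finally have pz: "pint (\<lambda>t. y t * p (cos t)) = 0" .
    have pc: "continuous_on UNIV (\<lambda>t. y t * p (cos t))" unfolding pn by (intro continuous_intros y)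
    have "pint (\<lambda>t. y t * y t) = pint (\<lambda>t. y t * y t - y t * p (cos t))"
      by (subst pint_diff) (auto intro!: continuous_intros y pc simp: pz)
    also have "\<dots> \<le> integral {0..2*pi} (\<lambda>t. e * B)"
      unfolding pint_def
    proof (rule integral_le)
      show "(\<lambda>t. y t * y t - y t * p (cos t)) integrable_on {0..2*pi}"
        by (intro pint_integrable continuous_on_diff continuous_on_mult y pc)
      fix t assume t: "t \<in> {0..2*pi}"
      have "y t * y t - y t * p (cos t) \<le> \<bar>y t\<bar> * \<bar>y t - p (cos t)\<bar>"
        unfolding abs_mult[symmetric] by (simp add: algebra_simps)
      also have "\<bar>y t - p (cos t)\<bar> \<le> e" using p(2)[of "cos t"] yH[OF t] by auto
      then have "\<bar>y t\<bar> * \<bar>y t - p (cos t)\<bar> \<le> B * e" using B(1) by (intro mult_mono B(2)) auto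
      finally show "y t * y t - y t * p (cos t) \<le> e * B" by (simp add: mult.commute)
    qed auto
    also have "\<dots> = e * (2 * pi * B)" by simp
    finally show ?thesis .
  qed
  have "pint (\<lambda>t. y t * y t) \<le> 0"
  proof (rule field_le_epsilon)
    fix e :: real assume e: "e > 0"
    have "pint (\<lambda>t. y t * y t) \<le> (e / (2 * pi * B)) * (2 * pi * B)" using e B by (intro small) auto
    then show "pint (\<lambda>t. y t * y t) \<le> 0 + e" using B by simp
  qed
  moreover have "pint (\<lambda>t. y t * y t) \<ge> 0" unfolding pint_def 
    by (intro integral_nonneg pint_integrable continuous_intros y) auto
  ultimately have "integral {0..2*pi} (\<lambda>t. y t * y t) = 0" by (simp add: pint_def)
  moreover have "integral {0..2*pi} (\<lambda>t. y t * y t) = 0 \<longleftrightarrow> (\<forall>t\<in>{0..2*pi}. y t * y t = 0)"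
    by (intro integral_eq_0_iff continuous_intros continuous_on_subset[OF y(1)]) auto
  ultimately have "y 0 * y 0 = 0" by (metis atLeastAtMost_iff order_refl pi_ge_zero mult_nonneg_nonneg zero_le_numeral)
  then show ?thesis by simp
qed

text \<open>
  Apply the even case to \<open>y (a + t) + y (a - t)\<close>, whose value at 0 is \<open>2 * y a\<close>.
\<close>

lemma fourier_complete:
  assumes y: "continuous_on UNIV y" "\<And>t. y (t + 2 * pi) = y t"
    and zc: "\<And>k::nat. pint (\<lambda>t. y t * cos (real k * t)) = 0" and zs: "\<And>k::nat. pint (\<lambda>t. y t * sin (real k * t)) = 0"
  shows "y a = 0"
proof -
  have perc: "cos (real k * (t + 2 * pi)) = cos (real k * t)" "sin (real k * (t + 2 * pi)) = sin (real k * t)" for k t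
    using periodic_int[of cos "real k * t" "int k", OF cos_periodic] periodic_int[of sin "real k * t" "int k", OF sin_periodic]
    by (simp_all add: algebra_simps)
  have yc: "continuous_on UNIV (\<lambda>t. y (t + b))" "continuous_on UNIV (\<lambda>t. y (b - t))" for b
    by (intro continuous_on_compose2[OF y(1)] continuous_intros; auto)+
  have sh: "pint (\<lambda>t. y (t + a) * cos (real k * t)) = 0" for k
  proof -
    define F where "F t = y t * cos (real k * (t - a))" for t
    have F: "F t = cos (real k * a) * (y t * cos (real k * t)) + sin (real k * a) * (y t * sin (real k * t))" for t
      by (simp add: F_def right_diff_distrib cos_diff algebra_simps)
    have "pint F = 0"
      unfolding F[abs_def] by (subst pint_add) (auto intro!: continuous_intros y simp: pint_cmult zc zs)
    moreover have "pint (\<lambda>t. F (t + a)) = pint F"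
    proof (rule pint_shift)
      show "continuous_on UNIV F" unfolding F_def by (intro continuous_intros y)
      show "F (t + 2 * pi) = F t" for t by (simp only: F y perc)
    qed
    ultimately show ?thesis by (simp add: F_def)
  qed
  define ya where "ya t = y (t + a) + y (a - t)" for t
  have "ya 0 = 0"
  proof (rule even_periodic_zero)
    show "continuous_on UNIV ya" unfolding ya_def by (intro continuous_intros yc)
    show "ya (- t) = ya t" for t by (simp add: ya_def add.commute)
    show "ya (t + 2 * pi) = ya t" for t
      using y(2)[of "t + a"] y(2)[of "a - (t + 2 * pi)"] by (simp add: ya_def algebra_simps)
    fix k :: nat
    define F where "F t = y (t + a) * cos (real k * t)" for t
    have "pint (\<lambda>t. F (- t)) = pint F"
    proof (rule pint_shift)
      show "continuous_on UNIV F" unfolding F_def by (intro continuous_intros yc)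
      show "F (t + 2 * pi) = F t" for t unfolding F_def perc using y(2)[of "t + a"] by (simp add: algebra_simps)
    qed
    then have "pint (\<lambda>t. y (a - t) * cos (real k * t)) = 0" using sh[of k] by (simp add: F_def[abs_def])
    then show "pint (\<lambda>t. ya t * cos (real k * t)) = 0"
      unfolding ya_def distrib_right using sh[of k]
      by (subst pint_add) (auto intro!: continuous_intros yc)
  qed
  then show ?thesis by (simp add: ya_def)
qed

text \<open>
  The index \<open>(k, True)\<close> stands for the cosine and \<open>(k, False)\<close> for the sine of \<open>k t\<close>.  The function with
  index \<open>(0, False)\<close> is 0 and is excluded wherever a basis is formed.
\<close>

definition trig :: "nat \<times> bool \<Rightarrow> real \<Rightarrow> real" where
  "trig j t = (if snd j then cos (real (fst j) * t) else sin (real (fst j) * t))"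

definition trig' :: "nat \<times> bool \<Rightarrow> real \<Rightarrow> real" where
  "trig' j t = (if snd j then - real (fst j) * sin (real (fst j) * t) else real (fst j) * cos (real (fst j) * t))"

lemma DERIV_trig: "(trig j has_real_derivative trig' j t) (at t)" 
  "(trig' j has_real_derivative - (real (fst j))\<^sup>2 * trig j t) (at t)"
  unfolding trig_def[abs_def] trig'_def[abs_def]
  by (cases "snd j"; auto intro!: derivative_eq_intros simp: power2_eq_square)+

lemma trig_cont: "continuous_on S (trig j)" "continuous_on S (trig' j)"
  by (intro continuous_at_imp_continuous_on ballI DERIV_isCont[OF DERIV_trig(1)] DERIV_isCont[OF DERIV_trig(2)])+

lemma smooth_trig: "smooth (trig j)"
proof -
  have "smooth (\<lambda>t::real. t)" by (simp add: smooth_def C_k_linear bounded_linear_ident)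
  then have "smooth (\<lambda>t. real (fst j) * t)" by (intro smooth_mult smooth_const)
  then show ?thesis unfolding trig_def[abs_def] by (cases "snd j") (auto intro: smooth_sin smooth_cos)
qed

lemma trig_per: "trig j (t + 2 * pi) = trig j t" "trig' j (t + 2 * pi) = trig' j t"
  using periodic_int[of cos "real (fst j) * t" "int (fst j)", OF cos_periodic] periodic_int[of sin "real (fst j) * t" "int (fst j)", OF sin_periodic]
  by (simp_all add: trig_def trig'_def distrib_left mult_ac)

text \<open>
  Functions of different frequency are eigenfunctions of the second derivative for different
  eigenvalues; sine and cosine of the same frequency are integrated directly.
\<close>

lemma trig_orthogonal:
  assumes "i \<noteq> j"
  shows "pint (\<lambda>t. trig i t * trig j t) = 0"
proof (cases "fst i = fst j")
  case True
  then have ne: "snd i \<noteq> snd j" using assms by (auto simp: prod_eq_iff)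
  define k where "k = real (fst i)"
  have e: "trig i t * trig j t = sin (k * t) * cos (k * t)" for t
    using True ne by (cases "snd i") (auto simp: trig_def k_def)
  show ?thesis
  proof (cases "k = 0")
    case True then show ?thesis unfolding e by (simp add: pint_def)
  next
    case False
    have "pint (\<lambda>t. sin (k * t) * cos (k * t)) = (sin (k * (2 * pi)))\<^sup>2 / (2 * k) - (sin (k * 0))\<^sup>2 / (2 * k)"
      by (rule pint_FTC) (use False in \<open>auto intro!: derivative_eq_intros simp: field_simps\<close>)
    moreover have "sin (k * (2 * pi)) = 0" using periodic_int[of sin 0 "int (fst i)", OF sin_periodic] by (simp add: k_def mult_ac)
    ultimately show ?thesis unfolding e by simp
  qed
next
  case False
  define a where "a = (real (fst j))\<^sup>2 - (real (fst i))\<^sup>2"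
  have a: "a \<noteq> 0" using False by (simp add: a_def)
  have "((\<lambda>t. trig' i t * trig j t - trig i t * trig' j t) has_real_derivative a * (trig i t * trig j t)) (at t)" for t
    by (auto intro!: derivative_eq_intros DERIV_trig simp: a_def algebra_simps)
  from pint_FTC[OF this] have "a * pint (\<lambda>t. trig i t * trig j t) = 0"
    using trig_per[of _ 0] by (simp add: pint_cmult)
  then show ?thesis using a by simp
qed

lemma trig_norm_pos:
  assumes "snd j \<or> fst j \<noteq> 0"
  shows "pint (\<lambda>t. trig j t * trig j t) > 0"
proof -
  have nn: "pint (\<lambda>t. trig j t * trig j t) \<ge> 0" unfolding pint_def 
    by (intro integral_nonneg pint_integrable continuous_intros trig_cont) auto
  have "pint (\<lambda>t. trig j t * trig j t) \<noteq> 0"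
  proof
    assume "pint (\<lambda>t. trig j t * trig j t) = 0"
    moreover have "integral {0..2*pi} (\<lambda>t. trig j t * trig j t) = 0 \<longleftrightarrow> (\<forall>t\<in>{0..2*pi}. trig j t * trig j t = 0)"
      by (intro integral_eq_0_iff continuous_intros trig_cont) auto
    ultimately have z: "trig j t = 0" if "t \<in> {0..2*pi}" for t using that by (auto simp: pint_def)
    show False
    proof (cases "snd j")
      case True then show ?thesis using z[of 0] by (simp add: trig_def)
    next
      case False
      then have k: "real (fst j) \<ge> 1" using assms by simp
      have "pi / (2 * real (fst j)) \<le> pi / 1" using k by (intro divide_left_mono) auto
      also have "\<dots> \<le> 2 * pi" by simp
      finally have "pi / (2 * real (fst j)) \<in> {0..2*pi}" by simp
      from z[OF this] show ?thesis using False k by (simp add: trig_def)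
    qed
  qed
  then show ?thesis using nn by simp
qed

text \<open>
  Unnormalised Fourier coefficients with respect to the rotation angle, as functions on the profile.
\<close>

definition coef :: "(real^2 \<Rightarrow> real) \<Rightarrow> nat \<times> bool \<Rightarrow> real \<Rightarrow> real" where
  "coef f j s = pint (\<lambda>t. f (vector [s, t]) * trig j t)"

lemma vector_2_eq: "vector [s, t] = s *\<^sub>R axis 1 1 + t *\<^sub>R (axis 2 1 :: real^2)"
  by (simp add: vec_eq_iff forall_2 vector_2 axis_def)

lemma continuous_vector2: "continuous_on S (\<lambda>x. vector [fst x, snd x] :: real^2)"
  unfolding vector_2_eq by (intro continuous_intros)

lemma continuous_slice:
  assumes "continuous_on UNIV (f :: real^2 \<Rightarrow> real)"
  shows "continuous_on S (\<lambda>t. f (vector [s, t]))" "continuous_on S (\<lambda>s. f (vector [s, t]))"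
proof -
  have "continuous_on S (\<lambda>t. vector [s, t] :: real^2)" "continuous_on S (\<lambda>s. vector [s, t] :: real^2)"
    unfolding vector_2_eq by (intro continuous_intros)+
  then show "continuous_on S (\<lambda>t. f (vector [s, t]))" "continuous_on S (\<lambda>s. f (vector [s, t]))"
    using continuous_on_compose2[OF assms] by blast+
qed

lemma DERIV_coef:
  assumes "smooth f"
  shows "(coef f j has_real_derivative coef (partial 1 f) j s) (at s)"
proof -
  have "((\<lambda>x. integral (cbox 0 (2*pi)) (\<lambda>t. f (vector [x, t]) * trig j t)) has_real_derivative 
    integral (cbox 0 (2*pi)) (\<lambda>t. partial 1 f (vector [s, t]) * trig j t)) (at s within UNIV)"
  proof (rule leibniz_rule_field_derivative)
    fix x t
    show "((\<lambda>x. f (vector [x, t]) * trig j t) has_real_derivative partial 1 f (vector [x, t]) * trig j t) (at x within UNIV)"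
      by (intro DERIV_cmult_right DERIV_along_1 assms)
  next
    fix x show "(\<lambda>t. f (vector [x, t]) * trig j t) integrable_on cbox 0 (2*pi)"
      unfolding box_real(2) by (intro pint_integrable continuous_intros continuous_slice smooth_continuous[OF assms] trig_cont)
  next
    show "continuous_on (UNIV \<times> cbox 0 (2 * pi)) (\<lambda>(x, t). partial 1 f (vector [x, t]) * trig j t)"
      unfolding case_prod_unfold
      by (intro continuous_on_mult continuous_on_compose2[OF smooth_continuous[OF smooth_partial[OF assms], of UNIV] continuous_vector2]
            continuous_on_compose2[OF trig_cont(1)] continuous_on_snd continuous_on_id) auto
  qed auto
  then show ?thesis unfolding coef_def[abs_def] pint_def box_real(2) by simp
qed

lemma smooth_coef:
  assumes "smooth f"
  shows "smooth (coef f j)"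
proof -
  have "\<forall>f. smooth f \<longrightarrow> C_k k (coef f j)" for k
  proof (induction k)
    case 0
    show ?case by (auto intro!: continuous_at_imp_continuous_on DERIV_isCont[OF DERIV_coef])
  next
    case (Suc k)
    show ?case
    proof (intro allI impI)
      fix f :: "real^2 \<Rightarrow> real" assume f: "smooth f"
      show "C_k (Suc k) (coef f j)"
        by (rule C_k_realI[OF DERIV_coef[OF f]]) (use Suc smooth_partial[OF f] in blast)
    qed
  qed
  then show ?thesis using assms by (simp add: smooth_def)
qed

lemma doubly_periodic_iff: "doubly_periodic f \<longleftrightarrow> (\<forall>s t. f (vector [s + 2 * pi, t]) = f (vector [s, t]) \<and> f (vector [s, t + 2 * pi]) = f (vector [s, t]))"
proof -
  have e: "vector [s, t] + axis 1 (2 * pi) = (vector [s + 2 * pi, t] :: real^2)" "vector [s, t] + axis 2 (2 * pi) = (vector [s, t + 2 * pi] :: real^2)" for s t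
    by (simp_all add: vec_eq_iff forall_2 vector_2 axis_def)
  have v: "p = vector [p $ 1, p $ 2]" for p :: "real^2" by (simp add: vec_eq_iff forall_2 vector_2)
  show ?thesis unfolding doubly_periodic_def forall_2 using e v by metis
qed

lemma partial_periodic:
  assumes "smooth f" "doubly_periodic f"
  shows "doubly_periodic (partial i f)"
  unfolding doubly_periodic_def
proof (intro allI)
  fix p :: "real^2" and j
  have "((\<lambda>p. p + axis j (2 * pi)) has_derivative (\<lambda>x. x)) (at p)"
    by (auto intro!: derivative_eq_intros)
  from has_derivative_compose[OF this smooth_has_derivative[OF assms(1)]]
  have "((\<lambda>p. f (p + axis j (2 * pi))) has_derivative frechet_derivative f (at (p + axis j (2 * pi)))) (at p)" .
  then have "(f has_derivative frechet_derivative f (at (p + axis j (2 * pi)))) (at p)"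
    using assms(2) by (simp add: doubly_periodic_def)
  from partialI[OF this] show "partial i f (p + axis j (2 * pi)) = partial i f p" by (simp add: partial_def)
qed

lemma coef_partial_2:
  assumes "smooth f" "doubly_periodic f"
  shows "coef (partial 2 (partial 2 f)) j s = - (real (fst j))\<^sup>2 * coef f j s"
proof -
  have D: "((\<lambda>t. partial 2 f (vector [s, t]) * trig j t - f (vector [s, t]) * trig' j t) has_real_derivative
     partial 2 (partial 2 f) (vector [s, t]) * trig j t - f (vector [s, t]) * (- (real (fst j))\<^sup>2 * trig j t)) (at t)" for t
    by (rule derivative_eq_intros DERIV_along_2 smooth_partial assms DERIV_trig refl)+ (simp add: algebra_simps)
  have "f (vector [s, 0 + 2 * pi]) = f (vector [s, 0])" "partial 2 f (vector [s, 0 + 2 * pi]) = partial 2 f (vector [s, 0])"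
    using assms(2) partial_periodic[OF assms, of 2] unfolding doubly_periodic_iff by blast+
  then have "pint (\<lambda>t. partial 2 (partial 2 f) (vector [s, t]) * trig j t - f (vector [s, t]) * (- (real (fst j))\<^sup>2 * trig j t)) = 0"
    using pint_FTC[OF D] trig_per[of j 0] by simp
  moreover have "(\<lambda>t. partial 2 (partial 2 f) (vector [s, t]) * trig j t - f (vector [s, t]) * (- (real (fst j))\<^sup>2 * trig j t))
    = (\<lambda>t. partial 2 (partial 2 f) (vector [s, t]) * trig j t - (- (real (fst j))\<^sup>2) * (f (vector [s, t]) * trig j t))"
    by (simp add: mult_ac)
  moreover have "pint (\<lambda>t. partial 2 (partial 2 f) (vector [s, t]) * trig j t - (- (real (fst j))\<^sup>2) * (f (vector [s, t]) * trig j t))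
    = coef (partial 2 (partial 2 f)) j s - pint (\<lambda>t. (- (real (fst j))\<^sup>2) * (f (vector [s, t]) * trig j t))"
    unfolding coef_def
    by (rule pint_diff; intro continuous_on_mult continuous_on_const continuous_slice smooth_continuous smooth_partial assms trig_cont)
  ultimately show ?thesis unfolding pint_cmult coef_def[symmetric] by simp
qed

text \<open>
  Fourier completeness on each circle of rotation.
\<close>

lemma fourier_complete_slice:
  assumes "continuous_on UNIV f" "doubly_periodic f" "\<And>j s. snd j \<or> fst j \<noteq> 0 \<Longrightarrow> coef f j s = 0"
  shows "f = (\<lambda>_. 0)"
proof
  fix p :: "real^2"
  have v: "p = vector [p $ 1, p $ 2]" by (simp add: vec_eq_iff forall_2 vector_2)
  have "f (vector [p $ 1, p $ 2]) = 0"
  proof (rule fourier_complete[where y = "\<lambda>t. f (vector [p $ 1, t])"])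
    show "continuous_on UNIV (\<lambda>t. f (vector [p $ 1, t]))" by (rule continuous_slice[OF assms(1)])
    show "f (vector [p $ 1, t + 2 * pi]) = f (vector [p $ 1, t])" for t using assms(2) by (simp add: doubly_periodic_iff)
    fix k :: nat
    show "pint (\<lambda>t. f (vector [p $ 1, t]) * cos (real k * t)) = 0"
      using assms(3)[of "(k, True)" "p $ 1"] by (simp add: coef_def trig_def)
    show "pint (\<lambda>t. f (vector [p $ 1, t]) * sin (real k * t)) = 0"
      using assms(3)[of "(k, False)" "p $ 1"] by (cases "k = 0") (simp_all add: coef_def trig_def pint_def)
  qed
  then show "f p = 0" using v by simp
qed

section \<open>Separation of variables in the eigenspaces\<close>

lemma has_dim_rescale:
  assumes V: "has_dim V n" and \<phi>: "\<And>s. \<phi> s \<noteq> 0"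
  shows "has_dim {u. (\<lambda>s. \<phi> s * u s) \<in> V} n"
proof -
  obtain B where B: "finite B" "fs.independent B" "fs.span B = V" "card B = n"
    using V unfolding has_dim_def by blast
  have eq: "(\<lambda>s. \<phi> s * (\<Sum>b\<in>B. c b * (b s / \<phi> s))) = (\<lambda>s. \<Sum>b\<in>B. c b * b s)" for c
    using \<phi> by (simp add: sum_distrib_left)
  have "has_dim {u. (\<lambda>s. \<phi> s * u s) \<in> V} (card B)"
  proof (rule has_dim_family[where f = "\<lambda>b s. b s / \<phi> s", OF B(1)])
    fix c assume c: "(\<lambda>x. \<Sum>b\<in>B. c b * (b x / \<phi> x)) = (\<lambda>_. 0)"
    have "(\<lambda>s. \<Sum>b\<in>B. c b * b s) = (\<lambda>_. 0)"
      unfolding eq[symmetric] using fun_cong[OF c] by simp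
    then show "\<forall>b\<in>B. c b = 0" by (rule B(2)[unfolded fs_independent_iff[OF B(1)], THEN spec, THEN mp])
  next
    show "{u. (\<lambda>s. \<phi> s * u s) \<in> V} = {\<lambda>x. \<Sum>b\<in>B. c b * (b x / \<phi> x) |c. True}"
    proof (intro subset_antisym subsetI)
      fix u assume "u \<in> {u. (\<lambda>s. \<phi> s * u s) \<in> V}"
      then obtain c where c: "(\<lambda>s. \<phi> s * u s) = (\<lambda>s. \<Sum>b\<in>B. c b * b s)"
        unfolding B(3)[symmetric] fs_span_finite[OF B(1)] by blast
      have "u = (\<lambda>x. \<Sum>b\<in>B. c b * (b x / \<phi> x))"
      proof
        fix x
        have "\<phi> x * u x = \<phi> x * (\<Sum>b\<in>B. c b * (b x / \<phi> x))"
          using fun_cong[OF c, of x] fun_cong[OF eq[of c], of x] by simp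
        then show "u x = (\<Sum>b\<in>B. c b * (b x / \<phi> x))" using \<phi>[of x] by (simp only: mult_cancel_left) simp
      qed
      then show "u \<in> {\<lambda>x. \<Sum>b\<in>B. c b * (b x / \<phi> x) |c. True}" by blast
    next
      fix u assume "u \<in> {\<lambda>x. \<Sum>b\<in>B. c b * (b x / \<phi> x) |c. True}"
      then obtain c where c: "u = (\<lambda>x. \<Sum>b\<in>B. c b * (b x / \<phi> x))" by blast
      show "u \<in> {u. (\<lambda>s. \<phi> s * u s) \<in> V}"
        unfolding c mem_Collect_eq eq B(3)[symmetric] fs_span_finite[OF B(1)] by blast
    qed
  qed
  then show ?thesis using B by simp
qed

text \<open>
  Bases of the spaces of radial factors combine to a basis of the space of sums of products.
\<close>

lemma has_dim_separated:
  fixes \<tau> :: "'j \<Rightarrow> real \<Rightarrow> real" and V :: "'j \<Rightarrow> (real \<Rightarrow> real) set"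
  assumes J: "finite J" and V: "\<And>j. j \<in> J \<Longrightarrow> has_dim (V j) (n j)"
    and ind: "\<And>u. (\<lambda>p :: real^2. \<Sum>j\<in>J. u j (p $ 1) * \<tau> j (p $ 2)) = (\<lambda>_. 0) \<Longrightarrow> \<forall>j\<in>J. u j = (\<lambda>_. 0)"
    and E: "E = {\<lambda>p :: real^2. \<Sum>j\<in>J. u j (p $ 1) * \<tau> j (p $ 2) |u. \<forall>j\<in>J. u j \<in> V j}"
  shows "has_dim E (\<Sum>j\<in>J. n j)"
proof -
  have "\<forall>j\<in>J. \<exists>B. finite B \<and> fs.independent B \<and> fs.span B = V j \<and> card B = n j"
    using V unfolding has_dim_def by blast
  then obtain B where B: "\<And>j. j \<in> J \<Longrightarrow> finite (B j)" "\<And>j. j \<in> J \<Longrightarrow> fs.independent (B j)"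
    "\<And>j. j \<in> J \<Longrightarrow> fs.span (B j) = V j" "\<And>j. j \<in> J \<Longrightarrow> card (B j) = n j" by metis
  have Vspan: "V j = {\<lambda>s. \<Sum>b\<in>B j. c b * b s |c. True}" if "j \<in> J" for j
    using B(3)[OF that] fs_span_finite[OF B(1)[OF that]] by simp
  define I where "I = (SIGMA j:J. B j)"
  define f where "f i p = snd i (p $ 1) * \<tau> (fst i) (p $ 2)" for i :: "'j \<times> (real \<Rightarrow> real)" and p :: "real^2"
  have sum: "(\<Sum>i\<in>I. c i * f i p) = (\<Sum>j\<in>J. (\<Sum>b\<in>B j. c (j, b) * b (p $ 1)) * \<tau> j (p $ 2))" for c p
  proof -
    have "(\<Sum>i\<in>I. c i * f i p) = (\<Sum>(j, b)\<in>Sigma J B. c (j, b) * (b (p $ 1) * \<tau> j (p $ 2)))"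
      unfolding I_def f_def by (intro sum.cong) auto
    also have "\<dots> = (\<Sum>j\<in>J. \<Sum>b\<in>B j. c (j, b) * (b (p $ 1) * \<tau> j (p $ 2)))"
      by (rule sum.Sigma[symmetric]) (use J B(1) in auto)
    finally show ?thesis by (simp add: sum_distrib_right mult.assoc)
  qed
  have "has_dim E (card I)"
  proof (rule has_dim_family)
    show "finite I" unfolding I_def using J B(1) by auto
    fix c assume "(\<lambda>p. \<Sum>i\<in>I. c i * f i p) = (\<lambda>_. 0)"
    then have "(\<lambda>p :: real^2. \<Sum>j\<in>J. (\<Sum>b\<in>B j. c (j, b) * b (p $ 1)) * \<tau> j (p $ 2)) = (\<lambda>_. 0)" by (simp add: sum)
    from ind[OF this] have z: "\<forall>j\<in>J. (\<lambda>s. \<Sum>b\<in>B j. c (j, b) * b s) = (\<lambda>_. 0)" .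
    have "\<forall>b\<in>B j. c (j, b) = 0" if j: "j \<in> J" for j
    proof -
      have "(\<lambda>s. \<Sum>b\<in>B j. c (j, b) * b s) = (\<lambda>_. 0)" using z j by blast
      then show ?thesis by (rule B(2)[OF j, unfolded fs_independent_iff[OF B(1)[OF j]], THEN spec[of _ "\<lambda>b. c (j, b)"], THEN mp])
    qed
    then show "\<forall>i\<in>I. c i = 0" by (auto simp: I_def)
  next
    show "E = {\<lambda>p. \<Sum>i\<in>I. c i * f i p |c. True}"
    proof (intro subset_antisym subsetI)
      fix g assume "g \<in> E"
      then obtain u where u: "g = (\<lambda>p. \<Sum>j\<in>J. u j (p $ 1) * \<tau> j (p $ 2))" "\<forall>j\<in>J. u j \<in> V j" unfolding E by blast
      then have "\<forall>j\<in>J. \<exists>c. u j = (\<lambda>s. \<Sum>b\<in>B j. c b * b s)"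
        using Vspan by blast
      then obtain c where c: "\<And>j. j \<in> J \<Longrightarrow> u j = (\<lambda>s. \<Sum>b\<in>B j. c j b * b s)" by metis
      have "g = (\<lambda>p. \<Sum>i\<in>I. (\<lambda>(j, b). c j b) i * f i p)"
        unfolding sum u(1) by (intro ext sum.cong) (auto simp: c)
      then show "g \<in> {\<lambda>p. \<Sum>i\<in>I. c i * f i p |c. True}" by blast
    next
      fix g assume "g \<in> {\<lambda>p. \<Sum>i\<in>I. c i * f i p |c. True}"
      then obtain c where g: "g = (\<lambda>p. \<Sum>j\<in>J. (\<Sum>b\<in>B j. c (j, b) * b (p $ 1)) * \<tau> j (p $ 2))" unfolding sum by blast
      have "\<forall>j\<in>J. (\<lambda>s. \<Sum>b\<in>B j. c (j, b) * b s) \<in> V j"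
      proof
        fix j assume j: "j \<in> J"
        show "(\<lambda>s. \<Sum>b\<in>B j. c (j, b) * b s) \<in> V j"
          unfolding Vspan[OF j] by (intro CollectI exI[of _ "\<lambda>b. c (j, b)"]) simp
      qed
      then show "g \<in> E" unfolding E g
        by (intro CollectI exI[of _ "\<lambda>j s. \<Sum>b\<in>B j. c (j, b) * b s"]) simp
    qed
  qed
  moreover have "card I = (\<Sum>j\<in>J. n j)" unfolding I_def using J B by (subst card_SigmaI) auto
  ultimately show ?thesis by simp
qed

lemma has_dim_0D:
  assumes "has_dim V 0"
  shows "V = {\<lambda>_. 0}"
proof -
  obtain B where B: "finite B" "fs.span B = V" "card B = 0" using assms unfolding has_dim_def by blast
  then have "B = {}" by simp
  then have "V = {0}" using B(2) fs.span_empty by blast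
  then show ?thesis by (simp only: zero_fun_def)
qed

definition valid_modes :: "nat \<Rightarrow> (nat \<times> bool) set" where
  "valid_modes K = {j. fst j < K \<and> (snd j \<or> fst j \<noteq> 0)}"

lemma finite_valid_modes: "finite (valid_modes K)"
  by (rule finite_subset[of _ "{..<K} \<times> UNIV"]) (auto simp: valid_modes_def)

lemma sum_valid_modes: "(\<Sum>j\<in>valid_modes K. n (fst j)) = (\<Sum>k<K. (if k = 0 then 1 else 2) * n k)" for n :: "nat \<Rightarrow> nat"
proof -
  have "valid_modes K = ({..<K} \<times> {True}) \<union> ({0<..<K} \<times> {False})" by (auto simp: valid_modes_def)
  then have "(\<Sum>j\<in>valid_modes K. n (fst j)) = (\<Sum>j\<in>{..<K} \<times> {True}. n (fst j)) + (\<Sum>j\<in>{0<..<K} \<times> {False}. n (fst j))"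
    by (simp only:) (rule sum.union_disjoint; auto)
  also have "(\<Sum>j\<in>{..<K} \<times> {True}. n (fst j)) = (\<Sum>k<K. n k)"
    by (subst sum.cartesian_product') simp
  also have "(\<Sum>j\<in>{0<..<K} \<times> {False}. n (fst j)) = (\<Sum>k\<in>{0<..<K}. n k)"
    by (subst sum.cartesian_product') simp
  also have "(\<Sum>k\<in>{0<..<K}. n k) = (\<Sum>k<K. if k = 0 then 0 else n k)"
    by (rule sum.mono_neutral_cong_left) auto
  also have "(\<Sum>k<K. n k) + \<dots> = (\<Sum>k<K. (if k = 0 then 1 else 2) * n k)"
    unfolding sum.distrib[symmetric] by (intro sum.cong) auto
  finally show ?thesis .
qed

lemma coef_separated:
  assumes J: "finite J"
  shows "coef (\<lambda>p. \<Sum>j\<in>J. u j (p $ 1) * trig j (p $ 2)) i s = (if i \<in> J then u i s * pint (\<lambda>t. trig i t * trig i t) else 0)"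
proof -
  have "coef (\<lambda>p. \<Sum>j\<in>J. u j (p $ 1) * trig j (p $ 2)) i s = pint (\<lambda>t. \<Sum>j\<in>J. u j s * (trig j t * trig i t))"
    unfolding coef_def vector_2 sum_distrib_right mult.assoc ..
  also have "\<dots> = (\<Sum>j\<in>J. u j s * pint (\<lambda>t. trig j t * trig i t))"
    by (subst pint_sum[OF J]) (auto intro!: continuous_intros trig_cont simp: pint_cmult)
  also have "\<dots> = (\<Sum>j\<in>J. if j = i then u i s * pint (\<lambda>t. trig i t * trig i t) else 0)"
    by (intro sum.cong) (auto simp: trig_orthogonal)
  finally show ?thesis using J by simp
qed

lemma smooth_sum: "finite J \<Longrightarrow> (\<And>j. j \<in> J \<Longrightarrow> smooth (f j)) \<Longrightarrow> smooth (\<lambda>p. \<Sum>j\<in>J. f j p :: real)"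
  by (induction J rule: finite_induct) (auto intro: smooth_intros)

lemma pint_lin4:
  assumes "continuous_on UNIV f1" "continuous_on UNIV f2" "continuous_on UNIV f3" "continuous_on UNIV f4"
  shows "pint (\<lambda>t. a1 * f1 t + a2 * f2 t + a3 * f3 t + a4 * f4 t) = a1 * pint f1 + a2 * pint f2 + a3 * pint f3 + a4 * pint f4"
  using assms by (simp add: pint_add pint_cmult continuous_on_add continuous_on_mult)

lemma partial_lin:
  fixes f g :: "real^'n \<Rightarrow> real"
  assumes "smooth f" "smooth g"
  shows "partial i (\<lambda>p. a * f p + b * g p) = (\<lambda>p. a * partial i f p + b * partial i g p)"
proof
  fix p
  have "((\<lambda>p. a * f p + b * g p) has_derivative (\<lambda>h. a * frechet_derivative f (at p) h + b * frechet_derivative g (at p) h)) (at p)"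
    by (intro has_derivative_add has_derivative_mult_right smooth_has_derivative assms)
  from partialI[OF this] show "partial i (\<lambda>p. a * f p + b * g p) p = a * partial i f p + b * partial i g p"
    by (simp add: partial_def)
qed

context shrinker_profile
begin

lemma eigen_iff:
  "f \<in> eigenspace X l \<longleftrightarrow> smooth f \<and> doubly_periodic f \<and> (\<forall>p. stability_operator X f p + l * f p = 0)"
  unfolding eigenspace_def by (auto simp: algebra_simps eq_neg_iff_add_eq_0 neg_eq_iff_add_eq_0)

lemma stability_lin:
  assumes "smooth f" "smooth g"
  shows "stability_operator X (\<lambda>p. a * f p + b * g p) p = a * stability_operator X f p + b * stability_operator X g p"
proof -
  have s: "smooth (\<lambda>p. a * f p + b * g p)" by (intro smooth_intros assms)
  show ?thesis
    unfolding stability_X[OF s] stability_X[OF assms(1)] stability_X[OF assms(2)] partial_lin[OF assms]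
      partial_lin[OF smooth_partial[OF assms(1)] smooth_partial[OF assms(2)]]
    by (simp add: add_divide_distrib algebra_simps)
qed

lemma eigen_lin: "f \<in> eigenspace X l \<Longrightarrow> g \<in> eigenspace X l \<Longrightarrow> (\<lambda>p. a * f p + b * g p) \<in> eigenspace X l"
  unfolding eigen_iff
proof (intro conjI allI)
  assume f: "smooth f \<and> doubly_periodic f \<and> (\<forall>p. stability_operator X f p + l * f p = 0)"
    and g: "smooth g \<and> doubly_periodic g \<and> (\<forall>p. stability_operator X g p + l * g p = 0)"
  then show "smooth (\<lambda>p. a * f p + b * g p)" by (intro smooth_intros) auto
  show "doubly_periodic (\<lambda>p. a * f p + b * g p)" using f g by (simp add: doubly_periodic_def)
  fix p
  have z: "stability_operator X f p + l * f p = 0" "stability_operator X g p + l * g p = 0" using f g by blast+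
  have "stability_operator X (\<lambda>p. a * f p + b * g p) p + l * (a * f p + b * g p) = 
    a * (stability_operator X f p + l * f p) + b * (stability_operator X g p + l * g p)"
    unfolding stability_lin[OF conjunct1[OF f] conjunct1[OF g]] by (simp add: algebra_simps)
  then show "stability_operator X (\<lambda>p. a * f p + b * g p) p + l * (a * f p + b * g p) = 0" unfolding z by simp
qed

lemma eigen_zero: "(\<lambda>_. 0) \<in> eigenspace X l"
proof -
  have "partial i (\<lambda>_::real^2. 0::real) = (\<lambda>_. 0)" for i
    by (rule ext, subst partialI[OF has_derivative_const]) simp
  then show ?thesis unfolding eigen_iff stability_X[OF smooth_const] by (simp add: smooth_const doubly_periodic_def)
qed

lemma eigen_subspace: "fs.subspace (eigenspace X l)"
proof (rule fs.subspaceI)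
  show "0 \<in> eigenspace X l" using eigen_zero by (simp add: zero_fun_def)
  show "f + g \<in> eigenspace X l" if "f \<in> eigenspace X l" "g \<in> eigenspace X l" for f g
    using eigen_lin[OF that, of 1 1] by (simp add: plus_fun_def)
  show "(\<lambda>x. a * f x) \<in> eigenspace X l" if "f \<in> eigenspace X l" for f a
    using eigen_lin[OF that that, of a 0] by simp
qed

lemma mode_solsD:
  assumes "u \<in> mode_sols k l"
  shows "smooth u" "u (s + 2 * pi) = u s" "(deriv q s * deriv u s + q s * deriv (deriv u) s) / (w s * v s) + pot k l s * u s = 0"
  using assms unfolding mode_sols_def by auto

lemma separated_eigen:
  assumes u: "u \<in> mode_sols (fst j) l"
  shows "(\<lambda>p :: real^2. u (p $ 1) * trig j (p $ 2)) \<in> eigenspace X l"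
proof -
  have D: "(u has_real_derivative deriv u s) (at s)" "(deriv u has_real_derivative deriv (deriv u) s) (at s)" for s
    by (intro smooth_real_deriv mode_solsD[OF u])+
  have sm: "smooth (\<lambda>p :: real^2. u (p $ 1) * trig j (p $ 2))"
    by (intro smooth_mult smooth_coord_compose mode_solsD(1)[OF u] smooth_trig)
  have p1: "partial 1 (\<lambda>p :: real^2. u (p $ 1) * trig j (p $ 2)) = (\<lambda>p :: real^2. deriv u (p $ 1) * trig j (p $ 2))"
    by (rule ext, rule partial_sep(1)[OF D(1) DERIV_trig(1)])
  have p11: "partial 1 (\<lambda>p :: real^2. deriv u (p $ 1) * trig j (p $ 2)) p = deriv (deriv u) (p $ 1) * trig j (p $ 2)" for p
    by (rule partial_sep(1)[OF D(2) DERIV_trig(1)])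
  have p2: "partial 2 (\<lambda>p :: real^2. u (p $ 1) * trig j (p $ 2)) = (\<lambda>p :: real^2. u (p $ 1) * trig' j (p $ 2))"
    by (rule ext, rule partial_sep(2)[OF D(1) DERIV_trig(1)])
  have p22: "partial 2 (\<lambda>p :: real^2. u (p $ 1) * trig' j (p $ 2)) p = u (p $ 1) * (- (real (fst j))\<^sup>2 * trig j (p $ 2))" for p
    by (rule partial_sep(2)[OF D(1) DERIV_trig(2)])
  show ?thesis unfolding eigen_iff
  proof (intro conjI allI sm)
    show "doubly_periodic (\<lambda>p :: real^2. u (p $ 1) * trig j (p $ 2))"
      unfolding doubly_periodic_iff by (simp add: vector_2 mode_solsD(2)[OF u] trig_per)
    fix p
    have "stability_operator X (\<lambda>p :: real^2. u (p $ 1) * trig j (p $ 2)) p + l * (u (p $ 1) * trig j (p $ 2)) = 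
      ((deriv q (p $ 1) * deriv u (p $ 1) + q (p $ 1) * deriv (deriv u) (p $ 1)) / (w (p $ 1) * v (p $ 1)) + pot (fst j) l (p $ 1) * u (p $ 1)) * trig j (p $ 2)"
      unfolding stability_X[OF sm] p1 p11 p2 p22 pot_def using w_nz[of "p $ 1"] v_nz[of "p $ 1"] r_nz[of "p $ 1"] 
      by (simp add: field_simps)
    then show "stability_operator X (\<lambda>p :: real^2. u (p $ 1) * trig j (p $ 2)) p + l * (u (p $ 1) * trig j (p $ 2)) = 0"
      unfolding mode_solsD(3)[OF u] by simp
  qed
qed

text \<open>
  Multiply the eigenvalue equation by \<open>trig j\<close> and integrate over the circle of rotation; two
  integrations by parts move the angular derivatives to \<open>trig j\<close>.
\<close>

lemma coef_mode:
  assumes f: "f \<in> eigenspace X l"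
  shows "coef f j \<in> mode_sols (fst j) l"
  unfolding mode_sols_def mem_Collect_eq
proof (intro conjI allI)
  have sm: "smooth f" and dp: "doubly_periodic f" and eq: "stability_operator X f p + l * f p = 0" for p
    using f unfolding eigen_iff by auto
  show "smooth (coef f j)" by (rule smooth_coef[OF sm])
  fix s
  show "coef f j (s + 2 * pi) = coef f j s" using dp unfolding coef_def doubly_periodic_iff by simp
  have d1: "deriv (coef f j) = coef (partial 1 f) j" by (rule ext, rule DERIV_imp_deriv[OF DERIV_coef[OF sm]])
  have d2: "deriv (coef (partial 1 f) j) = coef (partial 1 (partial 1 f)) j" 
    by (rule ext, rule DERIV_imp_deriv[OF DERIV_coef[OF smooth_partial[OF sm]]])
  define A1 A2 A3 A4 where A: "A1 = deriv q s / (w s * v s)" "A2 = q s / (w s * v s)" "A3 = 1 / (r s)\<^sup>2" 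
    "A4 = (kap s)\<^sup>2 + (sg s)\<^sup>2 / (r s)\<^sup>2 + 1 / 2 + l"
  have cont: "continuous_on UNIV (\<lambda>t. g (vector [s, t]) * trig j t)" if "smooth g" for g :: "real^2 \<Rightarrow> real"
    by (intro continuous_on_mult continuous_slice smooth_continuous that trig_cont)
  have cf: "pint (\<lambda>t. g (vector [s, t]) * trig j t) = coef g j s" for g by (simp add: coef_def)
  have "A1 * (partial 1 f (vector [s, t]) * trig j t) + A2 * (partial 1 (partial 1 f) (vector [s, t]) * trig j t)
     + A3 * (partial 2 (partial 2 f) (vector [s, t]) * trig j t) + A4 * (f (vector [s, t]) * trig j t) = 0" for t
  proof -
    have "A1 * (partial 1 f (vector [s, t]) * trig j t) + A2 * (partial 1 (partial 1 f) (vector [s, t]) * trig j t)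
     + A3 * (partial 2 (partial 2 f) (vector [s, t]) * trig j t) + A4 * (f (vector [s, t]) * trig j t) = 
      (stability_operator X f (vector [s, t]) + l * f (vector [s, t])) * trig j t"
      unfolding stability_X[OF sm] A vector_2 by (simp add: add_divide_distrib algebra_simps)
    then show ?thesis unfolding eq by simp
  qed
  then have "pint (\<lambda>t. A1 * (partial 1 f (vector [s, t]) * trig j t) + A2 * (partial 1 (partial 1 f) (vector [s, t]) * trig j t)
     + A3 * (partial 2 (partial 2 f) (vector [s, t]) * trig j t) + A4 * (f (vector [s, t]) * trig j t)) = 0"
    by (simp add: pint_def)
  also have "pint (\<lambda>t. A1 * (partial 1 f (vector [s, t]) * trig j t) + A2 * (partial 1 (partial 1 f) (vector [s, t]) * trig j t)
     + A3 * (partial 2 (partial 2 f) (vector [s, t]) * trig j t) + A4 * (f (vector [s, t]) * trig j t)) = 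
     A1 * coef (partial 1 f) j s + A2 * coef (partial 1 (partial 1 f)) j s + A3 * coef (partial 2 (partial 2 f)) j s + A4 * coef f j s"
    unfolding cf[symmetric] by (intro pint_lin4 cont smooth_partial sm)
  finally have z: "A1 * coef (partial 1 f) j s + A2 * coef (partial 1 (partial 1 f)) j s + A3 * coef (partial 2 (partial 2 f)) j s + A4 * coef f j s = 0" .
  show "(deriv q s * deriv (coef f j) s + q s * deriv (deriv (coef f j)) s) / (w s * v s) + pot (fst j) l s * coef f j s = 0"
    using z unfolding coef_partial_2[OF sm dp] d1 d2 A pot_def by (simp add: add_divide_distrib algebra_simps)
qed

lemma mode_sols_linear:
  assumes "u \<in> mode_sols k l"
  shows "(\<lambda>s. a * u s) \<in> mode_sols k l"
proof -
  interpret SL: sturm_liouville "\<lambda>s. 1 * Pm s" "\<lambda>s. Qm k s / 1" "\<lambda>s. Wm s / 1" by (rule SL_scaled) simp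
  have "(\<lambda>s. w s * u s) \<in> SL.periodic_sols l" using assms mode_sols_iff[of 1 u k l] by simp
  from SL.periodic_sols_scale[OF this, of a] show ?thesis
    using mode_sols_iff[of 1 "\<lambda>s. a * u s" k l] by (simp add: mult_ac)
qed

text \<open>
  The coefficients have the form of those of \<open>SL_scaled\<close> with scale factor 1; the value is the same
  for every other factor.
\<close>

definition mode_dim :: "nat \<Rightarrow> real \<Rightarrow> nat" where
  "mode_dim k l = sturm_liouville.mult (\<lambda>s. 1 * Pm s) (\<lambda>s. Qm k s / 1) (\<lambda>s. Wm s / 1) l"

lemma has_dim_mode_sols_scaled:
  assumes K: "K > 0"
  shows "has_dim (mode_sols k l) (sturm_liouville.mult (\<lambda>s. K * Pm s) (\<lambda>s. Qm k s / K) (\<lambda>s. Wm s / K) l)"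
proof -
  interpret SL: sturm_liouville "\<lambda>s. K * Pm s" "\<lambda>s. Qm k s / K" "\<lambda>s. Wm s / K" by (rule SL_scaled[OF K])
  have "mode_sols k l = {u. (\<lambda>s. w s * u s) \<in> SL.periodic_sols l}" using mode_sols_iff[OF K] by blast
  then show ?thesis using has_dim_rescale[OF SL.has_dim_periodic_sols w_nz] by simp
qed

lemma has_dim_mode_sols: "has_dim (mode_sols k l) (mode_dim k l)"
  unfolding mode_dim_def by (rule has_dim_mode_sols_scaled) simp

lemma mode_dim_scaled:
  assumes "K > 0"
  shows "sturm_liouville.mult (\<lambda>s. K * Pm s) (\<lambda>s. Qm k s / K) (\<lambda>s. Wm s / K) = mode_dim k"
  using has_dim_unique[OF has_dim_mode_sols_scaled[OF assms] has_dim_mode_sols] by auto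

lemma mode_dim_zero:
  assumes "\<And>s. (real k)\<^sup>2 \<ge> 1 + (r s)\<^sup>2" "l < 0"
  shows "mode_dim k l = 0"
proof -
  interpret SL: sturm_liouville "\<lambda>s. 1 * Pm s" "\<lambda>s. Qm k s / 1" "\<lambda>s. Wm s / 1" by (rule SL_scaled) simp
  have "Qm k s / 1 \<le> 0" for s
  proof -
    have "(1 - (real k)\<^sup>2) / (r s)\<^sup>2 \<le> - 1"
      using assms(1)[of s] r_pos[of s] by (simp add: divide_le_eq)
    then show ?thesis unfolding Qm_def using coeffs_pos(2)[of s] by (simp add: mult_nonneg_nonpos)
  qed
  then show ?thesis unfolding mode_dim_def using SL.mult_zero[OF _ assms(2)] by blast
qed

text \<open>
  An eigenfunction differs from its partial Fourier sum by a function all of whose coefficients vanish: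
  those of index at least \<open>K\<close> because the corresponding radial solution spaces are trivial.
\<close>

lemma eigenspace_eq:
  assumes K: "\<And>k. k \<ge> K \<Longrightarrow> mode_dim k l = 0"
  shows "eigenspace X l = {\<lambda>p. \<Sum>j\<in>valid_modes K. u j (p $ 1) * trig j (p $ 2) |u. \<forall>j\<in>valid_modes K. u j \<in> mode_sols (fst j) l}"
proof (intro subset_antisym subsetI)
  fix f assume f: "f \<in> eigenspace X l"
  then have sm: "smooth f" and dp: "doubly_periodic f" unfolding eigen_iff by auto
  define N where "N j = pint (\<lambda>t. trig j t * trig j t)" for j
  have N: "N j > 0" if "snd j \<or> fst j \<noteq> 0" for j using trig_norm_pos[OF that] by (simp add: N_def)
  define u where "u j s = (1 / N j) * coef f j s" for j s
  have um: "u j \<in> mode_sols (fst j) l" for j unfolding u_def[abs_def] by (intro mode_sols_linear coef_mode f)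
  define g where "g p = (\<Sum>j\<in>valid_modes K. u j (p $ 1) * trig j (p $ 2))" for p :: "real^2"
  have smg: "smooth g" unfolding g_def[abs_def]
    by (intro smooth_sum finite_valid_modes smooth_mult smooth_coord_compose smooth_trig mode_solsD(1)[OF um])
  have dpg: "doubly_periodic g" 
    unfolding doubly_periodic_iff g_def vector_2 using mode_solsD(2)[OF um] by (simp add: trig_per)
  have "(\<lambda>p. f p - g p) = (\<lambda>_. 0)"
  proof (rule fourier_complete_slice)
    show "continuous_on UNIV (\<lambda>p. f p - g p)" by (intro continuous_intros smooth_continuous sm smg)
    show "doubly_periodic (\<lambda>p. f p - g p)" using dp dpg by (simp add: doubly_periodic_def)
    fix j :: "nat \<times> bool" and s assume j: "snd j \<or> fst j \<noteq> 0"
    have "coef (\<lambda>p. f p - g p) j s = coef f j s - coef g j s"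
      unfolding coef_def left_diff_distrib
      by (rule pint_diff; intro continuous_on_mult continuous_slice smooth_continuous sm smg trig_cont)
    also have "coef g j s = (if j \<in> valid_modes K then u j s * N j else 0)"
      unfolding g_def[abs_def] N_def by (rule coef_separated[OF finite_valid_modes])
    also have "\<dots> = coef f j s"
    proof (cases "j \<in> valid_modes K")
      case True then show ?thesis using N[OF j] by (simp add: u_def)
    next
      case False
      then have "mode_dim (fst j) l = 0" using j by (intro K) (auto simp: valid_modes_def)
      then have "has_dim (mode_sols (fst j) l) 0" using has_dim_mode_sols[of "fst j" l] by simp
      then have "coef f j = (\<lambda>_. 0)" using has_dim_0D coef_mode[OF f, of j] by blast
      then show ?thesis using False by simp
    qed
    finally show "coef (\<lambda>p. f p - g p) j s = 0" by simp
  qed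
  then have "f = g" by (auto simp: fun_eq_iff)
  then show "f \<in> {\<lambda>p. \<Sum>j\<in>valid_modes K. u j (p $ 1) * trig j (p $ 2) |u. \<forall>j\<in>valid_modes K. u j \<in> mode_sols (fst j) l}"
    using um g_def[abs_def] by blast
next
  fix f :: "real^2 \<Rightarrow> real" assume "f \<in> {\<lambda>p. \<Sum>j\<in>valid_modes K. u j (p $ 1) * trig j (p $ 2) |u. \<forall>j\<in>valid_modes K. u j \<in> mode_sols (fst j) l}"
  then obtain u where u: "f = (\<lambda>p. \<Sum>j\<in>valid_modes K. u j (p $ 1) * trig j (p $ 2))" "\<forall>j\<in>valid_modes K. u j \<in> mode_sols (fst j) l"
    by blast
  have "(\<Sum>j\<in>valid_modes K. (\<lambda>p. u j (p $ 1) * trig j (p $ 2))) \<in> eigenspace X l"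
    by (rule fs.subspace_sum[OF eigen_subspace]) (use u(2) separated_eigen in blast)
  then show "f \<in> eigenspace X l" unfolding u(1) sum_fun_eq .
qed

lemma has_dim_eigenspace:
  assumes K: "\<And>k. k \<ge> K \<Longrightarrow> mode_dim k l = 0"
  shows "has_dim (eigenspace X l) (\<Sum>k<K. (if k = 0 then 1 else 2) * mode_dim k l)"
  unfolding sum_valid_modes[symmetric, of "\<lambda>k. mode_dim k l"]
proof (rule has_dim_separated[OF finite_valid_modes has_dim_mode_sols _ eigenspace_eq[OF K]])
  fix u :: "nat \<times> bool \<Rightarrow> real \<Rightarrow> real"
  assume z: "(\<lambda>p::real^2. \<Sum>j\<in>valid_modes K. u j (p $ 1) * trig j (p $ 2)) = (\<lambda>_. 0)"
  show "\<forall>j\<in>valid_modes K. u j = (\<lambda>_. 0)"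
  proof (intro ballI ext)
    fix j s assume j: "j \<in> valid_modes K"
    have "u j s * pint (\<lambda>t. trig j t * trig j t) = coef (\<lambda>_. 0) j s"
      using coef_separated[OF finite_valid_modes, of u K j s] j unfolding z by simp
    also have "\<dots> = 0" by (simp add: coef_def pint_def)
    finally show "u j s = 0" using trig_norm_pos[of j] j by (auto simp: valid_modes_def)
  qed
qed

end

section \<open>The index as a count of radial eigenvalues\<close>

lemma periodic_critical_point:
  fixes f :: "real \<Rightarrow> real"
  assumes "\<And>s. (f has_real_derivative f' s) (at s)" "f (0 + 2 * pi) = f 0"
  shows "\<exists>s. f' s = 0"
proof -
  obtain s where "0 < s" "s < 2 * pi" "f (2 * pi) - f 0 = (2 * pi - 0) * f' s"
    using MVT2[of 0 "2 * pi" f f'] assms(1) by auto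
  then show ?thesis using assms(2) by auto
qed

lemma sum_enat: "(\<Sum>i\<in>I. enat (f i)) = enat (\<Sum>i\<in>I. f i)"
  by (induction I rule: infinite_finite_induct) (auto simp: zero_enat_def)

lemma trig_separated_zero:
  assumes J: "finite J" "\<And>j. j \<in> J \<Longrightarrow> snd j \<or> fst j \<noteq> 0"
    and z: "(\<lambda>p::real^2. \<Sum>j\<in>J. u j (p $ 1) * trig j (p $ 2)) = (\<lambda>_. 0)"
  shows "\<forall>j\<in>J. u j = (\<lambda>_. 0)"
proof (intro ballI ext)
  fix j s assume j: "j \<in> J"
  have "u j s * pint (\<lambda>t. trig j t * trig j t) = coef (\<lambda>_. 0) j s"
    using coef_separated[OF J(1), of u j s] j unfolding z by simp
  also have "\<dots> = 0" by (simp add: coef_def pint_def)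
  finally show "u j s = 0" using trig_norm_pos[OF J(2)[OF j]] by simp
qed

context shrinker_profile
begin

definition neg_count :: "nat \<Rightarrow> nat" where
  "neg_count k = (\<Sum>l\<in>{l. l < 0 \<and> mode_dim k l \<noteq> 0}. mode_dim k l)"

lemma finite_neg_levels: "finite {l. l < 0 \<and> mode_dim k l \<noteq> 0}"
proof -
  interpret SL: sturm_liouville "\<lambda>s. 1 * Pm s" "\<lambda>s. Qm k s / 1" "\<lambda>s. Wm s / 1" by (rule SL_scaled) simp
  show ?thesis using SL.finite_mult unfolding mode_dim_def .
qed

lemma neg_count_bounds:
  assumes K: "K > 0"
  shows "(\<And>s. Qm k s \<le> K\<^sup>2 * Pm s) \<Longrightarrow> real (neg_count k) < K * pint Pm / pi + 1"
    "(\<And>s. Qm k s \<ge> K\<^sup>2 * Pm s) \<Longrightarrow> real (neg_count k) \<ge> K * pint Pm / pi - 1"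
proof -
  interpret SL: sturm_liouville "\<lambda>s. K * Pm s" "\<lambda>s. Qm k s / K" "\<lambda>s. Wm s / K" by (rule SL_scaled[OF K])
  have len: "SL.len = K * pint Pm"
    using pint_FTC[OF antideriv(2)[OF SL.cont(1)]] antideriv(1)[OF SL.cont(1)] 
    by (simp add: SL.len_def pint_cmult)
  have cnt: "(\<Sum>l\<in>{l. l < 0 \<and> SL.mult l \<noteq> 0}. SL.mult l) = neg_count k"
    unfolding neg_count_def mode_dim_scaled[OF K] ..
  show "real (neg_count k) < K * pint Pm / pi + 1" if "\<And>s. Qm k s \<le> K\<^sup>2 * Pm s"
    using SL.sum_mult_upper[unfolded cnt len] that K by (simp add: divide_le_eq power2_eq_square mult_ac)
  show "real (neg_count k) \<ge> K * pint Pm / pi - 1" if "\<And>s. Qm k s \<ge> K\<^sup>2 * Pm s"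
    using SL.sum_mult_lower[unfolded cnt len] that K by (simp add: le_divide_eq power2_eq_square mult_ac)
qed

lemma sg_nonzero: "\<exists>s. sg s \<noteq> 0" 
  using periodic_critical_point[OF smooth_real_deriv(1)[OF smooth_rz(1)] per_rz(1)[of 0]] regular v_nz 
  by (auto simp: sg_def)

lemma c_nonzero: "\<exists>s. c s \<noteq> 0" 
  using periodic_critical_point[OF smooth_real_deriv(1)[OF smooth_rz(2)] per_rz(2)[of 0]] regular v_nz 
  by (auto simp: c_def)

text \<open>
  Otherwise \<open>z / r\<close> would be constant, and at a critical point of \<open>r\<close> the derivative of \<open>z\<close> would
  vanish as well.
\<close>

lemma eta_nonzero: "\<exists>s. eta s \<noteq> 0"
proof (rule ccontr)
  assume "\<not> (\<exists>s. eta s \<noteq> 0)"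
  then have z: "z s * c s = r s * sg s" for s by (auto simp: eta_def)
  have "((\<lambda>s. z s / r s) has_real_derivative 0) (at s)" for s
  proof -
    have "((\<lambda>s. z s / r s) has_real_derivative ((v s * sg s) * r s - z s * (v s * c s)) / (r s * r s)) (at s)"
      by (intro DERIV_divide DERIV_z DERIV_r r_nz)
    moreover have "(v s * sg s) * r s - z s * (v s * c s) = v s * (r s * sg s - z s * c s)" by (simp add: algebra_simps)
    ultimately show ?thesis using z[of s] by simp
  qed
  then have zr0: "z s / r s = z 0 / r 0" for s using DERIV_isconst_all[of "\<lambda>s. z s / r s"] by blast
  have zr: "z s = (z 0 / r 0) * r s" for s using zr0[of s] unfolding nonzero_divide_eq_eq[OF r_nz[of s]] .
  obtain s0 where s0: "deriv r s0 = 0"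
    using periodic_critical_point[OF smooth_real_deriv(1)[OF smooth_rz(1)] per_rz(1)[of 0]] by blast
  have "(z has_real_derivative (z 0 / r 0) * deriv r s0) (at s0)"
    using DERIV_cmult[OF smooth_real_deriv(1)[OF smooth_rz(1)], of "z 0 / r 0" s0] unfolding zr[symmetric] .
  then have "deriv z s0 = 0" using s0 DERIV_imp_deriv by fastforce
  then show False using regular[of s0] s0 by simp
qed

definition transl :: "(real^2 \<Rightarrow> real) set" where
  "transl = {\<lambda>p. x \<bullet> unit_normal X p | x. True}"

definition dilat :: "(real^2 \<Rightarrow> real) set" where
  "dilat = {\<lambda>p. a * mean_curvature X p | a. True}"

lemma vector_3_all: obtains a1 a2 a3 where "(x :: real^3) = vector [a1, a2, a3]"
proof -
  have "x = vector [x $ 1, x $ 2, x $ 3]" by (simp add: vec_eq_iff forall_3 vector_3)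
  then show ?thesis using that by blast
qed

definition tmodes :: "(nat \<times> bool) set" where "tmodes = {(1, True), (1, False), (0, True)}"

lemma transl_eq: "transl = {\<lambda>p. \<Sum>j\<in>tmodes. u j (p $ 1) * trig j (p $ 2) |u. 
   \<forall>j\<in>tmodes. u j \<in> {\<lambda>s. a * (if fst j = 1 then sg else c) s |a. True}}"
proof (intro subset_antisym subsetI)
  fix f assume "f \<in> transl"
  then obtain x where x: "f = (\<lambda>p. x \<bullet> unit_normal X p)" by (auto simp: transl_def)
  obtain a1 a2 a3 where xa: "x = vector [a1, a2, a3]" by (rule vector_3_all)
  define a where "a j = (if j = (1, True) then - a1 else if j = (1, False) then - a2 else a3)" for j :: "nat \<times> bool"
  define u where "u j = (\<lambda>s. a j * (if fst j = 1 then sg else c) s)" for j :: "nat \<times> bool"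
  have "f = (\<lambda>p. \<Sum>j\<in>tmodes. u j (p $ 1) * trig j (p $ 2))"
    unfolding x xa normal_X inner_vector_3 tmodes_def u_def by (auto simp: trig_def a_def)
  moreover have "\<forall>j\<in>tmodes. u j \<in> {\<lambda>s. a * (if fst j = 1 then sg else c) s |a. True}"
    unfolding u_def by blast
  ultimately show "f \<in> {\<lambda>p. \<Sum>j\<in>tmodes. u j (p $ 1) * trig j (p $ 2) |u. 
   \<forall>j\<in>tmodes. u j \<in> {\<lambda>s. a * (if fst j = 1 then sg else c) s |a. True}}" by blast
next
  fix f :: "real^2 \<Rightarrow> real" assume "f \<in> {\<lambda>p. \<Sum>j\<in>tmodes. u j (p $ 1) * trig j (p $ 2) |u. 
   \<forall>j\<in>tmodes. u j \<in> {\<lambda>s. a * (if fst j = 1 then sg else c) s |a. True}}"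
  then obtain u where f: "f = (\<lambda>p. \<Sum>j\<in>tmodes. u j (p $ 1) * trig j (p $ 2))" and 
    u: "\<forall>j\<in>tmodes. u j \<in> {\<lambda>s. a * (if fst j = 1 then sg else c) s |a. True}"
    unfolding mem_Collect_eq[of f] by (elim exE conjE)
  have ex: "\<exists>a. u j = (\<lambda>s. a * (if fst j = 1 then sg else c) s)" if "j \<in> tmodes" for j using u that by blast
  have mem: "(1, True) \<in> tmodes" "(1, False) \<in> tmodes" "(0, True) \<in> tmodes" by (auto simp: tmodes_def)
  obtain a1 where a1: "u (1, True) = (\<lambda>s. a1 * sg s)" using ex[OF mem(1)] by auto
  obtain a2 where a2: "u (1, False) = (\<lambda>s. a2 * sg s)" using ex[OF mem(2)] by auto
  obtain a3 where a3: "u (0, True) = (\<lambda>s. a3 * c s)" using ex[OF mem(3)] by auto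
  note a = a1 a2 a3
  have "f = (\<lambda>p. vector [- a1, - a2, a3] \<bullet> unit_normal X p)"
    unfolding f tmodes_def normal_X inner_vector_3 using a by (auto simp: trig_def)
  then show "f \<in> transl" by (auto simp: transl_def)
qed

lemma transl_eigen: "transl \<subseteq> eigenspace X (- 1 / 2)"
proof
  fix f assume "f \<in> transl"
  then obtain u where f: "f = (\<lambda>p. \<Sum>j\<in>tmodes. u j (p $ 1) * trig j (p $ 2))" and 
    u: "\<forall>j\<in>tmodes. u j \<in> {\<lambda>s. a * (if fst j = 1 then sg else c) s |a. True}"
    unfolding transl_eq mem_Collect_eq[of f] by (elim exE conjE)
  have um: "u j \<in> mode_sols (fst j) (- 1 / 2)" if "j \<in> tmodes" for j
  proof -
    have "\<exists>a. u j = (\<lambda>s. a * (if fst j = 1 then sg else c) s)" using u that by blast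
    then obtain a where a: "u j = (\<lambda>s. a * (if fst j = 1 then sg else c) s)" ..
    have "(if fst j = 1 then sg else c) \<in> mode_sols (fst j) (- 1 / 2)"
      using that sg_mode c_mode unfolding tmodes_def by auto
    then show ?thesis unfolding a by (rule mode_sols_linear)
  qed
  have "(\<Sum>j\<in>tmodes. (\<lambda>p. u j (p $ 1) * trig j (p $ 2))) \<in> eigenspace X (- 1 / 2)"
    by (rule fs.subspace_sum[OF eigen_subspace]) (use um separated_eigen in blast)
  then show "f \<in> eigenspace X (- 1 / 2)" unfolding f sum_fun_eq .
qed

lemma has_dim_transl: "has_dim transl 3"
proof -
  have "has_dim transl (\<Sum>j\<in>tmodes. 1)"
  proof (rule has_dim_separated[OF _ _ _ transl_eq])
    show "finite tmodes" by (simp add: tmodes_def)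
    show "has_dim {\<lambda>s. a * (if fst j = 1 then sg else c) s |a. True} 1" if "j \<in> tmodes" for j
      using sg_nonzero c_nonzero by (intro has_dim_1) (auto simp: fun_eq_iff)
    show "\<forall>j\<in>tmodes. u j = (\<lambda>_. 0)" if "(\<lambda>p :: real^2. \<Sum>j\<in>tmodes. u j (p $ 1) * trig j (p $ 2)) = (\<lambda>_. 0)" for u
      by (rule trig_separated_zero[OF _ _ that]) (auto simp: tmodes_def)
  qed
  moreover have "(\<Sum>j\<in>tmodes. 1) = (3 :: nat)" by (simp add: tmodes_def)
  ultimately show ?thesis by (simp only:)
qed

lemma mean_curvature_eta: "mean_curvature X p = eta (p $ 1) / 2"
  unfolding mean_curvature_X shrinker eta_def by simp

lemma dilat_eigen: "dilat \<subseteq> eigenspace X (- 1)"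
proof
  fix f assume "f \<in> dilat"
  then obtain a where "f = (\<lambda>p. a * mean_curvature X p)" by (auto simp: dilat_def)
  then have "f = (\<lambda>p. (a / 2 * eta (p $ 1)) * trig (0, True) (p $ 2))" by (simp add: mean_curvature_eta trig_def)
  moreover have "(\<lambda>p :: real^2. (a / 2 * eta (p $ 1)) * trig (0, True) (p $ 2)) \<in> eigenspace X (- 1)"
    by (rule separated_eigen) (use mode_sols_linear[OF eta_mode, of "a / 2"] in simp)
  ultimately show "f \<in> eigenspace X (- 1)" by simp
qed

lemma has_dim_dilat: "has_dim dilat 1"
proof (rule has_dim_1)
  obtain s where s: "eta s \<noteq> 0" using eta_nonzero by blast
  show "mean_curvature X \<noteq> (\<lambda>_. 0)"
  proof
    assume "mean_curvature X = (\<lambda>_. 0)"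
    then have "mean_curvature X (vector [s, 0]) = 0" by simp
    then show False using s unfolding mean_curvature_eta by (simp add: vector_2)
  qed
qed (simp add: dilat_def)

lemma trivial_eq: "trivial_variations X = {\<lambda>p. f p + g p |f g. f \<in> transl \<and> g \<in> dilat}"
  unfolding trivial_variations_def
proof (intro subset_antisym subsetI)
  fix h assume "h \<in> {\<lambda>p. x \<bullet> unit_normal X p + a * mean_curvature X p |x a. True}"
  then obtain x a where h: "h = (\<lambda>p. x \<bullet> unit_normal X p + a * mean_curvature X p)" by blast
  have "(\<lambda>p. x \<bullet> unit_normal X p) \<in> transl" "(\<lambda>p. a * mean_curvature X p) \<in> dilat"
    by (auto simp: transl_def dilat_def)
  then show "h \<in> {\<lambda>p. f p + g p |f g. f \<in> transl \<and> g \<in> dilat}" unfolding h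
    by (intro CollectI exI[of _ "\<lambda>p. x \<bullet> unit_normal X p"] exI[of _ "\<lambda>p. a * mean_curvature X p"] conjI refl)
qed (auto simp: transl_def dilat_def)

lemma transl_trivial: "transl \<subseteq> trivial_variations X"
proof
  fix f assume "f \<in> transl"
  then obtain x where "f = (\<lambda>p. x \<bullet> unit_normal X p + 0 * mean_curvature X p)" by (auto simp: transl_def)
  then show "f \<in> trivial_variations X" unfolding trivial_variations_def by blast
qed

lemma dilat_trivial: "dilat \<subseteq> trivial_variations X"
proof
  fix f assume "f \<in> dilat"
  then obtain a where "f = (\<lambda>p. 0 \<bullet> unit_normal X p + a * mean_curvature X p)" by (auto simp: dilat_def)
  then show "f \<in> trivial_variations X" unfolding trivial_variations_def by blast
qed

lemma subspace_transl: "fs.subspace transl" and subspace_dilat: "fs.subspace dilat"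
  using has_dim_subspace has_dim_transl has_dim_dilat by blast+

lemma trivial_subspace: "fs.subspace (trivial_variations X)"
proof -
  have "trivial_variations X = {x + y |x y. x \<in> transl \<and> y \<in> dilat}"
    unfolding trivial_eq plus_fun_def ..
  then show ?thesis using fs.subspace_sums[OF subspace_transl subspace_dilat] by simp
qed

lemma eigen_disjoint:
  assumes "f \<in> eigenspace X l" "f \<in> eigenspace X m" "l \<noteq> m"
  shows "f = (\<lambda>_. 0)"
proof
  fix p
  have "stability_operator X f p + l * f p = 0" "stability_operator X f p + m * f p = 0"
    using assms unfolding eigen_iff by auto
  then have "l * f p = m * f p" by linarith
  then show "f p = 0" using assms(3) by simp
qed

lemma trivial_zero_mem: "(\<lambda>_. 0) \<in> transl" "(\<lambda>_. 0) \<in> dilat"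
  using fs.subspace_0[OF subspace_transl] fs.subspace_0[OF subspace_dilat] by (simp_all add: zero_fun_def)

text \<open>
  Translations have the eigenvalue \<open>- 1 / 2\<close> and span three dimensions, the dilation has the eigenvalue
  \<open>- 1\<close>.
\<close>

definition triv_dim :: "real \<Rightarrow> nat" where
  "triv_dim l = (if l = - 1 / 2 then 3 else if l = - 1 then 1 else 0)"

text \<open>
  Eigenfunctions for different eigenvalues are independent, so a sum of a translation and a dilation is
  an eigenfunction only if one of the two summands is 0.
\<close>

lemma has_dim_trivial: "has_dim (eigenspace X l \<inter> trivial_variations X) (triv_dim l)"
proof -
  have split: "(l + 1 / 2) \<noteq> 0 \<longrightarrow> f = (\<lambda>_. 0)" "(l + 1) \<noteq> 0 \<longrightarrow> g = (\<lambda>_. 0)"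
    if fg: "f \<in> transl" "g \<in> dilat" "(\<lambda>p. f p + g p) \<in> eigenspace X l" for f g
  proof -
    have f: "f \<in> eigenspace X (- 1 / 2)" and g: "g \<in> eigenspace X (- 1)" using fg transl_eigen dilat_eigen by auto
    have e: "(l + 1 / 2) * f p + (l + 1) * g p = 0" for p
    proof -
      have "stability_operator X (\<lambda>p. 1 * f p + 1 * g p) p = 1 * stability_operator X f p + 1 * stability_operator X g p"
        using f g by (intro stability_lin) (auto simp: eigen_iff)
      moreover have "stability_operator X (\<lambda>p. 1 * f p + 1 * g p) p + l * (f p + g p) = 0" using fg(3) by (simp add: eigen_iff)
      moreover have "stability_operator X f p + (- 1 / 2) * f p = 0" "stability_operator X g p + (- 1) * g p = 0"
        using f g unfolding eigen_iff by blast+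
      ultimately show ?thesis by (simp add: algebra_simps)
    qed
    have "(\<lambda>p. (l + 1 / 2) * f p) = (\<lambda>p. - (l + 1) * g p)" using e by (auto simp: fun_eq_iff eq_neg_iff_add_eq_0 algebra_simps)
    moreover have "(\<lambda>p. (l + 1 / 2) * f p) \<in> eigenspace X (- 1 / 2)" using fs.subspace_scale[OF eigen_subspace f] .
    moreover have "(\<lambda>p. - (l + 1) * g p) \<in> eigenspace X (- 1)" using fs.subspace_scale[OF eigen_subspace g] .
    ultimately have z: "(\<lambda>p. (l + 1 / 2) * f p) = (\<lambda>_. 0)" "(\<lambda>p. - (l + 1) * g p) = (\<lambda>_. 0)"
      using eigen_disjoint[of _ "- 1 / 2" "- 1"] by auto
    then show "(l + 1 / 2) \<noteq> 0 \<longrightarrow> f = (\<lambda>_. 0)" "(l + 1) \<noteq> 0 \<longrightarrow> g = (\<lambda>_. 0)"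
      using fun_cong[OF z(1)] fun_cong[OF z(2)] by (auto simp: fun_eq_iff add_eq_0_iff)
  qed
  consider "l = - 1 / 2" | "l = - 1" | "l \<noteq> - 1 / 2" "l \<noteq> - 1" by blast
  then show ?thesis
  proof cases
    case 1
    have "eigenspace X l \<inter> trivial_variations X = transl"
    proof (intro subset_antisym subsetI)
      fix h assume "h \<in> eigenspace X l \<inter> trivial_variations X"
      then obtain f g where "h = (\<lambda>p. f p + g p)" "f \<in> transl" "g \<in> dilat" "h \<in> eigenspace X l" unfolding trivial_eq by blast
      then show "h \<in> transl" using split(2)[of f g] 1 by simp
    next
      fix h assume h: "h \<in> transl"
      then show "h \<in> eigenspace X l \<inter> trivial_variations X" using transl_eigen transl_trivial 1 by auto
    qed
    then show ?thesis using has_dim_transl 1 by (simp add: triv_dim_def)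
  next
    case 2
    have "eigenspace X l \<inter> trivial_variations X = dilat"
    proof (intro subset_antisym subsetI)
      fix h assume "h \<in> eigenspace X l \<inter> trivial_variations X"
      then obtain f g where "h = (\<lambda>p. f p + g p)" "f \<in> transl" "g \<in> dilat" "h \<in> eigenspace X l" unfolding trivial_eq by blast
      then show "h \<in> dilat" using split(1)[of f g] 2 by simp
    next
      fix h assume h: "h \<in> dilat"
      then show "h \<in> eigenspace X l \<inter> trivial_variations X" using dilat_eigen dilat_trivial 2 by auto
    qed
    then show ?thesis using has_dim_dilat 2 by (simp add: triv_dim_def)
  next
    case 3
    have "eigenspace X l \<inter> trivial_variations X = {\<lambda>_. 0}"
    proof (intro subset_antisym subsetI)
      fix h assume "h \<in> eigenspace X l \<inter> trivial_variations X"
      then obtain f g where "h = (\<lambda>p. f p + g p)" "f \<in> transl" "g \<in> dilat" "h \<in> eigenspace X l" unfolding trivial_eq by blast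
      then show "h \<in> {\<lambda>_. 0}" using split[of f g] 3 by (simp add: add_eq_0_iff)
    next
      fix h assume h: "h \<in> {\<lambda>_::real^2. 0::real}"
      then have "h \<in> trivial_variations X" using trivial_zero_mem(1) transl_trivial by auto
      then show "h \<in> eigenspace X l \<inter> trivial_variations X" using eigen_zero h by auto
    qed
    then show ?thesis using has_dim_0 3 by (simp add: triv_dim_def)
  qed
qed

text \<open>
  Only finitely many negative eigenvalues have a nontrivial eigenspace.  At each of them the quotient by
  the trivial variations has the dimension of the eigenspace minus that of its trivial part, and the
  trivial parts have dimension 3 and 1.
\<close>

theorem index_eq:
  assumes K: "\<And>k s. k \<ge> K \<Longrightarrow> (real k)\<^sup>2 \<ge> 1 + (r s)\<^sup>2"
  shows "index X = enat ((\<Sum>k<K. (if k = 0 then 1 else 2) * neg_count k) - 4)"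
    "4 \<le> (\<Sum>k<K. (if k = 0 then 1 else 2) * neg_count k)"
proof -
  define L where "L = (\<Union>k<K. {l. l < 0 \<and> mode_dim k l \<noteq> 0})"
  define d where "d l = (\<Sum>k<K. (if k = 0 then 1 else 2) * mode_dim k l)" for l
  have L: "finite L" "L \<subseteq> {..<0}" unfolding L_def using finite_neg_levels by auto
  have dimE: "has_dim (eigenspace X l) (d l)" if "l < 0" for l
    unfolding d_def by (rule has_dim_eigenspace) (use mode_dim_zero[OF K that] in blast)
  have dm: "dim_mod (eigenspace X l) (trivial_variations X) = enat (d l - triv_dim l)" if "l < 0" for l
    by (rule dim_mod_eq[OF dimE[OF that] has_dim_trivial trivial_subspace])
  have le: "triv_dim l \<le> d l" if "l < 0" for l
    by (rule has_dim_mono[OF has_dim_trivial dimE[OF that]]) simp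
  have d0: "d l = 0" if "l < 0" "l \<notin> L" for l
    unfolding d_def using that by (intro sum.neutral) (auto simp: L_def)
  have "index X = (\<Sum>l\<in>L. dim_mod (eigenspace X l) (trivial_variations X))"
    unfolding index_def using L d0 by (intro infsum_enat_finite) (auto simp: dm zero_enat_def)
  also have "\<dots> = (\<Sum>l\<in>L. enat (d l - triv_dim l))" using L by (intro sum.cong) (auto simp: dm)
  also have "\<dots> = enat ((\<Sum>l\<in>L. d l) - (\<Sum>l\<in>L. triv_dim l))"
    unfolding sum_enat using L le by (subst sum_subtractf_nat) auto
  also have triv: "(\<Sum>l\<in>L. triv_dim l) = 4"
  proof -
    have mem: "- 1 / 2 \<in> L" "- 1 \<in> L"
      using d0[of "- 1 / 2"] d0[of "- 1"] le[of "- 1 / 2"] le[of "- 1"] by (auto simp: triv_dim_def)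
    have "(\<Sum>l\<in>L. triv_dim l) = (\<Sum>l\<in>{- 1 / 2, - 1}. triv_dim l)"
      using L mem by (intro sum.mono_neutral_right) (auto simp: triv_dim_def)
    then show ?thesis by (simp add: triv_dim_def)
  qed
  also have sumd: "(\<Sum>l\<in>L. d l) = (\<Sum>k<K. (if k = 0 then 1 else 2) * neg_count k)"
  proof -
    have "(\<Sum>l\<in>L. d l) = (\<Sum>k<K. (if k = 0 then 1 else 2) * (\<Sum>l\<in>L. mode_dim k l))"
      unfolding d_def by (subst sum.swap) (simp add: sum_distrib_left)
    also have "\<dots> = (\<Sum>k<K. (if k = 0 then 1 else 2) * neg_count k)"
    proof (intro sum.cong refl arg_cong2[where f = "(*)"])
      fix k assume "k \<in> {..<K}"
      then show "(\<Sum>l\<in>L. mode_dim k l) = neg_count k"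
        unfolding neg_count_def using L by (intro sum.mono_neutral_right) (auto simp: L_def)
    qed
    finally show ?thesis .
  qed
  finally show "index X = enat ((\<Sum>k<K. (if k = 0 then 1 else 2) * neg_count k) - 4)" .
  have "(\<Sum>l\<in>L. triv_dim l) \<le> (\<Sum>l\<in>L. d l)" using L le by (intro sum_mono) auto
  then show "4 \<le> (\<Sum>k<K. (if k = 0 then 1 else 2) * neg_count k)" unfolding triv sumd .
qed

end

section \<open>Integrals over the period cell\<close>

abbreviation cell :: "(real^2) set" where "cell \<equiv> cbox 0 (\<chi> i. 2 * pi)"

text \<open>
  Fubini's theorem for a product of two intervals, carried over to \<open>real^2\<close> by the measure-preserving
  identification of the coordinates.
\<close>

lemma integral_cell:
  fixes f :: "real^2 \<Rightarrow> real"
  assumes "continuous_on UNIV f"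
  shows "integral cell f = pint (\<lambda>s. pint (\<lambda>t. f (vector [s, t])))"
    "integral cell f = pint (\<lambda>t. pint (\<lambda>s. f (vector [s, t])))"
proof -
  define g where "g x = (vector [fst x, snd x] :: real^2)" for x :: "real \<times> real"
  define h where "h p = (p $ 1, p $ 2)" for p :: "real^2"
  have hg: "h (g x) = x" for x by (simp add: g_def h_def vector_2)
  have gh: "g (h p) = p" for p by (simp add: g_def h_def vector_2 vec_eq_iff forall_2)
  have gbox: "g ` cbox u w = cbox (g u) (g w)" for u w
  proof (intro subset_antisym subsetI)
    fix p assume "p \<in> cbox (g u) (g w)"
    then have "h p \<in> cbox u w" 
      by (cases u, cases w) (auto simp: g_def h_def mem_box_cart forall_2 vector_2 cbox_Pair_eq)
    then show "p \<in> g ` cbox u w" using gh[of p] by (metis imageI)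
  qed (cases u, cases w, auto simp: g_def mem_box_cart forall_2 vector_2 cbox_Pair_eq)
  have hbox: "h ` cbox a b = cbox (h a) (h b)" for a b
    using gbox[of "h a" "h b"] hg gh by (metis (no_types, lifting) image_comp image_ident image_cong comp_apply)
  have cont: "measure lborel (g ` cbox u w) = 1 * measure lborel (cbox u w)" for u w
  proof -
    obtain u1 u2 w1 w2 where uw: "u = (u1, u2)" "w = (w1, w2)" by (cases u, cases w) auto
    show ?thesis
    proof (cases "u1 \<le> w1 \<and> u2 \<le> w2")
      case True
      then have ne: "cbox (g u) (g w) \<noteq> {}" by (auto simp: uw g_def interval_ne_empty_cart forall_2 vector_2)
      show ?thesis unfolding gbox content_cbox_cart[OF ne] using True
        by (simp add: uw g_def UNIV_2 vector_2 content_Pair content_real)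
    next
      case False
      then have "\<not> (\<forall>i. g u $ i \<le> g w $ i)" by (simp add: uw g_def forall_2 vector_2)
      then have "cbox (g u) (g w) = {}" using interval_ne_empty_cart(1)[of "g u" "g w"] by blast
      moreover have "cbox u w = {}" using False by (auto simp: uw cbox_Pair_eq)
      ultimately show ?thesis unfolding gbox by simp
    qed
  qed
  have int: "(f has_integral integral cell f) cell"
    by (intro integrable_integral integrable_continuous continuous_on_subset[OF assms]) auto
  have contg: "continuous (at x) g" for x
    using continuous_on_eq_continuous_at[OF open_UNIV, THEN iffD1, OF continuous_vector2[of UNIV]] unfolding g_def by blast
  have "((\<lambda>x. f (g x)) has_integral (1 / 1) *\<^sub>R integral cell f) (h ` cell)"
    by (rule has_integral_twiddle[OF zero_less_one hg gh contg _ _ cont int]) (unfold gbox hbox, blast+)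
  moreover have "h ` cell = cbox (0, 0) (2 * pi, 2 * pi)" unfolding hbox by (simp add: h_def)
  ultimately have e: "integral cell f = integral (cbox (0, 0) (2 * pi, 2 * pi)) (\<lambda>x. f (g x))"
    by (simp add: integral_unique)
  have cfg: "continuous_on S (\<lambda>x. f (g x))" for S
    unfolding g_def by (rule continuous_on_compose2[OF assms continuous_vector2]) auto
  have "integral (cbox (0, 0) (2 * pi, 2 * pi)) (\<lambda>x. f (g x)) = integral (cbox 0 (2 * pi)) (\<lambda>x. integral (cbox 0 (2 * pi)) (\<lambda>y. f (g (x, y))))"
    by (rule integral_prod_continuous[OF cfg])
  then show 1: "integral cell f = pint (\<lambda>s. pint (\<lambda>t. f (vector [s, t])))" 
    unfolding e pint_def by (simp add: g_def)
  have "integral (cbox 0 (2 * pi)) (\<lambda>x. integral (cbox 0 (2 * pi)) (\<lambda>y. f (g (x, y)))) = 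
    integral (cbox 0 (2 * pi)) (\<lambda>y. integral (cbox 0 (2 * pi)) (\<lambda>x. f (g (x, y))))"
    by (rule integral_swap_continuous) (use cfg in \<open>simp add: case_prod_unfold\<close>)
  then show "integral cell f = pint (\<lambda>t. pint (\<lambda>s. f (vector [s, t])))" 
    unfolding 1 pint_def by (simp add: g_def)
qed

lemma integral_divergence:
  assumes g: "smooth g1" "doubly_periodic g1" "smooth g2" "doubly_periodic g2"
  shows "integral cell (\<lambda>p. partial 1 g1 p + partial 2 g2 p) = (0 :: real)"
proof -
  have 1: "integral cell (partial 1 g1) = 0"
  proof -
    have "pint (\<lambda>s. partial 1 g1 (vector [s, t])) = g1 (vector [2 * pi, t]) - g1 (vector [0, t])" for t
      by (rule pint_FTC[OF DERIV_along_1[OF g(1)]])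
    moreover have "g1 (vector [0 + 2 * pi, t]) = g1 (vector [0, t])" for t using g(2) unfolding doubly_periodic_iff by blast
    ultimately show ?thesis by (simp add: integral_cell(2) smooth_continuous smooth_partial g pint_def)
  qed
  have 2: "integral cell (partial 2 g2) = 0"
  proof -
    have "pint (\<lambda>t. partial 2 g2 (vector [s, t])) = g2 (vector [s, 2 * pi]) - g2 (vector [s, 0])" for s
      by (rule pint_FTC[OF DERIV_along_2[OF g(3)]])
    moreover have "g2 (vector [s, 0 + 2 * pi]) = g2 (vector [s, 0])" for s using g(4) unfolding doubly_periodic_iff by blast
    ultimately show ?thesis by (simp add: integral_cell(1) smooth_continuous smooth_partial g pint_def)
  qed
  show ?thesis
    by (subst integral_add) (auto intro!: integrable_continuous smooth_continuous smooth_partial g simp: 1 2)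
qed

section \<open>Entropy of a self-shrinker\<close>

lemma DERIV_gaussian:
  assumes "(f1 has_real_derivative d1) (at x)" "(f2 has_real_derivative d2) (at x)" "(f3 has_real_derivative d3) (at x)"
  shows "((\<lambda>x. (1 / T) * exp (- ((f1 x)\<^sup>2 + (f2 x)\<^sup>2 + (f3 x)\<^sup>2) / (4 * T))) has_real_derivative
    (1 / T) * (exp (- ((f1 x)\<^sup>2 + (f2 x)\<^sup>2 + (f3 x)\<^sup>2) / (4 * T)) * (- (2 * f1 x * d1 + 2 * f2 x * d2 + 2 * f3 x * d3) / (4 * T)))) (at x)"
proof -
  have "((\<lambda>x. (f1 x)\<^sup>2 + (f2 x)\<^sup>2 + (f3 x)\<^sup>2) has_real_derivative 2 * f1 x * d1 + 2 * f2 x * d2 + 2 * f3 x * d3) (at x)"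
    by (auto intro!: derivative_eq_intros assms)
  from DERIV_cmult[OF DERIV_chain2[OF DERIV_exp DERIV_cdivide[OF DERIV_minus[OF this], of "4 * T"]], of "1 / T"]
  show ?thesis .
qed

context shrinker_profile
begin

lemma F_functional_X: "F_functional X = pint Pm / 2"
proof -
  define f where "f p = exp (- (norm (X p))\<^sup>2 / 4) * area_density X p" for p
  have f: "f p = Pm (p $ 1)" for p
    unfolding f_def norm_X area_X Pm_def w_def by (simp add: mult_ac)
  have "continuous_on UNIV f" unfolding f
    by (intro smooth_continuous smooth_coord_compose smooth_coeffs)
  from integral_cell(2)[OF this] have "integral cell f = pint (\<lambda>t. pint Pm)" unfolding f vector_2 .
  also have "\<dots> = 2 * pi * pint Pm" by (simp add: pint_def)
  finally show ?thesis unfolding F_functional_def f_def[symmetric] by simp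
qed

text \<open>
  The first variation of the Gaussian area with centre \<open>e y\<close> and scale \<open>T = 1 + a e\<^sup>2\<close>, as \<open>e\<close>
  increases.  Let \<open>u = x - e y\<close>.  The divergence theorem for the tangential part of \<open>G V\<close>, where
  \<open>V = \<alpha> u + y\<close> and \<open>\<alpha> = a e / T\<close>, gives an expression with integral 0; adding it to the integrand
  removes the constant term and all tangential components of \<open>u\<close> and \<open>y\<close>.  With the mean curvature
  \<open>(U + e Y) / 2\<close>, where \<open>U\<close> and \<open>Y\<close> are the normal components of \<open>u\<close> and \<open>y\<close>, the remainder is
  \<open>- (e / 2) (\<alpha> U + Y)\<^sup>2\<close> times a positive density.
\<close>

lemma gaussian_first_variation:
  fixes y1 y2 y3 a e T :: real
  assumes e: "e \<ge> 0" and T: "T = 1 + a * e\<^sup>2" "T > 0"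
  defines "u1 \<equiv> \<lambda>p::real^2. r (p $ 1) * cos (p $ 2) - e * y1" and "u2 \<equiv> \<lambda>p::real^2. r (p $ 1) * sin (p $ 2) - e * y2"
    and "u3 \<equiv> \<lambda>p::real^2. z (p $ 1) - e * y3"
  defines "G \<equiv> \<lambda>p. (1 / T) * exp (- ((u1 p)\<^sup>2 + (u2 p)\<^sup>2 + (u3 p)\<^sup>2) / (4 * T))"
  shows "integral cell (\<lambda>p. G p * (v (p $ 1) * r (p $ 1)) * (- 2 * a * e / T + (u1 p * y1 + u2 p * y2 + u3 p * y3) / (2 * T) 
     + a * e * ((u1 p)\<^sup>2 + (u2 p)\<^sup>2 + (u3 p)\<^sup>2) / (2 * T\<^sup>2))) \<le> 0"
proof -
  have Tn: "T \<noteq> 0" using T by simp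
  define \<alpha> where "\<alpha> = a * e / T"
  have su: "smooth u1" "smooth u2" "smooth u3"
    unfolding u1_def u2_def u3_def by (intro smooth_intros smooth_rz)+
  have sG: "smooth G" unfolding G_def by (intro smooth_intros su) (use T in auto)
  \<comment> \<open>Components along the profile, along the circle of rotation, and along the normal.\<close>
  define es where "es b1 b2 b3 p = b1 * (c (p $ 1) * cos (p $ 2)) + b2 * (c (p $ 1) * sin (p $ 2)) + b3 * sg (p $ 1)" for b1 b2 b3 and p :: "real^2"
  define et where "et b1 b2 p = b2 * cos (p $ 2) - b1 * sin (p $ 2)" for b1 b2 and p :: "real^2"
  define en where "en b1 b2 b3 p = b3 * c (p $ 1) - sg (p $ 1) * (b1 * cos (p $ 2) + b2 * sin (p $ 2))" for b1 b2 b3 and p :: "real^2"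
  define V1 V2 V3 where V: "V1 = (\<lambda>p. \<alpha> * u1 p + y1)" "V2 = (\<lambda>p. \<alpha> * u2 p + y2)" "V3 = (\<lambda>p. \<alpha> * u3 p + y3)"
  define g1 where "g1 p = G p * r (p $ 1) * es (V1 p) (V2 p) (V3 p) p" for p
  define g2 where "g2 p = G p * v (p $ 1) * et (V1 p) (V2 p) p" for p
  have s1: "smooth g1" unfolding g1_def[abs_def] es_def V by (intro smooth_intros su sG smooth_rz)
  have s2: "smooth g2" unfolding g2_def[abs_def] et_def V by (intro smooth_intros su sG smooth_rz)
  have dp: "doubly_periodic g1" "doubly_periodic g2"
    unfolding doubly_periodic_iff g1_def g2_def es_def et_def V G_def u1_def u2_def u3_def vector_2
    by (simp_all add: per_geo per_rz)
  define D where "D p = - 2 * a * e / T + (u1 p * y1 + u2 p * y2 + u3 p * y3) / (2 * T) 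
     + a * e * ((u1 p)\<^sup>2 + (u2 p)\<^sup>2 + (u3 p)\<^sup>2) / (2 * T\<^sup>2)" for p
  have key: "G p * (v (p $ 1) * r (p $ 1)) * D p \<le> - (partial 1 g1 p + partial 2 g2 p)" for p
  proof -
    define s t where st: "s = p $ 1" "t = p $ 2"
    have p: "p = vector [s, t]" by (simp add: st vec_eq_iff forall_2 vector_2)
    define C S where CS: "C = cos t" "S = sin t"
    have cs: "C\<^sup>2 + S\<^sup>2 = 1" by (simp add: CS)
    have cg: "(c s)\<^sup>2 + (sg s)\<^sup>2 = 1" by (rule c_sg)
    define us where "us = es (u1 p) (u2 p) (u3 p) p"
    define ut where "ut = et (u1 p) (u2 p) p"
    define U where "U = en (u1 p) (u2 p) (u3 p) p"
    define ys where "ys = es y1 y2 y3 p"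
    define yt where "yt = et y1 y2 p"
    define Y where "Y = en y1 y2 y3 p"
    define E where "E = es (V1 p) (V2 p) (V3 p) p"
    define H where "H = et (V1 p) (V2 p) p"
    define N where "N = en (V1 p) (V2 p) (V3 p) p"
    define Vr where "Vr = V1 p * C + V2 p * S"
    have lin: "E = \<alpha> * us + ys" "H = \<alpha> * ut + yt" "N = \<alpha> * U + Y"
      unfolding E_def H_def N_def us_def ut_def U_def ys_def yt_def Y_def es_def et_def en_def V by (simp_all add: algebra_simps)
    have dot: "u1 p * y1 + u2 p * y2 + u3 p * y3 = us * ys + ut * yt + U * Y"
      using cs cg unfolding us_def ut_def U_def ys_def yt_def Y_def es_def et_def en_def st(1)[symmetric] st(2)[symmetric] CS(1)[symmetric] CS(2)[symmetric]
      by algebra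
    have sq: "(u1 p)\<^sup>2 + (u2 p)\<^sup>2 + (u3 p)\<^sup>2 = us\<^sup>2 + ut\<^sup>2 + U\<^sup>2"
      using cs cg unfolding us_def ut_def U_def es_def et_def en_def st(1)[symmetric] st(2)[symmetric] CS(1)[symmetric] CS(2)[symmetric]
      by algebra
    have Vr: "c s * E - Vr = sg s * N"
      using cs cg unfolding E_def N_def Vr_def es_def en_def st(1)[symmetric] st(2)[symmetric] CS(1)[symmetric] CS(2)[symmetric]
      by algebra
    \<comment> \<open>The self-shrinker equation at the point \<open>x = u + e y\<close>.\<close>
    have HN: "kap s + sg s / r s = - (U + e * Y) / 2"
      unfolding shrinker U_def Y_def en_def u1_def u2_def u3_def st(1)[symmetric] st(2)[symmetric] CS(1)[symmetric] CS(2)[symmetric]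
      using cs r_nz[of s] by (simp add: field_simps) algebra
    have d1: "partial 1 g1 p = G p * v s * (- (us / (2 * T)) * r s * E + c s * E + r s * (\<alpha> + kap s * N))"
    proof -
      have Dx: "((\<lambda>s. u1 (vector [s, t])) has_real_derivative v s * c s * C) (at s)"
         "((\<lambda>s. u2 (vector [s, t])) has_real_derivative v s * c s * S) (at s)"
         "((\<lambda>s. u3 (vector [s, t])) has_real_derivative v s * sg s) (at s)"
        unfolding u1_def u2_def u3_def vector_2 CS by (auto intro!: derivative_eq_intros DERIV_r DERIV_z)
      have DG: "((\<lambda>s. G (vector [s, t])) has_real_derivative G p * (- v s * us / (2 * T))) (at s)"
      proof -
        have A: "((\<lambda>s. G (vector [s, t])) has_real_derivative (1 / T) * (exp (- ((u1 p)\<^sup>2 + (u2 p)\<^sup>2 + (u3 p)\<^sup>2) / (4 * T)) *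
           (- (2 * u1 p * (v s * c s * C) + 2 * u2 p * (v s * c s * S) + 2 * u3 p * (v s * sg s)) / (4 * T)))) (at s)"
          unfolding G_def p by (rule DERIV_gaussian[OF Dx])
        have B: "- (2 * u1 p * (v s * c s * C) + 2 * u2 p * (v s * c s * S) + 2 * u3 p * (v s * sg s)) / (4 * T) = - v s * us / (2 * T)"
          unfolding us_def es_def st(1)[symmetric] st(2)[symmetric] CS(1)[symmetric] CS(2)[symmetric] using Tn by (simp add: field_simps)
        show ?thesis using A unfolding B G_def by (simp only: mult.assoc)
      qed
      have DE: "((\<lambda>s. es (V1 (vector [s, t])) (V2 (vector [s, t])) (V3 (vector [s, t])) (vector [s, t])) has_real_derivative v s * (\<alpha> + kap s * N)) (at s)"
      proof -
        have "((\<lambda>s. es (V1 (vector [s, t])) (V2 (vector [s, t])) (V3 (vector [s, t])) (vector [s, t])) has_real_derivative 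
          (\<alpha> * (v s * c s * C)) * (c s * C) + (- kap s * v s * sg s) * C * V1 p
          + ((\<alpha> * (v s * c s * S)) * (c s * S) + (- kap s * v s * sg s) * S * V2 p)
          + ((\<alpha> * (v s * sg s)) * sg s + (kap s * v s * c s) * V3 p)) (at s)"
          unfolding es_def vector_2 V p CS by (auto intro!: derivative_eq_intros Dx[unfolded CS] DERIV_c DERIV_sg)
        moreover have "(\<alpha> * (v s * c s * C)) * (c s * C) + (- kap s * v s * sg s) * C * V1 p
          + ((\<alpha> * (v s * c s * S)) * (c s * S) + (- kap s * v s * sg s) * S * V2 p)
          + ((\<alpha> * (v s * sg s)) * sg s + (kap s * v s * c s) * V3 p) = v s * (\<alpha> + kap s * N)"
          using cs cg unfolding N_def en_def st(1)[symmetric] st(2)[symmetric] CS(1)[symmetric] CS(2)[symmetric] by algebra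
        ultimately show ?thesis by simp
      qed
      have "((\<lambda>s. g1 (vector [s, t])) has_real_derivative 
        (G p * (- v s * us / (2 * T)) * r s + v s * c s * G p) * E + v s * (\<alpha> + kap s * N) * (G p * r s)) (at s)"
        unfolding g1_def vector_2 using DERIV_mult[OF DERIV_mult[OF DG DERIV_r] DE] unfolding p[symmetric] E_def .
      from DERIV_unique[OF DERIV_along_1[OF s1] this] show ?thesis unfolding p[symmetric] by (simp add: algebra_simps)
    qed
    have d2: "partial 2 g2 p = G p * v s * (- (ut / (2 * T)) * r s * H + \<alpha> * r s - Vr)"
    proof -
      have Dx: "((\<lambda>t. u1 (vector [s, t])) has_real_derivative - r s * S) (at t)"
         "((\<lambda>t. u2 (vector [s, t])) has_real_derivative r s * C) (at t)"
         "((\<lambda>t. u3 (vector [s, t])) has_real_derivative 0) (at t)"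
        unfolding u1_def u2_def u3_def vector_2 CS by (auto intro!: derivative_eq_intros)
      have DG: "((\<lambda>t. G (vector [s, t])) has_real_derivative G p * (- r s * ut / (2 * T))) (at t)"
      proof -
        have A: "((\<lambda>t. G (vector [s, t])) has_real_derivative (1 / T) * (exp (- ((u1 p)\<^sup>2 + (u2 p)\<^sup>2 + (u3 p)\<^sup>2) / (4 * T)) *
           (- (2 * u1 p * (- r s * S) + 2 * u2 p * (r s * C) + 2 * u3 p * 0) / (4 * T)))) (at t)"
          unfolding G_def p by (rule DERIV_gaussian[OF Dx])
        have B: "- (2 * u1 p * (- r s * S) + 2 * u2 p * (r s * C) + 2 * u3 p * 0) / (4 * T) = - r s * ut / (2 * T)"
          unfolding ut_def et_def st(1)[symmetric] st(2)[symmetric] CS(1)[symmetric] CS(2)[symmetric] using Tn by (simp add: field_simps)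
        show ?thesis using A unfolding B G_def by (simp only: mult.assoc)
      qed
      have DE: "((\<lambda>t. et (V1 (vector [s, t])) (V2 (vector [s, t])) (vector [s, t])) has_real_derivative \<alpha> * r s - Vr) (at t)"
      proof -
        have "((\<lambda>t. et (V1 (vector [s, t])) (V2 (vector [s, t])) (vector [s, t])) has_real_derivative 
          ((\<alpha> * (r s * C)) * C + (- S) * V2 p) - ((\<alpha> * (- r s * S)) * S + C * V1 p)) (at t)"
          unfolding et_def vector_2 V p CS by (auto intro!: derivative_eq_intros Dx[unfolded CS])
        moreover have "((\<alpha> * (r s * C)) * C + (- S) * V2 p) - ((\<alpha> * (- r s * S)) * S + C * V1 p) = \<alpha> * r s - Vr"
          using cs unfolding Vr_def by algebra
        ultimately show ?thesis by simp
      qed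
      have "((\<lambda>t. g2 (vector [s, t])) has_real_derivative 
        (G p * (- r s * ut / (2 * T)) * v s) * H + (\<alpha> * r s - Vr) * (G p * v s)) (at t)"
        unfolding g2_def vector_2 using DERIV_mult[OF DERIV_cmult_right[OF DG, of "v s"] DE] unfolding p[symmetric] H_def .
      from DERIV_unique[OF DERIV_along_2[OF s2] this] show ?thesis unfolding p[symmetric] by (simp add: algebra_simps)
    qed
    have sum: "partial 1 g1 p + partial 2 g2 p = G p * (v s * r s) * (- (us * E + ut * H) / (2 * T) + 2 * \<alpha> - (U + e * Y) / 2 * N)"
    proof -
      have "partial 1 g1 p + partial 2 g2 p = G p * v s * (r s * (- (us * E + ut * H) / (2 * T) + 2 * \<alpha> + kap s * N) + (c s * E - Vr))"
        unfolding d1 d2 using Tn by (simp add: field_simps)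
      also have "r s * (- (us * E + ut * H) / (2 * T) + 2 * \<alpha> + kap s * N) + (c s * E - Vr) = 
        r s * (- (us * E + ut * H) / (2 * T) + 2 * \<alpha> + (kap s + sg s / r s) * N)"
        unfolding Vr using r_nz[of s] by (simp add: field_simps)
      also have "(kap s + sg s / r s) * N = - ((U + e * Y) / 2 * N)" unfolding HN by (simp only: minus_mult_left[symmetric] minus_divide_left[symmetric])
      finally show ?thesis by (simp add: mult_ac)
    qed
    have Dp: "D p + (- (us * E + ut * H) / (2 * T) + 2 * \<alpha> - (U + e * Y) / 2 * N) = - (e / 2) * (\<alpha> * U + Y)\<^sup>2"
    proof -
      have invT: "1 / T = 1 - \<alpha> * e" unfolding \<alpha>_def using Tn T(1) by (simp add: field_simps power2_eq_square)
      have half: "x / (2 * T) = x * ((1 - \<alpha> * e) / 2)" for x unfolding invT[symmetric] by simp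
      have "D p = - 2 * \<alpha> + (us * ys + ut * yt + U * Y) / (2 * T) + \<alpha> * (us\<^sup>2 + ut\<^sup>2 + U\<^sup>2) / (2 * T)"
        unfolding D_def dot sq \<alpha>_def using Tn by (simp add: power2_eq_square)
      then show ?thesis unfolding half lin by (simp add: power2_eq_square algebra_simps add_divide_distrib diff_divide_distrib)
    qed
    have "- (e / 2) * (\<alpha> * U + Y)\<^sup>2 \<le> 0" using e by (simp add: mult_nonpos_nonneg)
    then have "D p \<le> - (- (us * E + ut * H) / (2 * T) + 2 * \<alpha> - (U + e * Y) / 2 * N)" using Dp by linarith
    moreover have "G p * (v s * r s) \<ge> 0" unfolding G_def using T v_pos[of s] r_pos[of s] by simp
    ultimately have "G p * (v s * r s) * D p \<le> G p * (v s * r s) * (- (- (us * E + ut * H) / (2 * T) + 2 * \<alpha> - (U + e * Y) / 2 * N))"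
      by (rule mult_left_mono)
    then show ?thesis unfolding sum st(1)[symmetric] by (simp only: mult_minus_right)
  qed
  have sD: "smooth (\<lambda>p. G p * (v (p $ 1) * r (p $ 1)) * D p)"
    unfolding D_def by (intro smooth_intros smooth_rz sG su) (use Tn in auto)
  have "integral cell (\<lambda>p. G p * (v (p $ 1) * r (p $ 1)) * D p) \<le> integral cell (\<lambda>p. - (partial 1 g1 p + partial 2 g2 p))"
    by (intro integral_le integrable_continuous smooth_continuous[OF sD] continuous_intros smooth_continuous smooth_partial s1 s2 key)
  also have "\<dots> = 0" by (simp only: integral_neg integral_divergence[OF s1 dp(1) s2 dp(2)] minus_zero)
  finally show ?thesis unfolding D_def .
qed

end

context shrinker_profile
begin

lemma X_differentiable: "(X has_derivative frechet_derivative X (at p)) (at p)"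
proof -
  have "X differentiable (at p)"
    unfolding X_eq vector_3_eq
    by (intro differentiable_add differentiable_scaleR differentiable_const
        differentiableI[OF has_derivative_sep[OF DERIV_r DERIV_cos]] differentiableI[OF has_derivative_sep[OF DERIV_r DERIV_sin]]
        differentiableI[OF has_derivative_sep[OF DERIV_z DERIV_const]])
  then show ?thesis by (simp add: frechet_derivative_works)
qed

lemma area_density_scaled:
  assumes "t0 > 0"
  shows "area_density (\<lambda>p. x0 + sqrt t0 *\<^sub>R X p) p = t0 * (v (p $ 1) * r (p $ 1))"
proof -
  have "((\<lambda>p. x0 + sqrt t0 *\<^sub>R X p) has_derivative (\<lambda>h. sqrt t0 *\<^sub>R frechet_derivative X (at p) h)) (at p)"
    by (rule has_derivative_eq_rhs[OF has_derivative_add[OF has_derivative_const has_derivative_scaleR_right[OF X_differentiable]]]) simp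
  from partialI[OF this] have P: "partial i (\<lambda>p. x0 + sqrt t0 *\<^sub>R X p) p = sqrt t0 *\<^sub>R partial i X p" for i
    by (simp add: partial_def)
  have "metric (\<lambda>p. x0 + sqrt t0 *\<^sub>R X p) p $ i $ j = t0 * metric X p $ i $ j" for i j
    unfolding metric_def vec_lambda_beta P using assms by simp
  then have "metric (\<lambda>p. x0 + sqrt t0 *\<^sub>R X p) p = diag2 (t0 * (v (p $ 1))\<^sup>2) (t0 * (r (p $ 1))\<^sup>2)"
    unfolding eq_diag2 metric_X by (simp add: diag2_nth)
  then have "area_density (\<lambda>p. x0 + sqrt t0 *\<^sub>R X p) p = sqrt ((t0 * (v (p $ 1) * r (p $ 1)))\<^sup>2)"
    unfolding area_density_def diag2_ops by (simp add: diag2_ops power2_eq_square mult_ac)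
  also have "\<dots> = t0 * (v (p $ 1) * r (p $ 1))" using assms v_pos[of "p $ 1"] r_pos[of "p $ 1"] by (intro real_sqrt_unique) auto
  finally show ?thesis .
qed

text \<open>
  Translating and dilating the surface amounts to Gaussian area with centre \<open>y = - x\<^sub>0 / sqrt t\<^sub>0\<close> and
  scale \<open>1 / t\<^sub>0\<close>.  The path with centre \<open>e y\<close> and scale \<open>T e = 1 + (1 / t\<^sub>0 - 1) e\<^sup>2\<close> joins it, at
  \<open>e = 1\<close>, to \<open>F\<close> itself at \<open>e = 0\<close>.
\<close>

lemma F_functional_scaled_le:
  assumes t0: "t0 > 0"
  shows "F_functional (\<lambda>p. x0 + sqrt t0 *\<^sub>R X p) \<le> F_functional X"
proof -
  define y where "y = (- 1 / sqrt t0) *\<^sub>R x0"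
  define a where "a = 1 / t0 - 1"
  define T where "T e = 1 + a * e\<^sup>2" for e
  define U where "U e p = (r (p $ 1) * cos (p $ 2) - e * y $ 1)\<^sup>2 + (r (p $ 1) * sin (p $ 2) - e * y $ 2)\<^sup>2 + (z (p $ 1) - e * y $ 3)\<^sup>2" for e and p :: "real^2"
  define U' where "U' e p = (r (p $ 1) * cos (p $ 2) - e * y $ 1) * y $ 1 + (r (p $ 1) * sin (p $ 2) - e * y $ 2) * y $ 2 + (z (p $ 1) - e * y $ 3) * y $ 3" for e and p :: "real^2"
  define J where "J p = v (p $ 1) * r (p $ 1)" for p :: "real^2"
  define g where "g e p = (1 / T e) * exp (- U e p / (4 * T e)) * J p" for e p
  define g' where "g' e p = (1 / T e) * exp (- U e p / (4 * T e)) * J p * (- 2 * a * e / T e + U' e p / (2 * T e) + a * e * U e p / (2 * (T e)\<^sup>2))" for e p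
  have Tpos: "T e > 0" if "e \<in> {0..1}" for e
  proof -
    have e2: "0 \<le> e\<^sup>2" "e\<^sup>2 \<le> 1" using that by (auto simp: power_le_one)
    have "T e = (1 - e\<^sup>2) + (1 / t0) * e\<^sup>2" by (simp add: T_def a_def algebra_simps)
    moreover have "(1 - e\<^sup>2) + (1 / t0) * e\<^sup>2 > 0"
    proof (cases "e\<^sup>2 = 1")
      case True then show ?thesis using t0 by simp
    next
      case False
      then have "1 - e\<^sup>2 > 0" using e2 by simp
      moreover have "(1 / t0) * e\<^sup>2 \<ge> 0" using t0 e2 by simp
      ultimately show ?thesis by linarith
    qed
    ultimately show ?thesis by simp
  qed
  have sU: "smooth (U e)" "smooth (U' e)" "smooth J" for e
    unfolding U_def[abs_def] U'_def[abs_def] J_def[abs_def] by (intro smooth_intros smooth_rz)+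
  have sg': "smooth (g e)" "smooth (g' e)" if "e \<in> {0..1}" for e
    unfolding g_def[abs_def] g'_def[abs_def] using Tpos[OF that] by (intro smooth_intros sU; simp)+
  have deriv_le: "integral cell (g' e) \<le> 0" if "e \<in> {0..1}" for e
    using gaussian_first_variation[of e "T e" a "y $ 1" "y $ 2" "y $ 3"] that Tpos[OF that]
    unfolding g'_def U_def U'_def J_def T_def by simp
  have D: "((\<lambda>e. integral cell (g e)) has_real_derivative integral cell (g' e)) (at e within {0..1})" if e: "e \<in> {0..1}" for e
  proof (rule leibniz_rule_field_derivative[OF _ _ _ e])
    fix e p assume e: "e \<in> {0..1::real}"
    have Tn: "T e \<noteq> 0" using Tpos[OF e] by simp
    have DT: "(T has_real_derivative 2 * a * e) (at e)" unfolding T_def[abs_def] by (auto intro!: derivative_eq_intros)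
    have DU: "((\<lambda>e. U e p) has_real_derivative - 2 * U' e p) (at e)"
      unfolding U_def U'_def by (auto intro!: derivative_eq_intros simp: algebra_simps)
    have "((\<lambda>e. exp (- U e p / (4 * T e))) has_real_derivative 
       exp (- U e p / (4 * T e)) * ((- (- 2 * U' e p) * (4 * T e) - - U e p * (4 * (2 * a * e))) / ((4 * T e) * (4 * T e)))) (at e)"
      by (rule DERIV_chain2[OF DERIV_exp DERIV_divide[OF DERIV_minus[OF DU] DERIV_cmult[OF DT]]]) (use Tn in simp)
    from DERIV_cmult_right[OF DERIV_mult[OF DERIV_divide[OF DERIV_const[of 1] DT Tn] this], of "J p"]
    have "((\<lambda>e. g e p) has_real_derivative ((0 * T e - 1 * (2 * a * e)) / (T e * T e) * exp (- U e p / (4 * T e)) + 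
      exp (- U e p / (4 * T e)) * ((- (- 2 * U' e p) * (4 * T e) - - U e p * (4 * (2 * a * e))) / ((4 * T e) * (4 * T e))) * (1 / T e)) * J p) (at e)"
      unfolding g_def .
    also have "((0 * T e - 1 * (2 * a * e)) / (T e * T e) * exp (- U e p / (4 * T e)) + 
      exp (- U e p / (4 * T e)) * ((- (- 2 * U' e p) * (4 * T e) - - U e p * (4 * (2 * a * e))) / ((4 * T e) * (4 * T e))) * (1 / T e)) * J p = g' e p"
    proof -
      define x where "x = exp (- U e p / (4 * T e))"
      show ?thesis unfolding g'_def x_def[symmetric] using Tn by (simp add: field_simps power2_eq_square)
    qed
    finally show "((\<lambda>e. g e p) has_real_derivative g' e p) (at e within {0..1})" by (rule has_field_derivative_at_within)
  next
    fix e assume "e \<in> {0..1::real}"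
    then show "g e integrable_on cell" by (intro integrable_continuous smooth_continuous sg')
  next
    have r1: "continuous_on S (\<lambda>x. f (snd x $ 1))" if "smooth f" for S :: "(real \<times> (real^2)) set" and f :: "real \<Rightarrow> real"
      by (rule continuous_on_compose2[OF smooth_continuous[OF that, of UNIV]]) (auto intro!: continuous_intros)
    have nz: "\<forall>x\<in>{0..1} \<times> cell. T (fst x) \<noteq> 0" using Tpos by force
    show "continuous_on ({0..1} \<times> cell) (\<lambda>(e, p). g' e p)"
      unfolding g'_def J_def U_def U'_def case_prod_unfold
      using nz unfolding T_def by (intro continuous_intros r1 smooth_rz smooth_v) auto
  qed simp
  have "\<exists>e\<in>{0<..<1}. integral cell (g 1) - integral cell (g 0) = integral cell (g' e) * (1 - 0)"
    by (rule mvt_simple) (use D in \<open>auto simp: has_field_derivative_def\<close>)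
  then obtain e where "e \<in> {0<..<1}" "integral cell (g 1) - integral cell (g 0) = integral cell (g' e) * (1 - 0)" ..
  then have le: "integral cell (g 1) \<le> integral cell (g 0)" using deriv_le[of e] by simp
  have norm3: "(norm x)\<^sup>2 = (x $ 1)\<^sup>2 + (x $ 2)\<^sup>2 + (x $ 3)\<^sup>2" for x :: "real^3"
    unfolding power2_norm_eq_inner by (simp add: inner_vec_def sum_3 power2_eq_square)
  have Xn: "X p $ 1 = r (p $ 1) * cos (p $ 2)" "X p $ 2 = r (p $ 1) * sin (p $ 2)" "X p $ 3 = z (p $ 1)" for p
    unfolding X_eq vector_3 by simp_all
  have U: "U e p = (norm (X p - e *\<^sub>R y))\<^sup>2" for e p
    unfolding U_def norm3 by (simp add: Xn)
  have g0: "g 0 = (\<lambda>p. exp (- (norm (X p))\<^sup>2 / 4) * area_density X p)"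
    by (rule ext) (simp add: g_def U T_def J_def area_X)
  have g1: "g 1 = (\<lambda>p. exp (- (norm (x0 + sqrt t0 *\<^sub>R X p))\<^sup>2 / 4) * area_density (\<lambda>p. x0 + sqrt t0 *\<^sub>R X p) p)"
  proof
    fix p
    have "x0 + sqrt t0 *\<^sub>R X p = sqrt t0 *\<^sub>R (X p - 1 *\<^sub>R y)"
      using t0 by (simp add: y_def scaleR_add_right)
    then have "(norm (x0 + sqrt t0 *\<^sub>R X p))\<^sup>2 = t0 * U 1 p"
      unfolding U using t0 by (simp add: power_mult_distrib)
    moreover have "T 1 = 1 / t0" by (simp add: T_def a_def)
    ultimately show "g 1 p = exp (- (norm (x0 + sqrt t0 *\<^sub>R X p))\<^sup>2 / 4) * area_density (\<lambda>p. x0 + sqrt t0 *\<^sub>R X p) p"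
      unfolding g_def area_density_scaled[OF t0] J_def using t0 by (simp add: mult_ac)
  qed
  show ?thesis using le unfolding F_functional_def g0 g1 by (simp add: divide_right_mono)
qed

lemma entropy_X: "entropy X = pint Pm / 2"
  unfolding entropy_def
proof (rule cSup_eq_maximum)
  have "X = (\<lambda>p. 0 + sqrt 1 *\<^sub>R X p)" by simp
  then have "F_functional X = F_functional (\<lambda>p. 0 + sqrt 1 *\<^sub>R X p)" by simp
  then have "F_functional X \<in> {F_functional (\<lambda>p. x0 + sqrt t0 *\<^sub>R X p) |x0 t0. t0 > 0}"
    by (intro CollectI exI[of _ 0] exI[of _ 1]) simp
  then show "pint Pm / 2 \<in> {F_functional (\<lambda>p. x0 + sqrt t0 *\<^sub>R X p) |x0 t0. t0 > 0}" by (simp only: F_functional_X)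
next
  fix x assume "x \<in> {F_functional (\<lambda>p. x0 + sqrt t0 *\<^sub>R X p) |x0 t0. t0 > 0}"
  then show "x \<le> pint Pm / 2" using F_functional_scaled_le unfolding F_functional_X by auto
qed

end

section \<open>Bounds for the potentials and for the index\<close>

context shrinker_profile
begin

lemma norm_X_bounded: "\<exists>B. \<forall>p. norm (X p) \<le> B"
proof -
  have sm: "smooth (\<lambda>s. (r s)\<^sup>2 + (z s)\<^sup>2)" by (intro smooth_intros smooth_rz)
  obtain B where B: "\<And>s. \<bar>(r s)\<^sup>2 + (z s)\<^sup>2\<bar> \<le> B"
    using periodic_bounded[OF smooth_continuous[OF sm]] per_rz by auto
  have "norm (X p) \<le> sqrt B" for p
    using B[of "p $ 1"] by (intro real_le_rsqrt) (simp add: norm_X)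
  then show ?thesis by blast
qed

lemma norm_le_max: "norm (X p) \<le> max_origin_distance X"
proof -
  obtain B where "\<And>p. norm (X p) \<le> B" using norm_X_bounded by blast
  then show ?thesis unfolding max_origin_distance_def by (intro cSUP_upper bdd_aboveI2[of _ _ B]) auto
qed

lemma sq_le_max: "(r s)\<^sup>2 + (z s)\<^sup>2 \<le> (max_origin_distance X)\<^sup>2"
proof -
  have "(norm (X (vector [s, 0])))\<^sup>2 \<le> (max_origin_distance X)\<^sup>2"
    by (intro power_mono norm_le_max) auto
  then show ?thesis by (simp add: norm_X vector_2)
qed

lemma max_origin_pos: "max_origin_distance X > 0"
proof -
  have "max_origin_distance X \<ge> norm (X (vector [0, 0]))" by (rule norm_le_max)
  then have nn: "max_origin_distance X \<ge> 0" using norm_ge_zero order_trans by blast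
  have "(max_origin_distance X)\<^sup>2 > 0" using sq_le_max[of 0] r_pos[of 0]
    by (smt (verit) zero_less_power zero_le_power2)
  then show ?thesis using nn by (cases "max_origin_distance X = 0") auto
qed

lemma infdist_axis: "infdist (X p) rotation_axis = r (p $ 1)"
proof (rule antisym)
  have Xp: "X p = vector [r (p $ 1) * cos (p $ 2), r (p $ 1) * sin (p $ 2), z (p $ 1)]" by (simp add: X_eq)
  have n3: "norm x = sqrt ((x $ 1)\<^sup>2 + (x $ 2)\<^sup>2 + (x $ 3)\<^sup>2)" for x :: "real^3"
    unfolding norm_eq_sqrt_inner by (simp add: inner_vec_def sum_3 power2_eq_square)
  have rc: "(r (p $ 1) * cos (p $ 2))\<^sup>2 + (r (p $ 1) * sin (p $ 2))\<^sup>2 = (r (p $ 1))\<^sup>2"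
  proof -
    have "(r (p $ 1) * cos (p $ 2))\<^sup>2 + (r (p $ 1) * sin (p $ 2))\<^sup>2 = (r (p $ 1))\<^sup>2 * ((sin (p $ 2))\<^sup>2 + (cos (p $ 2))\<^sup>2)"
      by (simp only: power_mult_distrib distrib_left add.commute)
    then show ?thesis by simp
  qed
  have mem: "(vector [0, 0, z (p $ 1)] :: real^3) \<in> rotation_axis" by (simp add: rotation_axis_def vector_3)
  have "infdist (X p) rotation_axis \<le> dist (X p) (vector [0, 0, z (p $ 1)])" by (rule infdist_le[OF mem])
  also have "\<dots> = r (p $ 1)"
    unfolding dist_norm n3 Xp vector_minus_component vector_3 using rc r_pos[of "p $ 1"] by simp
  finally show "infdist (X p) rotation_axis \<le> r (p $ 1)" .
  have ne: "rotation_axis \<noteq> {}" using mem by blast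
  show "r (p $ 1) \<le> infdist (X p) rotation_axis"
    unfolding infdist_notempty[OF ne]
  proof (rule cINF_greatest[OF ne])
    fix y :: "real^3" assume y: "y \<in> rotation_axis"
    have "sqrt ((r (p $ 1))\<^sup>2) \<le> dist (X p) y"
      unfolding dist_norm n3 Xp vector_minus_component vector_3 using rc y by (intro real_sqrt_le_mono) (simp add: rotation_axis_def)
    then show "r (p $ 1) \<le> dist (X p) y" using r_pos[of "p $ 1"] by simp
  qed
qed

lemma min_axis: "min_axis_distance X > 0" "min_axis_distance X \<le> r s"
proof -
  obtain b where b: "b > 0" "\<And>s. r s \<ge> b"
    using periodic_pos_bounded_below[OF smooth_continuous[OF smooth_rz(1)] per_rz(1) r_pos] by blast
  have "b \<le> min_axis_distance X" unfolding min_axis_distance_def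
    by (rule cINF_greatest) (auto simp: infdist_axis b)
  then show "min_axis_distance X > 0" using b(1) by linarith
  have "min_axis_distance X \<le> infdist (X (vector [s, 0])) rotation_axis" unfolding min_axis_distance_def
    by (rule cINF_lower) (auto intro!: bdd_belowI2[of _ 0] infdist_nonneg)
  then show "min_axis_distance X \<le> r s" by (simp add: infdist_axis vector_2)
qed

text \<open>
  Both sides contain the factor \<open>Wm > 0\<close>; what remains is the comparison of \<open>V\<^sub>k\<close> with \<open>K\<^sup>2\<close>.
\<close>

lemma Qm_compare:
  shows "Qm k s \<ge> K\<^sup>2 * Pm s \<longleftrightarrow> K\<^sup>2 * (w s)\<^sup>2 \<le> 1 + (1 - (real k)\<^sup>2) / (r s)\<^sup>2"
    and "Qm k s \<le> K\<^sup>2 * Pm s \<longleftrightarrow> 1 + (1 - (real k)\<^sup>2) / (r s)\<^sup>2 \<le> K\<^sup>2 * (w s)\<^sup>2"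
proof -
  define A where "A = 1 + (1 - (real k)\<^sup>2) / (r s)\<^sup>2"
  have "K\<^sup>2 * Pm s = Wm s * (K\<^sup>2 * (w s)\<^sup>2)" unfolding Pm_def Wm_def using w_nz[of s] by (simp add: power2_eq_square)
  moreover have "Qm k s = Wm s * A" by (simp add: Qm_def A_def)
  ultimately show "Qm k s \<ge> K\<^sup>2 * Pm s \<longleftrightarrow> K\<^sup>2 * (w s)\<^sup>2 \<le> 1 + (1 - (real k)\<^sup>2) / (r s)\<^sup>2"
    "Qm k s \<le> K\<^sup>2 * Pm s \<longleftrightarrow> 1 + (1 - (real k)\<^sup>2) / (r s)\<^sup>2 \<le> K\<^sup>2 * (w s)\<^sup>2"
    using coeffs_pos(2)[of s] unfolding A_def[symmetric] by (simp_all only: mult_le_cancel_left_pos)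
qed

lemma w_sq: "(w s)\<^sup>2 = (r s)\<^sup>2 * exp (- (((r s)\<^sup>2 + (z s)\<^sup>2) / 2))"
proof -
  have "(exp (- ((r s)\<^sup>2 + (z s)\<^sup>2) / 4))\<^sup>2 = exp (- (((r s)\<^sup>2 + (z s)\<^sup>2) / 2))"
    unfolding power2_eq_square exp_add[symmetric] by (simp add: field_simps)
  then show ?thesis by (simp add: w_def power_mult_distrib)
qed

text \<open>
  With \<open>x = r\<^sup>2 / 2\<close> this is \<open>x \<le> exp (x - 1)\<close>, with equality on the circle of radius \<open>sqrt 2\<close> in
  the plane \<open>z = 0\<close>.
\<close>

lemma w_sq_upper: "(exp 1 / 2) * (w s)\<^sup>2 \<le> 1"
proof -
  define x where "x = (r s)\<^sup>2 / 2"
  have "exp (- (((r s)\<^sup>2 + (z s)\<^sup>2) / 2)) \<le> exp (- x)" by (simp add: x_def)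
  then have "(exp 1 / 2) * (w s)\<^sup>2 \<le> (exp 1 / 2) * ((r s)\<^sup>2 * exp (- x))"
    unfolding w_sq by (intro mult_left_mono) auto
  also have "\<dots> = x * (exp 1 * exp (- x))" by (simp add: x_def)
  also have "exp 1 * exp (- x) = exp (1 - x)" by (simp add: exp_add[symmetric])
  also have "x * exp (1 - x) \<le> exp (x - 1) * exp (1 - x)"
    using exp_ge_add_one_self[of "x - 1"] by (intro mult_right_mono) auto
  also have "\<dots> = 1" by (simp add: exp_add[symmetric])
  finally show ?thesis .
qed

lemma w_sq_lower: "(exp ((max_origin_distance X)\<^sup>2 / 4) / min_axis_distance X)\<^sup>2 * (w s)\<^sup>2 \<ge> 1"
proof -
  define R where "R = max_origin_distance X"
  define m where "m = min_axis_distance X"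
  have m: "0 < m" "m \<le> r s" using min_axis by (auto simp: m_def)
  have ex: "(exp (R\<^sup>2 / 4))\<^sup>2 = exp (R\<^sup>2 / 2)" unfolding power2_eq_square[of "exp _"] exp_add[symmetric] by simp
  have "exp (- (R\<^sup>2 / 2)) \<le> exp (- (((r s)\<^sup>2 + (z s)\<^sup>2) / 2))" using sq_le_max[of s] by (simp add: R_def)
  moreover have "m\<^sup>2 \<le> (r s)\<^sup>2" using m by (intro power_mono) auto
  ultimately have "m\<^sup>2 * exp (- (R\<^sup>2 / 2)) \<le> (w s)\<^sup>2" unfolding w_sq by (intro mult_mono) auto
  then have "(exp (R\<^sup>2 / 2) / m\<^sup>2) * (m\<^sup>2 * exp (- (R\<^sup>2 / 2))) \<le> (exp (R\<^sup>2 / 2) / m\<^sup>2) * (w s)\<^sup>2"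
    by (intro mult_left_mono) auto
  moreover have "(exp (R\<^sup>2 / 2) / m\<^sup>2) * (m\<^sup>2 * exp (- (R\<^sup>2 / 2))) = 1"
    using m by (simp add: exp_minus)
  ultimately show ?thesis unfolding R_def[symmetric] m_def[symmetric] power_divide ex by simp
qed

lemma len_pos: "pint Pm > 0"
proof -
  have D: "(antideriv Pm has_real_derivative Pm s) (at s)" for s
    by (rule antideriv(2)[OF smooth_continuous[OF smooth_coeffs(1)]])
  have "antideriv Pm 0 < antideriv Pm (2 * pi)"
    by (rule DERIV_pos_imp_increasing) (use D coeffs_pos(1) in auto)
  then show ?thesis using pint_FTC[OF D] by simp
qed

text \<open>
  Each mode \<open>k \<ge> 1\<close> counts twice, for cosine and sine.  In the lower bound the three copies of the modes
  0 and 1 contribute the constant \<open>- 3\<close>, in the upper bound fewer than \<open>1 + R\<close> modes \<open>k \<ge> 1\<close> lie below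
  the cutoff \<open>sqrt (1 + R\<^sup>2)\<close>; both then lose 4 to the trivial variations.
\<close>

theorem index_bounds:
  defines "F \<equiv> entropy X" and "R \<equiv> max_origin_distance X" and "m \<equiv> min_axis_distance X"
  obtains n where "index X = enat n" "3 * sqrt (2 * exp 1) / pi * F - 7 < real n"
    "real n < 2 / pi * (F / m) * exp (R\<^sup>2 / 4) * (3 + 1 / m + 2 * R) + 2 * R - 1"
proof -
  define L where "L = pint Pm"
  have FL: "F = L / 2" by (simp add: F_def L_def entropy_X)
  have L: "L > 0" using len_pos by (simp add: L_def)
  have R: "R > 0" using max_origin_pos by (simp add: R_def)
  have m: "m > 0" "\<And>s. m \<le> r s" using min_axis by (auto simp: m_def)
  have rR: "(r s)\<^sup>2 \<le> R\<^sup>2" for s using sq_le_max[of s] zero_le_power2[of "z s"] unfolding R_def by linarith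
  define K where "K = nat \<lceil>sqrt (1 + R\<^sup>2)\<rceil>"
  have sq1: "sqrt (1 + R\<^sup>2) > 1" using R by simp
  have sqR: "sqrt (1 + R\<^sup>2) < 1 + R" using R by (intro real_less_lsqrt) (auto simp: power2_eq_square algebra_simps)
  have K2: "K \<ge> 2" unfolding K_def using sq1 by linarith
  have KR: "real K - 1 < 1 + R" unfolding K_def using sq1 sqR by linarith
  have cut: "(real k)\<^sup>2 \<ge> 1 + (r s)\<^sup>2" if "k \<ge> K" for k s
  proof -
    have "sqrt (1 + R\<^sup>2) \<le> real k" using that unfolding K_def by linarith
    then have "1 + R\<^sup>2 \<le> (real k)\<^sup>2" using sqrt_le_D by blast
    then show ?thesis using rR[of s] by linarith
  qed
  define S where "S = (\<Sum>k<K. (if k = 0 then 1 else 2) * neg_count k)"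
  have idx: "index X = enat (S - 4)" and S4: "4 \<le> S"
    unfolding S_def by (rule index_eq[OF cut]; assumption)+
  have rS: "real (S - 4) = real S - 4" using S4 by (simp add: of_nat_diff)
  have Ssplit: "S = neg_count 0 + 2 * (\<Sum>k\<in>{1..<K}. neg_count k)"
  proof -
    have "{..<K} = insert 0 {1..<K}" using K2 by auto
    then show ?thesis unfolding S_def by (simp add: sum_distrib_left)
  qed
  \<comment> \<open>Below, only the modes 0 and 1 are kept, with the constant potential \<open>exp 1 / 2\<close>. In mode 0
    the excess \<open>1 / r\<^sup>2\<close> allows a slightly larger constant, which makes the inequality strict.\<close>
  define c1 where "c1 = sqrt (exp 1 / 2)"
  define c0 where "c0 = sqrt ((exp 1 / 2) * (1 + 1 / R\<^sup>2))"
  have c1: "c1 > 0" "c1\<^sup>2 = exp 1 / 2" by (auto simp: c1_def)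
  have c0: "c0 > c1" "c0\<^sup>2 = (exp 1 / 2) * (1 + 1 / R\<^sup>2)"
    using R unfolding c0_def c1_def by (auto simp: field_simps intro!: add_nonneg_nonneg)
  have n1: "real (neg_count 1) \<ge> c1 * L / pi - 1" unfolding L_def
  proof (rule neg_count_bounds(2)[OF c1(1)])
    show "Qm 1 s \<ge> c1\<^sup>2 * Pm s" for s unfolding Qm_compare unfolding c1(2) using w_sq_upper[of s] by simp
  qed
  have n0: "real (neg_count 0) \<ge> c0 * L / pi - 1" unfolding L_def
  proof (rule neg_count_bounds(2))
    show "c0 > 0" using c0 c1 by linarith
    show "Qm 0 s \<ge> c0\<^sup>2 * Pm s" for s unfolding Qm_compare unfolding c0(2)
    proof -
      have "(exp 1 / 2) * (1 + 1 / R\<^sup>2) * (w s)\<^sup>2 = ((exp 1 / 2) * (w s)\<^sup>2) * (1 + 1 / R\<^sup>2)" by (simp add: mult_ac)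
      also have "\<dots> \<le> 1 * (1 + 1 / R\<^sup>2)" by (intro mult_right_mono w_sq_upper) auto
      also have "1 / R\<^sup>2 \<le> 1 / (r s)\<^sup>2" using rR[of s] r_pos[of s] R by (intro divide_left_mono) auto
      finally show "(exp 1 / 2) * (1 + 1 / R\<^sup>2) * (w s)\<^sup>2 \<le> 1 + (1 - (real 0)\<^sup>2) / (r s)\<^sup>2" by simp
    qed
  qed
  have lower: "3 * sqrt (2 * exp 1) / pi * F - 7 < real (S - 4)"
  proof -
    have "1 \<in> {1..<K}" using K2 by simp
    then have "neg_count 1 \<le> (\<Sum>k\<in>{1..<K}. neg_count k)" by (intro member_le_sum) auto
    then have "neg_count 0 + 2 * neg_count 1 \<le> S" unfolding Ssplit by linarith
    then have "real (neg_count 0 + 2 * neg_count 1) \<le> real S" by (rule of_nat_mono)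
    then have "real (neg_count 0) + 2 * real (neg_count 1) \<le> real S" by (simp only: of_nat_add of_nat_mult of_nat_numeral)
    moreover have "c1 * L / pi < c0 * L / pi" using c0(1) L by (intro divide_strict_right_mono mult_strict_right_mono) auto
    ultimately have A: "3 * (c1 * L / pi) - 3 < real S" using n0 n1 by linarith
    have "sqrt (2 * exp 1) = 2 * c1"
      unfolding c1_def by (rule real_sqrt_unique) (simp_all add: power_mult_distrib)
    then have B: "3 * sqrt (2 * exp 1) / pi * F = 3 * (c1 * L / pi)" by (simp add: FL)
    show ?thesis unfolding B rS using A by linarith
  qed
  \<comment> \<open>Above, each mode below the cutoff is bounded by a constant potential; \<open>d1\<^sup>2\<close> serves for all
    \<open>k \<ge> 1\<close>, and mode 0 has the additional term \<open>1 / r\<^sup>2\<close>.\<close>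
  define d1 where "d1 = exp (R\<^sup>2 / 4) / m"
  define d0 where "d0 = d1 * (1 + 1 / m)"
  have d1: "d1 > 0" "\<And>s. d1\<^sup>2 * (w s)\<^sup>2 \<ge> 1" using w_sq_lower m by (auto simp: d1_def R_def m_def)
  have u1: "real (neg_count k) < d1 * L / pi + 1" if "k \<ge> 1" for k unfolding L_def
  proof (rule neg_count_bounds(1)[OF d1(1)])
    fix s
    have "(1 - (real k)\<^sup>2) / (r s)\<^sup>2 \<le> 0" using that by (intro divide_nonpos_nonneg) auto
    then show "Qm k s \<le> d1\<^sup>2 * Pm s" unfolding Qm_compare using d1(2)[of s] by linarith
  qed
  have u0: "real (neg_count 0) < d0 * L / pi + 1" unfolding L_def
  proof (rule neg_count_bounds(1))
    show "d0 > 0" unfolding d0_def using m(1) by (intro mult_pos_pos d1(1) add_pos_pos) auto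
    fix s
    have "1 / (r s)\<^sup>2 \<le> 1 / m\<^sup>2" using m(1) m(2)[of s] by (intro divide_left_mono power_mono) auto
    also have "1 / m\<^sup>2 \<le> (1 + 1 / m)\<^sup>2 - 1" using m by (simp add: power2_eq_square field_simps)
    finally have "1 + 1 / (r s)\<^sup>2 \<le> (1 + 1 / m)\<^sup>2 * 1" by simp
    also have "\<dots> \<le> (1 + 1 / m)\<^sup>2 * (d1\<^sup>2 * (w s)\<^sup>2)" by (intro mult_left_mono d1) auto
    finally show "Qm 0 s \<le> d0\<^sup>2 * Pm s" unfolding Qm_compare d0_def by (simp add: power_mult_distrib mult_ac)
  qed
  have upper: "real (S - 4) < 2 / pi * (F / m) * exp (R\<^sup>2 / 4) * (3 + 1 / m + 2 * R) + 2 * R - 1"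
  proof -
    define b where "b = d1 * L / pi + 1"
    have b: "b > 0" using d1 L by (auto simp: b_def intro!: add_pos_pos)
    have "(\<Sum>k\<in>{1..<K}. real (neg_count k)) \<le> (\<Sum>k\<in>{1..<K}. b)"
      by (intro sum_mono) (use u1 in \<open>auto simp: b_def less_imp_le\<close>)
    also have "\<dots> = (real K - 1) * b" using K2 by (simp add: of_nat_diff)
    also have "\<dots> \<le> (1 + R) * b" using KR b by (intro mult_right_mono) auto
    finally have "real S < d0 * L / pi + 1 + 2 * ((1 + R) * b)" using u0 unfolding Ssplit by simp
    also have "\<dots> = 2 / pi * (F / m) * exp (R\<^sup>2 / 4) * (3 + 1 / m + 2 * R) + 2 * R + 3"
      unfolding b_def d0_def d1_def FL using m by (simp add: field_simps)
    finally show ?thesis unfolding rS by linarith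
  qed
  show ?thesis using that[OF idx lower upper] .
qed

end

theorem theorem1p1:
  fixes \<gamma> :: "real \<Rightarrow> real \<times> real" and \<Sigma> :: "real^2 \<Rightarrow> real^3" and F r_min R :: real
  assumes "closed_half_plane_curve \<gamma>"
    and "\<Sigma> = torus_of_revolution \<gamma>"
    and "self_shrinker \<Sigma>"
    and "F = entropy \<Sigma>"
    and "r_min = min_axis_distance \<Sigma>"
    and "R = max_origin_distance \<Sigma>"
  shows "ereal (3 * sqrt (2 * exp 1) / pi * F - 7) < ereal_of_enat (index \<Sigma>) \<and>
    ereal_of_enat (index \<Sigma>) <
      ereal (2 / pi * (F / r_min) * exp (R\<^sup>2 / 4) * (3 + 1 / r_min + 2 * R) + 2 * R - 1)"
proof -
  interpret shrinker_profile "\<lambda>s. fst (\<gamma> s)" "\<lambda>s. snd (\<gamma> s)"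
    using shrinker_profile_of_curve assms(1-3) by blast
  have X: "X = \<Sigma>" unfolding assms(2) by simp
  obtain n where "index \<Sigma> = enat n" "3 * sqrt (2 * exp 1) / pi * F - 7 < real n"
    "real n < 2 / pi * (F / r_min) * exp (R\<^sup>2 / 4) * (3 + 1 / r_min + 2 * R) + 2 * R - 1"
    using index_bounds unfolding X assms(4-6)[symmetric] by blast
  then show ?thesis by simp
qed

end
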